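(* Let $N\ge 1$ and let $\mathcal{H}$ be either the Hardy space $H^2(B_N)$ or a weighted Bergman space $A^2_s(B_N)$ with $s>-1$. Suppose that $\varphi$ is a linear fractional self-map of $B_N$ with $\|\varphi\|_\infty=1$, and let $\sigma$ be the adjoint map of $\varphi$. Then the operator $C_{\varphi\circ\sigma}-C_{\sigma\circ\varphi}$ is compact on $\mathcal{H}$ if and only if $\varphi\circ\sigma=\sigma\circ\varphi$.
   Context: $B_N$ is the open unit ball of $\mathbb{C}^N$, $\partial B_N$ the unit sphere, $\langle\cdot,\cdot\rangle$ the standard Hermitian inner product, $\mu$ normalized Lebesgue measure on $\partial B_N$, $\nu$ normalized Lebesgue volume measure on $B_N$. $H^2(B_N)$ is the Hilbert space of holomorphic $f$ on $B_N$ with $\|f\|_2^2=\sup_{0<r<1}\int_{\partial B_N}|f(r\zeta)|^2\,d\mu(\zeta)<\infty$. For $s>-1$, $A^2_s(B_N)$ is the Hilbert space of holomorphic $f$ on $B_N$ with $\|f\|_{2,s}^2=\int_{B_N}|f(z)|^2 w_s(z)\,d\nu(z)<\infty$, where $w_s(z)=\frac{\Gamma(N+s+1)}{\Gamma(N+1)\Gamma(s+1)}(1-|z|^2)^s$. For an analytic map $\varphi:B_N\to B_N$, $C_\varphi f=f\circ\varphi$ and $\|\varphi\|_\infty=\sup_{z\in B_N}|\varphi(z)|$. A linear fractional map of $\mathbb{C}^N$ is a map of the form $\varphi(z)=\frac{Az+B}{\langle z,C\rangle+d}$, where $A$ is an $N\times N$ complex matrix, $B,C$ are column vectors in $\mathbb{C}^N$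 and $d\in\mathbb{C}$. It is a linear fractional self-map of $B_N$ if it maps $B_N$ into $B_N$ (with the denominator nonvanishing on $\overline{B_N}$, so that $\varphi$ is holomorphic in a neighborhood of $\overline{B_N}$). The adjoint map of such $\varphi$ is $$\sigma(z)=\frac{A^*z-C}{\langle z,-B\rangle+\overline{d}},$$ which is again a linear fractional self-map of $B_N$ (Cowen–MacCluer). For every linear fractional self-map of $B_N$ the induced composition operator is bounded on $H^2(B_N)$ and on $A^2_s(B_N)$, $s>-1$ (Cowen–MacCluer). *)

theory Defs
  imports "HOL-Analysis.Analysis"
begin

definition hinner :: "complex^'n \<Rightarrow> complex^'n \<Rightarrow> complex" where
  "hinner z w = (\<Sum>i\<in>UNIV. z $ i * cnj (w $ i))"

definition conj_transpose :: "complex^'n^'m \<Rightarrow> complex^'m^'n" where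
  "conj_transpose A = (\<chi> i j. cnj (A $ j $ i))"

definition holomorphic_on_ball :: "(complex^'n \<Rightarrow> complex) \<Rightarrow> bool" where
  "holomorphic_on_ball f \<longleftrightarrow>
     (\<forall>z\<in>ball 0 1. \<exists>L. (f has_derivative L) (at z) \<and> (\<forall>c v. L (c *s v) = c * L v))"

definition ball_measure :: "(complex^'n) measure" where
  "ball_measure = restrict_space (uniform_measure lborel (ball 0 1)) (ball 0 1)"

text \<open>
  By polar coordinates, the normalized surface measure of a Borel set \<open>E\<close> of the unit sphere is
  the normalized volume of the cone of all \<open>r\<zeta>\<close> with \<open>0 < r < 1\<close> and \<open>\<zeta> \<in> E\<close>, i.e. of the
  preimage of \<open>E\<close> under the radial projection \<open>sgn z = z / |z|\<close>. The origin is a null set.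
\<close>

definition sphere_measure :: "(complex^'n) measure" where
  "sphere_measure =
     restrict_space (distr (uniform_measure lborel (ball 0 1)) borel sgn) (sphere 0 1)"

text \<open>
  Functions on the ball are represented by total functions; all notions below only depend on the
  values on the ball, and functions that agree there have distance 0 in either norm.
\<close>

definition hardy_sqnorm :: "(complex^'n \<Rightarrow> complex) \<Rightarrow> ennreal" where
  "hardy_sqnorm f =
     (SUP r\<in>{0<..<1::real}. \<integral>\<^sup>+\<zeta>. ennreal ((cmod (f (r *\<^sub>R \<zeta>)))\<^sup>2) \<partial>sphere_measure)"

definition hardy_space :: "(complex^'n \<Rightarrow> complex) set" where
  "hardy_space = {f. holomorphic_on_ball f \<and> hardy_sqnorm f < \<infinity>}"

definition hardy_norm :: "(complex^'n \<Rightarrow> complex) \<Rightarrow> real" where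
  "hardy_norm f = sqrt (enn2real (hardy_sqnorm f))"

definition bergman_weight :: "real \<Rightarrow> complex^'n \<Rightarrow> real" where
  "bergman_weight s z =
     Gamma (real CARD('n) + s + 1) / (Gamma (real CARD('n) + 1) * Gamma (s + 1))
       * (1 - (norm z)\<^sup>2) powr s"

definition bergman_sqnorm :: "real \<Rightarrow> (complex^'n \<Rightarrow> complex) \<Rightarrow> ennreal" where
  "bergman_sqnorm s f =
     (\<integral>\<^sup>+z. ennreal ((cmod (f z))\<^sup>2 * bergman_weight s z) \<partial>ball_measure)"

definition bergman_space :: "real \<Rightarrow> (complex^'n \<Rightarrow> complex) set" where
  "bergman_space s = {f. holomorphic_on_ball f \<and> bergman_sqnorm s f < \<infinity>}"

definition bergman_norm :: "real \<Rightarrow> (complex^'n \<Rightarrow> complex) \<Rightarrow> real" where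
  "bergman_norm s f = sqrt (enn2real (bergman_sqnorm s f))"

definition compact_operator_on ::
  "('a \<Rightarrow> complex) set \<Rightarrow> (('a \<Rightarrow> complex) \<Rightarrow> real) \<Rightarrow> (('a \<Rightarrow> complex) \<Rightarrow> 'a \<Rightarrow> complex) \<Rightarrow> bool"
  where
  "compact_operator_on H nrm T \<longleftrightarrow>
     (\<forall>f\<in>H. T f \<in> H) \<and>
     (\<forall>F :: nat \<Rightarrow> 'a \<Rightarrow> complex. (\<forall>k. F k \<in> H) \<and> (\<exists>M. \<forall>k. nrm (F k) \<le> M) \<longrightarrow>
        (\<exists>g\<in>H. \<exists>r :: nat \<Rightarrow> nat. strict_mono r \<and>
           (\<lambda>k. nrm (\<lambda>z. T (F (r k)) z - g z)) \<longlonglongrightarrow> 0))"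

definition comp_op :: "('a \<Rightarrow> 'a) \<Rightarrow> ('a \<Rightarrow> complex) \<Rightarrow> 'a \<Rightarrow> complex" where
  "comp_op \<phi> f = f \<circ> \<phi>"

definition lin_frac_map ::
  "complex^'n^'n \<Rightarrow> complex^'n \<Rightarrow> complex^'n \<Rightarrow> complex \<Rightarrow> complex^'n \<Rightarrow> complex^'n" where
  "lin_frac_map A B C d z = (1 / (hinner z C + d)) *s (A *v z + B)"

definition lin_frac_self_map ::
  "complex^'n^'n \<Rightarrow> complex^'n \<Rightarrow> complex^'n \<Rightarrow> complex \<Rightarrow> bool" where
  "lin_frac_self_map A B C d \<longleftrightarrow>
     (\<forall>z\<in>cball 0 1. hinner z C + d \<noteq> 0) \<and>
     lin_frac_map A B C d ` ball 0 1 \<subseteq> ball 0 1"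

definition adjoint_map ::
  "complex^'n^'n \<Rightarrow> complex^'n \<Rightarrow> complex^'n \<Rightarrow> complex \<Rightarrow> complex^'n \<Rightarrow> complex^'n" where
  "adjoint_map A B C d = lin_frac_map (conj_transpose A) (- C) (- B) (cnj d)"

definition sup_norm_ball :: "(complex^'n \<Rightarrow> complex^'n) \<Rightarrow> real" where
  "sup_norm_ball \<phi> = (SUP z\<in>ball 0 1. norm (\<phi> z))"

end

theory Submission
  imports Defs "HOL-Complex_Analysis.Complex_Analysis"
begin

text \<open>
  Both \<open>\<psi>\<^sub>1 = \<phi> \<circ> \<sigma>\<close> and \<open>\<psi>\<^sub>2 = \<sigma> \<circ> \<phi>\<close>
  satisfy \<open>1 - \<langle>\<psi> z, w\<rangle> = N(z, w) / N(z, 0)\<close> for a Hermitian sesqui-affine form \<open>N\<close>. If \<open>|\<phi> \<zeta>| = 1\<close>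
  with \<open>|\<zeta>| = 1\<close>, then \<open>\<eta> = \<phi> \<zeta>\<close> is a fixed point of \<open>\<psi>\<^sub>1\<close>. At a boundary fixed point the linear part
  of \<open>N\<close> is determined up to a real factor, so only its quadratic part \<open>Q\<close> is free.

  Compactness is tested on the normalized kernel powers
  \<open>(1 - |w|\<^sup>2)\<^bsup>m - \<gamma>/2\<^esup> / (1 - \<langle>\<cdot>, w\<rangle>)\<^bsup>m\<^esup>\<close>, evaluated at \<open>z\<close>, where \<open>z\<close> and \<open>w\<close> approach \<open>\<eta>\<close> along
  the curves \<open>\<eta> + s\<alpha> - s\<^sup>2\<kappa>\<eta>\<close> with \<open>\<langle>\<alpha>, \<eta>\<rangle> = -i\<close>. These are tangential enough that \<open>1 - |z|\<^sup>2\<close>, \<open>1 - |w|\<^sup>2\<close>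
  and \<open>1 - \<langle>\<psi>\<^sub>1 z, w\<rangle>\<close> are all of order \<open>s\<^sup>2\<close>, and the coefficient of \<open>s\<^sup>2\<close> sees all of \<open>Q\<close>. Compactness of
  the difference forces the coefficients for \<open>\<psi>\<^sub>1\<close> and \<open>\<psi>\<^sub>2\<close> to agree, hence the forms, hence the maps.
\<close>

section \<open>The Hermitian inner product and unitary invariance of Lebesgue measure\<close>

text \<open>The argument uses neither reproducing kernels nor weak convergence. Powers of
  \<open>1 / (1 - hinner z w)\<close> take the place of the kernel of the space: an upper bound for
  their norms and a growth bound for point evaluations with the matching exponent are all that is
  needed, and both follow from the same volume estimates for the Hardy and the Bergman spaces. The
  order m is an integer even where \<gamma> is not, at the price that only m-th powers of limits are
  compared; two consecutive orders repair this.

  The condition on \<alpha> shapes the geometry. A nontangential approach sees only the linear part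
  of the form, which carries no information beyond the fixed point. An imaginary \<langle>\<alpha>,
  \<eta>\<rangle> keeps the curves tangential, and equal values for both curves make the terms of
  order s cancel. The value must not be 0: complex tangential directions alone would miss the values
  of Q that involve \<eta>, and for N = 1 there are none besides 0.\<close>

lemma hinner_add_left: "hinner (x + y) z = hinner x z + hinner y z"
  by (simp add: hinner_def algebra_simps sum.distrib)

lemma hinner_add_right: "hinner x (y + z) = hinner x y + hinner x z"
  by (simp add: hinner_def algebra_simps sum.distrib)

lemma hinner_scale_left: "hinner (c *s x) y = c * hinner x y"
  by (simp add: hinner_def sum_distrib_left mult.assoc)

lemma hinner_scale_right: "hinner x (c *s y) = cnj c * hinner x y"
  by (simp add: hinner_def sum_distrib_left algebra_simps)

lemma scaleR_eq_scale: "r *\<^sub>R (x :: complex^'n) = of_real r *s x"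
  by (simp add: vec_eq_iff vector_scaleR_component scaleR_conv_of_real[where 'a=complex])

lemma hinner_minus_left: "hinner (- x) y = - hinner x y"
  by (simp add: hinner_def sum_negf)

lemma hinner_minus_right: "hinner x (- y) = - hinner x y"
  by (simp add: hinner_def sum_negf)

lemma hinner_diff_left: "hinner (x - y) z = hinner x z - hinner y z"
  by (simp add: hinner_def algebra_simps sum_subtractf)

lemma hinner_diff_right: "hinner x (y - z) = hinner x y - hinner x z"
  by (simp add: hinner_def algebra_simps sum_subtractf)

lemma hinner_zero [simp]: "hinner 0 x = 0" "hinner x 0 = 0"
  by (simp_all add: hinner_def)

lemmas hinner_simps = hinner_add_left hinner_add_right hinner_scale_left hinner_scale_right
  hinner_minus_left hinner_minus_right hinner_diff_left hinner_diff_right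

lemma hinner_scaleR_left: "hinner (r *\<^sub>R x) y = of_real r * hinner x y"
  by (simp add: scaleR_eq_scale hinner_simps)

lemma cnj_hinner: "cnj (hinner x y) = hinner y x"
  by (simp add: hinner_def mult.commute)

lemma Re_hinner: "Re (hinner x y) = x \<bullet> y"
  by (simp add: hinner_def inner_vec_def Re_sum inner_complex_def)

lemma hinner_self: "hinner x x = of_real ((norm x)\<^sup>2)"
proof -
  have "Im (hinner x x) = 0"
    using cnj_hinner[of x x] by (metis complex_cnj_cancel_iff Reals_cnj_iff complex_is_Real_iff)
  then show ?thesis
    by (simp add: complex_eq_iff Re_hinner power2_norm_eq_inner)
qed

lemma norm_scale_vec: "norm (c *s (x :: complex^'n)) = cmod c * norm x"
proof -
  have "complex_of_real ((norm (c *s x))\<^sup>2) = of_real ((cmod c * norm x)\<^sup>2)"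
    unfolding hinner_self[symmetric] hinner_simps
    using complex_norm_square[of c]
    by (simp add: hinner_self power_mult_distrib mult.assoc[symmetric] mult.commute[of c])
  then show ?thesis
    by (simp only: of_real_eq_iff) (simp add: power2_eq_iff_nonneg)
qed

lemma cmod_hinner_le: "cmod (hinner x y) \<le> norm x * norm y"
proof (cases "hinner x y = 0")
  case False
  \<comment> \<open>A phase that makes the product real, so that the real Cauchy-Schwarz inequality
    applies.\<close>
  define c where "c = cnj (hinner x y) / cmod (hinner x y)"
  have "c * hinner x y = cmod (hinner x y)"
    using False by (simp add: c_def complex_norm_square[symmetric] mult.commute[of "cnj _"] power2_eq_square)
  then have "cmod (hinner x y) = (c *s x) \<bullet> y"
    by (metis Re_complex_of_real Re_hinner hinner_scale_left)
  also have "\<dots> \<le> norm (c *s x) * norm y"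
    by (rule norm_cauchy_schwarz)
  also have "norm (c *s x) = norm x"
    using False by (simp add: norm_scale_vec c_def norm_divide)
  finally show ?thesis .
qed simp

text \<open>The equality case of Cauchy-Schwarz. It identifies points from a single value of the
  pairing, and so detects boundary fixed points.\<close>

lemma hinner_eq_1_unit:
  assumes "hinner x y = 1" "norm x \<le> 1" "norm y \<le> 1"
  shows "x = y"
proof -
  have "x \<bullet> y = 1"
    using assms(1) Re_hinner[of x y] by simp
  moreover have "(norm (x - y))\<^sup>2 = (norm x)\<^sup>2 + (norm y)\<^sup>2 - 2 * (x \<bullet> y)"
    by (simp add: power2_norm_eq_inner inner_diff inner_commute)
  moreover have "(norm x)\<^sup>2 \<le> 1" "(norm y)\<^sup>2 \<le> 1"
    using assms by (auto intro: power_le_one)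
  ultimately have "(norm (x - y))\<^sup>2 \<le> 0"
    by simp
  then show ?thesis by simp
qed

lemma hinner_ext: "(\<And>w. hinner x w = hinner y w) \<Longrightarrow> x = y"
proof -
  assume "\<And>w. hinner x w = hinner y w"
  then have "hinner (x - y) (x - y) = 0"
    by (simp add: hinner_simps)
  then show ?thesis by (simp add: hinner_self)
qed

lemma norm_diff_hinner_le:
  assumes "norm z \<le> 1"
  shows "1 - norm w \<le> cmod (1 - hinner z w)"
proof -
  have "cmod (hinner z w) \<le> norm z * norm w" by (rule cmod_hinner_le)
  also have "\<dots> \<le> norm w" using assms by (simp add: mult_left_le_one_le)
  finally show ?thesis
    using norm_triangle_ineq2[of 1 "hinner z w"] by simp
qed

lemma continuous_on_hinner [continuous_intros]:
  "continuous_on S f \<Longrightarrow> continuous_on S g \<Longrightarrow> continuous_on S (\<lambda>x. hinner (f x) (g x))"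
  unfolding hinner_def by (intro continuous_intros)

lemma continuous_on_scale_vec [continuous_intros]:
  fixes f :: "'a :: topological_space \<Rightarrow> complex"
  shows "continuous_on S f \<Longrightarrow> continuous_on S g \<Longrightarrow> continuous_on S (\<lambda>x. f x *s g x)"
  by (simp add: vector_scalar_mult_def) (intro continuous_intros)

lemma continuous_on_matrix_vector_mult [continuous_intros]:
  fixes A :: "complex^'n^'m"
  shows "continuous_on S f \<Longrightarrow> continuous_on S (\<lambda>x. A *v f x)"
  by (simp add: matrix_vector_mult_def) (intro continuous_intros)

lemma hinner_conj_transpose: "hinner (conj_transpose A *v x) y = hinner x (A *v y)"
proof -
  have "hinner (conj_transpose A *v x) y = (\<Sum>i\<in>UNIV. \<Sum>j\<in>UNIV. cnj (A $ j $ i) * x $ j * cnj (y $ i))"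
    by (simp add: hinner_def conj_transpose_def matrix_vector_mult_def sum_distrib_right)
  also have "\<dots> = (\<Sum>j\<in>UNIV. \<Sum>i\<in>UNIV. cnj (A $ j $ i) * x $ j * cnj (y $ i))"
    by (rule sum.swap)
  also have "\<dots> = hinner x (A *v y)"
    by (simp add: hinner_def matrix_vector_mult_def sum_distrib_left mult_ac)
  finally show ?thesis .
qed

lemma hinner_conj_transpose': "hinner x (conj_transpose A *v y) = hinner (A *v x) y"
  by (metis cnj_hinner hinner_conj_transpose)

lemma linear_hinner: "linear (\<lambda>x. hinner x y)"
  by (rule linearI) (simp_all add: hinner_simps hinner_scaleR_left scaleR_conv_of_real[where 'a=complex])

text \<open>A complex Householder reflection; the phase makes the inner product of \<open>z\<close> with its
  target real, which is what the reflection needs.\<close>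

lemma unitary_to_axis_exists:
  fixes z :: "complex^'n" and i :: 'n
  obtains U where "linear U" "\<And>x y. hinner (U x) (U y) = hinner x y"
    "\<exists>\<theta>. cmod \<theta> = 1 \<and> U z = axis i (\<theta> * of_real (norm z))"
proof -
  define \<theta> where "\<theta> = (if z $ i = 0 then 1 else z $ i / cmod (z $ i))"
  have \<theta>: "cmod \<theta> = 1"
    by (simp add: \<theta>_def norm_divide)
  define b where "b = axis i (\<theta> * of_real (norm z))"
  have h: "hinner z b = cmod (z $ i) * norm z"
  proof -
    have "hinner z b = (\<Sum>j\<in>UNIV. if j = i then z $ i * cnj (\<theta> * of_real (norm z)) else 0)"
      unfolding hinner_def by (rule sum.cong) (auto simp: b_def axis_def)
    also have "\<dots> = z $ i * cnj \<theta> * norm z"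
      by simp
    also have "z $ i * cnj \<theta> = cmod (z $ i)"
      by (simp add: \<theta>_def complex_norm_square[symmetric] power2_eq_square)
    finally show ?thesis by simp
  qed
  have nb: "norm b = norm z"
    using \<theta> by (simp add: b_def norm_eq_sqrt_inner[of "axis i _"] inner_axis_axis norm_eq_sqrt_inner[symmetric] norm_mult)
  define v where "v = z - b"
  have hb: "hinner b z = hinner z b"
    by (metis h cnj_hinner complex_cnj_complex_of_real)
  \<comment> \<open>Since \<open>hinner z b\<close> is real and |b| = |z|, both sides equal
    \<open>2 * ((norm z)\<^sup>2 - hinner z b)\<close>. This makes the reflection subtract exactly v
    from z.\<close>
  have vv: "hinner v v = 2 * hinner z v"
    using nb hb hinner_self[of z] hinner_self[of b]
    by (simp add: v_def hinner_simps algebra_simps del: of_real_power)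
  define q where "q = (norm v)\<^sup>2"
  define U where "U x = x - (2 * hinner x v / q) *s v" for x
  have "linear U"
    by (rule linearI) (auto simp: U_def hinner_simps hinner_scaleR_left add_divide_distrib
        algebra_simps vec_eq_iff scaleR_conv_of_real[where 'a=complex])
  moreover have "hinner (U x) (U y) = hinner x y" for x y
  proof (cases "v = 0")
    case False
    then have q: "complex_of_real q \<noteq> 0" by (simp add: q_def)
    have "cnj (hinner y v) = hinner v y" by (rule cnj_hinner)
    then show ?thesis
      using q by (simp add: U_def hinner_simps hinner_self[of v, folded q_def] field_simps)
  qed (simp add: U_def)
  moreover have "U z = b"
  proof (cases "v = 0")
    case False
    then have "2 * hinner z v / q = 1"
      using vv[symmetric] by (simp add: hinner_self q_def)
    then show ?thesis by (simp add: U_def v_def)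
  qed (simp add: U_def v_def)
  ultimately show ?thesis
    using that \<theta> b_def by blast
qed

lemma unitary_orthogonal_transformation:
  fixes U :: "complex^'n \<Rightarrow> complex^'n"
  assumes "linear U" "\<And>x y. hinner (U x) (U y) = hinner x y"
  shows "orthogonal_transformation U"
  using assms unfolding orthogonal_transformation_def by (metis Re_hinner)

lemma orthogonal_transformation_phase:
  assumes "cmod c = 1"
  shows "orthogonal_transformation (\<lambda>x :: complex^'n. c *s x)"
proof (rule unitary_orthogonal_transformation)
  show "linear (\<lambda>x :: complex^'n. c *s x)"
    by (rule linearI) (simp_all add: vec_eq_iff algebra_simps)
  show "hinner (c *s x) (c *s y) = hinner x y" for x y :: "complex^'n"
    using complex_norm_square[of c] assms by (simp add: hinner_simps mult.assoc[symmetric] mult.commute[of "cnj c"])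
qed

section \<open>Lebesgue measure under translations, dilations and rotations\<close>

lemma nn_integral_lborel_translate:
  fixes f :: "'a :: euclidean_space \<Rightarrow> ennreal"
  assumes [measurable]: "f \<in> borel_measurable borel"
  shows "(\<integral>\<^sup>+x. f (x + a) \<partial>lborel) = (\<integral>\<^sup>+x. f x \<partial>lborel)"
proof -
  have "(\<integral>\<^sup>+x. f x \<partial>lborel) = (\<integral>\<^sup>+x. f x \<partial>distr lborel borel (\<lambda>x. a + x))"
    by (simp add: lborel_distr_plus)
  also have "\<dots> = (\<integral>\<^sup>+x. f (x + a) \<partial>lborel)"
    by (subst nn_integral_distr) (auto simp: add.commute)
  finally show ?thesis by simp
qed

lemma nn_integral_lborel_dilate:
  fixes f :: "'a :: euclidean_space \<Rightarrow> ennreal"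
  assumes [measurable]: "f \<in> borel_measurable borel" and "c > 0"
  shows "(\<integral>\<^sup>+x. f (c *\<^sub>R x) \<partial>lborel) = ennreal (1 / c ^ DIM('a)) * (\<integral>\<^sup>+x. f x \<partial>lborel)"
proof -
  have "(\<integral>\<^sup>+x. f x \<partial>lborel) = ennreal (c ^ DIM('a)) * (\<integral>\<^sup>+x. f (c *\<^sub>R x) \<partial>lborel)"
    using \<open>c > 0\<close> by (subst lborel_affine[of c 0]) (simp_all add: nn_integral_density nn_integral_distr nn_integral_cmult)
  moreover have "ennreal (1 / c ^ DIM('a)) * ennreal (c ^ DIM('a)) = 1"
    using \<open>c > 0\<close> by (simp add: ennreal_mult[symmetric])
  ultimately show ?thesis by (simp add: mult.assoc[symmetric])
qed

text \<open>Uniqueness of translation-invariant measures: Fubini gives \<open>\<nu> A * \<lambda> B = \<nu> B * \<lambda> A\<close> for the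
  image \<open>\<nu>\<close> of \<open>\<lambda> = lborel\<close>, and the unit ball, preserved by the map, fixes the constant.\<close>

lemma distr_lborel_orthogonal:
  fixes U :: "'a :: euclidean_space \<Rightarrow> 'a"
  assumes U: "orthogonal_transformation U"
  shows "distr lborel borel U = lborel"
proof -
  have lin: "linear U" using U by (rule orthogonal_transformation_linear)
  have [measurable]: "U \<in> borel \<rightarrow>\<^sub>M borel"
    using linear_continuous_on[of U UNIV] lin
    by (intro borel_measurable_continuous_onI) (simp add: linear_conv_bounded_linear)
  define \<nu> where "\<nu> = distr lborel borel U"
  have [measurable_cong]: "sets \<nu> = sets borel" by (simp add: \<nu>_def)
  obtain V where V: "\<And>x. U (V x) = x"
    using orthogonal_transformation_surj[OF U] by (metis surj_def)
  have int_\<nu>: "(\<integral>\<^sup>+x. f x \<partial>\<nu>) = (\<integral>\<^sup>+x. f (U x) \<partial>lborel)"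
    if "f \<in> borel_measurable borel" for f :: "'a \<Rightarrow> ennreal"
    using that by (simp add: \<nu>_def nn_integral_distr)
  have trans_\<nu>: "(\<integral>\<^sup>+x. f (x + a) \<partial>\<nu>) = (\<integral>\<^sup>+x. f x \<partial>\<nu>)"
    if [measurable]: "f \<in> borel_measurable borel" for f :: "'a \<Rightarrow> ennreal" and a
  proof -
    have "(\<integral>\<^sup>+x. f (x + a) \<partial>\<nu>) = (\<integral>\<^sup>+x. f (U (x + V a)) \<partial>lborel)"
      using lin by (subst int_\<nu>) (auto simp: linear_add V)
    also have "\<dots> = (\<integral>\<^sup>+x. f (U x) \<partial>lborel)"
      by (rule nn_integral_lborel_translate) auto
    finally show ?thesis by (simp add: int_\<nu>)
  qed
  have "sigma_finite_measure \<nu>"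
  proof -
    let ?A = "range (\<lambda>n. U ` ball 0 (real n))"
    have b: "U ` ball 0 (real n) = ball 0 (real n)" for n
      using image_orthogonal_transformation_ball[OF U, of 0] lin by (simp add: linear_0)
    have A: "?A \<subseteq> sets \<nu>" by (auto simp: b)
    have un: "\<Union> ?A = space \<nu>"
      unfolding b by (auto simp: \<nu>_def) (metis reals_Archimedean2)
    have "emeasure \<nu> (ball 0 (real n)) < \<infinity>" for n
    proof -
      have "U -` ball 0 (real n) = ball 0 (real n)"
        using orthogonal_transformation_norm[OF U] by auto
      then show ?thesis
        using emeasure_lborel_ball_finite[of "0::'a" "real n"] by (simp add: \<nu>_def emeasure_distr)
    qed
    then have "\<forall>a\<in>?A. emeasure \<nu> a \<noteq> \<infinity>" by (auto simp: b less_top)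
    then show ?thesis
      using A un by (intro sigma_finite_measure.intro exI[of _ ?A]) auto
  qed
  then interpret \<nu>: sigma_finite_measure \<nu> .
  interpret pair_sigma_finite \<nu> lborel ..
  \<comment> \<open>Shifting y by x, exchanging the integrals and then shifting x by -y trades the
    roles of the two measures. The price is a reflection of A, removed at the end by the invariance
    of Lebesgue measure itself under \<open>uminus\<close>.\<close>
  have main: "emeasure \<nu> A * emeasure lborel B = emeasure \<nu> B * emeasure lborel (uminus -` A)"
    if [measurable]: "A \<in> sets borel" "B \<in> sets borel" for A B :: "'a set"
  proof -
    have "emeasure \<nu> A * emeasure lborel B = (\<integral>\<^sup>+x. indicator A x * emeasure lborel B \<partial>\<nu>)"
      by (simp add: nn_integral_multc)
    also have "\<dots> = (\<integral>\<^sup>+x. \<integral>\<^sup>+y. indicator A x * indicator B y \<partial>lborel \<partial>\<nu>)"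
      by (simp add: nn_integral_cmult)
    also have "\<dots> = (\<integral>\<^sup>+x. \<integral>\<^sup>+y. indicator A x * indicator B (y + x) \<partial>lborel \<partial>\<nu>)"
      by (intro nn_integral_cong nn_integral_lborel_translate[symmetric]) measurable
    also have "\<dots> = (\<integral>\<^sup>+y. \<integral>\<^sup>+x. indicator A x * indicator B (y + x) \<partial>\<nu> \<partial>lborel)"
      by (rule Fubini'[symmetric]) measurable
    also have "\<dots> = (\<integral>\<^sup>+y. \<integral>\<^sup>+x. indicator A (x - y) * indicator B x \<partial>\<nu> \<partial>lborel)"
    proof (rule nn_integral_cong)
      fix y :: 'a
      show "(\<integral>\<^sup>+x. indicator A x * indicator B (y + x) \<partial>\<nu>) = (\<integral>\<^sup>+x. indicator A (x - y) * indicator B x \<partial>\<nu>)"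
        using trans_\<nu>[of "\<lambda>x. indicator A x * indicator B (y + x)" "-y"] by simp
    qed
    also have "\<dots> = (\<integral>\<^sup>+x. \<integral>\<^sup>+y. indicator A (x - y) * indicator B x \<partial>lborel \<partial>\<nu>)"
      by (rule Fubini') measurable
    also have "\<dots> = (\<integral>\<^sup>+x. emeasure lborel (uminus -` A) * indicator B x \<partial>\<nu>)"
    proof (rule nn_integral_cong)
      fix x :: 'a
      have "(\<integral>\<^sup>+y. indicator A (x - y) * indicator B x \<partial>lborel)
          = (\<integral>\<^sup>+y. indicator (uminus -` A) (y + (- x)) * indicator B x \<partial>lborel)"
        by (intro nn_integral_cong) (auto simp: indicator_def)
      also have "\<dots> = (\<integral>\<^sup>+y. indicator (uminus -` A) y * indicator B x \<partial>lborel)"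
        using measurable_sets_borel[of uminus borel A]
        by (intro nn_integral_lborel_translate) auto
      also have "\<dots> = emeasure lborel (uminus -` A) * indicator B x"
        using measurable_sets_borel[of uminus borel A]
        by (subst nn_integral_multc) auto
      finally show "(\<integral>\<^sup>+y. indicator A (x - y) * indicator B x \<partial>lborel) = \<dots>" .
    qed
    also have "\<dots> = emeasure \<nu> B * emeasure lborel (uminus -` A)"
      by (subst nn_integral_cmult) (auto simp: mult.commute)
    finally show ?thesis .
  qed
  have ball: "emeasure \<nu> (ball 0 1) = emeasure lborel (ball (0::'a) 1)"
  proof -
    have "U -` ball 0 1 = ball 0 1"
      using orthogonal_transformation_norm[OF U] by auto
    then show ?thesis by (simp add: \<nu>_def emeasure_distr)
  qed
  have pos: "emeasure lborel (ball (0::'a) 1) \<noteq> 0"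
    using content_ball_pos[of 1 "0::'a"] by (auto simp: measure_def)
  have fin: "emeasure lborel (ball (0::'a) 1) \<noteq> \<infinity>"
    using emeasure_lborel_ball_finite[of "0::'a" 1] by simp
  have refl: "emeasure \<nu> A = emeasure lborel (uminus -` A)" if "A \<in> sets borel" for A
    using main[of A "ball 0 1"] that pos fin ball
    by (simp add: mult.commute[of _ "emeasure lborel (ball 0 1)"] ennreal_mult_cancel_left)
  have lborel_refl: "emeasure lborel (uminus -` A) = emeasure lborel A"
    if "A \<in> sets borel" for A :: "'a set"
  proof -
    have "lborel = distr lborel borel (uminus :: 'a \<Rightarrow> 'a)"
      using lborel_affine[of "-1" "0::'a"] by (simp add: density_1)
    then have "emeasure lborel A = emeasure (distr lborel borel uminus) A" by simp
    also have "\<dots> = emeasure lborel (uminus -` A)"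
      using that by (simp add: emeasure_distr)
    finally show ?thesis by simp
  qed
  show ?thesis
    by (rule measure_eqI) (use refl lborel_refl in \<open>auto simp: \<nu>_def\<close>)
qed

section \<open>Volumes of nonisotropic sets\<close>

lemma nn_integral_lborel_orthogonal:
  fixes f :: "'a :: euclidean_space \<Rightarrow> ennreal" and U :: "'a \<Rightarrow> 'a"
  assumes U: "orthogonal_transformation U" and [measurable]: "f \<in> borel_measurable borel"
  shows "(\<integral>\<^sup>+x. f (U x) \<partial>lborel) = (\<integral>\<^sup>+x. f x \<partial>lborel)"
proof -
  have [measurable]: "U \<in> borel \<rightarrow>\<^sub>M borel"
    using linear_continuous_on[of U UNIV] orthogonal_transformation_linear[OF U]
    by (intro borel_measurable_continuous_onI) (simp add: linear_conv_bounded_linear)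
  have "(\<integral>\<^sup>+x. f x \<partial>lborel) = (\<integral>\<^sup>+x. f x \<partial>distr lborel borel U)"
    by (simp add: distr_lborel_orthogonal[OF U])
  then show ?thesis by (simp add: nn_integral_distr)
qed

lemma emeasure_lborel_orthogonal_vimage:
  fixes U :: "'a :: euclidean_space \<Rightarrow> 'a"
  assumes U: "orthogonal_transformation U" and "A \<in> sets borel"
  shows "emeasure lborel (U -` A) = emeasure lborel A"
proof -
  have [measurable]: "U \<in> borel \<rightarrow>\<^sub>M borel"
    using linear_continuous_on[of U UNIV] orthogonal_transformation_linear[OF U]
    by (intro borel_measurable_continuous_onI) (simp add: linear_conv_bounded_linear)
  have "emeasure lborel A = emeasure (distr lborel borel U) A"
    by (simp add: distr_lborel_orthogonal[OF U])
  then show ?thesis using assms(2) by (simp add: emeasure_distr)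
qed

text \<open>Half-diagonal of the boxes of size \<open>\<kappa>\<close> in one complex direction and \<open>\<surd>\<kappa>\<close> in the others:
  the geometry of the ball near a boundary point.\<close>

definition nonisotropic_diag :: "'n::finite \<Rightarrow> real \<Rightarrow> complex^'n" where
  "nonisotropic_diag i \<kappa> = (\<chi> j. if j = i then Complex \<kappa> \<kappa> else Complex (sqrt \<kappa>) (sqrt \<kappa>))"

lemma nonisotropic_diag_inner:
  assumes "b \<in> Basis"
  obtains j u where "b = axis j u" "u \<in> Basis"
    "nonisotropic_diag i \<kappa> \<bullet> b = (if j = i then \<kappa> else sqrt \<kappa>)"
  using assms by (force simp: Basis_vec_def Basis_complex_def nonisotropic_diag_def inner_axis inner_complex_def)

text \<open>The volume of a box: the direction i contributes 4\<kappa>^2 and each of the other N - 1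
  complex directions 4\<kappa>. The exponent N + 1 is the homogeneous dimension behind the kernel
  estimates on the ball.\<close>

lemma prod_nonisotropic_diag:
  fixes i :: "'n::finite"
  assumes "\<kappa> \<ge> 0"
  shows "(\<Prod>b\<in>Basis. 2 * (nonisotropic_diag i \<kappa> \<bullet> b)) = (4 * \<kappa>) ^ (CARD('n) + 1) / 4"
proof -
  let ?D = "nonisotropic_diag i \<kappa>"
  have B: "(Basis :: (complex^'n) set) = (\<lambda>(j, u). axis j u) ` (UNIV \<times> Basis)"
    by (auto simp: Basis_vec_def image_iff)
  have inj: "inj_on (\<lambda>(j :: 'n, u :: complex). axis j u) (UNIV \<times> Basis)"
    by (auto simp: inj_on_def axis_eq_axis Basis_complex_def)
  have "(\<Prod>b\<in>Basis. 2 * (?D \<bullet> b)) = (\<Prod>(j, u)\<in>UNIV \<times> Basis. 2 * (?D \<bullet> axis j u))"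
    unfolding B by (subst prod.reindex[OF inj]) (simp add: case_prod_unfold)
  also have "\<dots> = (\<Prod>j\<in>UNIV. \<Prod>u\<in>Basis. 2 * (?D \<bullet> axis j u))"
    by (rule prod.cartesian_product[symmetric])
  also have "\<dots> = (\<Prod>j\<in>UNIV. if j = i then 4 * \<kappa>\<^sup>2 else 4 * \<kappa>)"
    using assms by (intro prod.cong)
      (auto simp: Basis_complex_def nonisotropic_diag_def inner_axis inner_complex_def power2_eq_square)
  also have "\<dots> = 4 * \<kappa>\<^sup>2 * (\<Prod>j\<in>UNIV - {i}. 4 * \<kappa>)"
    by (subst prod.remove[of UNIV i]) auto
  also have "\<dots> = 4 * \<kappa>\<^sup>2 * (4 * \<kappa>) ^ (CARD('n) - 1)"
    by (simp add: card_Diff_singleton)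
  also have "\<dots> = (4 * \<kappa>)\<^sup>2 * (4 * \<kappa>) ^ (CARD('n) - 1) / 4"
    by (simp add: power2_eq_square)
  also have "(4 * \<kappa>)\<^sup>2 * (4 * \<kappa>) ^ (CARD('n) - 1) = (4 * \<kappa>) ^ (CARD('n) + 1)"
  proof -
    have "2 + (CARD('n) - 1) = CARD('n) + 1"
      using zero_less_card_finite[where 'a='n] by linarith
    then show ?thesis by (metis power_add)
  qed
  finally show ?thesis .
qed

lemma emeasure_nonisotropic_box:
  fixes i :: "'n::finite"
  assumes "\<kappa> \<ge> 0"
  shows "emeasure lborel (cbox (c - nonisotropic_diag i \<kappa>) (c + nonisotropic_diag i \<kappa>))
      = ennreal ((4 * \<kappa>) ^ (CARD('n) + 1) / 4)" (is ?A)
    and "emeasure lborel (box (c - nonisotropic_diag i \<kappa>) (c + nonisotropic_diag i \<kappa>))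
      = ennreal ((4 * \<kappa>) ^ (CARD('n) + 1) / 4)" (is ?B)
proof -
  let ?D = "nonisotropic_diag i \<kappa>"
  have nn: "?D \<bullet> b \<ge> 0" if "b \<in> Basis" for b
    using that assms by (metis nonisotropic_diag_inner real_sqrt_ge_zero)
  have *: "(c + ?D - (c - ?D)) \<bullet> b = 2 * (?D \<bullet> b)" for b
    unfolding inner_diff_left inner_add_left by simp
  show ?A
    unfolding prod_nonisotropic_diag[OF assms, of i, symmetric] *[symmetric]
    by (rule emeasure_lborel_cbox) (use nn in \<open>auto simp: algebra_simps\<close>)
  show ?B
    unfolding prod_nonisotropic_diag[OF assms, of i, symmetric] *[symmetric]
    by (rule emeasure_lborel_box) (use nn in \<open>auto simp: algebra_simps\<close>)
qed

lemma hinner_axis: "hinner x (axis i c) = x $ i * cnj c"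
proof -
  have "hinner x (axis i c) = (\<Sum>j\<in>UNIV. if j = i then x $ i * cnj c else 0)"
    unfolding hinner_def by (rule sum.cong) (auto simp: axis_def)
  then show ?thesis by simp
qed

lemma norm_vec_two_components:
  fixes x :: "complex^'n"
  assumes "i \<noteq> j"
  shows "(cmod (x $ i))\<^sup>2 + (cmod (x $ j))\<^sup>2 \<le> (norm x)\<^sup>2"
proof -
  have "(norm x)\<^sup>2 = (\<Sum>k\<in>UNIV. (cmod (x $ k))\<^sup>2)"
    by (simp add: norm_vec_def L2_set_def sum_nonneg)
  moreover have "(\<Sum>k\<in>{i, j}. (cmod (x $ k))\<^sup>2) \<le> (\<Sum>k\<in>UNIV. (cmod (x $ k))\<^sup>2)"
    by (rule sum_mono2) auto
  ultimately show ?thesis using assms by simp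
qed

text \<open>For small t, a rotation taking w to an axis puts the set into a box of width O(t) in the
  complex direction of w and O(\<surd>t) in the others.\<close>

lemma emeasure_nonisotropic_ball_le:
  "\<exists>K>0. \<forall>(w :: complex^'n) t. norm w < 1 \<longrightarrow> t > 0 \<longrightarrow>
     emeasure lborel {z \<in> ball 0 1. cmod (1 - hinner z w) < t} \<le> ennreal (K * t ^ (CARD('n) + 1))"
proof -
  let ?N = "CARD('n)"
  define V where "V = measure lborel (ball (0 :: complex^'n) 1)"
  have V: "emeasure lborel (ball (0 :: complex^'n) 1) = ennreal V"
    unfolding V_def using emeasure_lborel_ball_finite[of "0 :: complex^'n" 1]
    by (intro emeasure_eq_ennreal_measure) auto
  have V0: "V \<ge> 0" by (simp add: V_def)
  \<comment> \<open>The first summand serves t \<ge> 1/4, where the volume of the whole ball is a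
    good enough bound; the second one is the box for t < 1/4.\<close>
  define K where "K = V * 4 ^ (?N + 1) + 8 ^ (?N + 1)"
  have "emeasure lborel {z \<in> ball 0 1. cmod (1 - hinner z w) < t} \<le> ennreal (K * t ^ (?N + 1))"
    if w: "norm w < 1" and t: "t > 0" for w :: "complex^'n" and t
  proof (cases "t < 1/4")
    case False
    then have "1 \<le> (4 * t) ^ (?N + 1)" by (intro one_le_power) auto
    then have "V * 1 \<le> V * (4 * t) ^ (?N + 1)" using V0 by (rule mult_left_mono)
    also have "\<dots> \<le> K * t ^ (?N + 1)"
      using t by (simp add: K_def power_mult_distrib algebra_simps)
    finally have "ennreal V \<le> ennreal (K * t ^ (?N + 1))" by (simp add: ennreal_leI)
    moreover have "emeasure lborel {z \<in> ball 0 1. cmod (1 - hinner z w) < t} \<le> ennreal V"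
      unfolding V[symmetric] by (rule emeasure_mono) auto
    ultimately show ?thesis by order
  next
    case True
    obtain i :: 'n where True by simp
    obtain U \<theta> where U: "linear U" "\<And>x y. hinner (U x) (U y) = hinner x y"
      and \<theta>: "cmod \<theta> = 1" "U w = axis i (\<theta> * of_real (norm w))"
      using unitary_to_axis_exists[of w i] by metis
    have orth: "orthogonal_transformation U"
      using U by (rule unitary_orthogonal_transformation)
    \<comment> \<open>The point of the axis whose pairing with \<open>U w\<close> is 1. It lies
      outside the ball when w is not 0.\<close>
    define c where "c = axis i (\<theta> / of_real (norm w))"
    let ?D = "nonisotropic_diag i (2 * t)"
    have "{z \<in> ball 0 1. cmod (1 - hinner z w) < t} \<subseteq> U -` cbox (c - ?D) (c + ?D)"
    proof
      fix z assume "z \<in> {z \<in> ball 0 1. cmod (1 - hinner z w) < t}"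
      then have z: "norm z < 1" "cmod (1 - hinner z w) < t" by auto
      define y where "y = U z"
      have ny: "norm y < 1"
        using z(1) orthogonal_transformation_norm[OF orth, of z] by (simp add: y_def)
      have h: "hinner z w = y $ i * (cnj \<theta> * norm w)"
        using U(2)[of z w] \<theta>(2) by (simp add: y_def hinner_axis)
      have yi: "cmod (y $ i) > 1 - t"
      proof -
        have "1 - t < cmod (hinner z w)"
          using z(2) norm_triangle_ineq2[of 1 "1 - hinner z w"] by simp
        also have "\<dots> = cmod (y $ i) * norm w"
          using \<theta>(1) by (simp add: h norm_mult)
        also have "\<dots> \<le> cmod (y $ i)"
          using w by (simp add: mult_right_le_one_le)
        finally show ?thesis .
      qed
      have nw: "norm w > 1/2"
      proof -
        have "1 - norm w \<le> t"
          using norm_diff_hinner_le[of z w] z by simp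
        then show ?thesis using True by simp
      qed
      have e: "\<theta> * cnj \<theta> = 1"
        using \<theta>(1) complex_norm_square[of \<theta>] by simp
      have "y $ i - \<theta> / of_real (norm w) = - (\<theta> / norm w) * (1 - hinner z w)"
      proof -
        have nz: "complex_of_real (norm w) \<noteq> 0" using nw by auto
        have "(\<theta> / norm w) * (y $ i * (cnj \<theta> * norm w)) = (\<theta> * cnj \<theta>) * (y $ i)"
          using nz by (simp add: field_simps)
        then show ?thesis by (simp only: h e) (simp add: algebra_simps)
      qed
      then have "cmod (y $ i - \<theta> / of_real (norm w)) = cmod (1 - hinner z w) / norm w"
        using \<theta>(1) nw by (simp add: norm_mult norm_divide)
      also have "\<dots> \<le> t / (1/2)"
        using z(2) nw t by (intro frac_le) auto
      finally have A: "cmod (y $ i - \<theta> / of_real (norm w)) \<le> 2 * t" by simp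
      \<comment> \<open>The coordinate i uses up (1 - t)^2 of the squared norm, which leaves at most
        2t for any other coordinate.\<close>
      have Bj: "cmod (y $ j) \<le> sqrt (2 * t)" if "j \<noteq> i" for j
      proof -
        have "(1 - t)\<^sup>2 \<le> (cmod (y $ i))\<^sup>2"
          using yi True by (intro power_mono) auto
        moreover have "(norm y)\<^sup>2 \<le> 1" using ny by (simp add: power_le_one)
        moreover have "(1 - t)\<^sup>2 \<ge> 1 - 2 * t" by (simp add: power2_eq_square algebra_simps)
        ultimately have "(cmod (y $ j))\<^sup>2 \<le> 2 * t"
          using norm_vec_two_components[OF that, of y] by linarith
        then show ?thesis by (rule real_le_rsqrt)
      qed
      have "\<bar>(y - c) \<bullet> b\<bar> \<le> ?D \<bullet> b" if bB: "b \<in> Basis" for b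
      proof -
        obtain j u where b: "b = axis j u" "u \<in> Basis" "?D \<bullet> b = (if j = i then 2 * t else sqrt (2 * t))"
          using nonisotropic_diag_inner[OF bB] by metis
        have "\<bar>(y - c) \<bullet> b\<bar> = \<bar>(y - c) $ j \<bullet> u\<bar>"
          by (simp add: b(1) inner_axis)
        also have "\<dots> \<le> cmod ((y - c) $ j)"
          using b(2) Cauchy_Schwarz_ineq2[of "(y - c) $ j" u] by simp
        also have "\<dots> \<le> (if j = i then 2 * t else sqrt (2 * t))"
          using A Bj by (auto simp: c_def axis_def)
        finally show ?thesis using b(3) by simp
      qed
      then have "y \<in> cbox (c - ?D) (c + ?D)"
        by (fastforce simp: mem_box inner_diff inner_add abs_le_iff)
      then show "z \<in> U -` cbox (c - ?D) (c + ?D)" by (simp add: y_def)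
    qed
    then have "emeasure lborel {z \<in> ball 0 1. cmod (1 - hinner z w) < t}
        \<le> emeasure lborel (U -` cbox (c - ?D) (c + ?D))"
    proof (rule emeasure_mono)
      have "U \<in> borel \<rightarrow>\<^sub>M borel"
        using linear_continuous_on[of U UNIV] U(1)
        by (intro borel_measurable_continuous_onI) (simp add: linear_conv_bounded_linear)
      then show "U -` cbox (c - ?D) (c + ?D) \<in> sets lborel"
        using measurable_sets_borel[of U borel "cbox (c - ?D) (c + ?D)"] by auto
    qed
    also have "\<dots> = emeasure lborel (cbox (c - ?D) (c + ?D))"
      by (rule emeasure_lborel_orthogonal_vimage[OF orth]) auto
    also have "\<dots> = ennreal ((8 * t) ^ (?N + 1) / 4)"
      using emeasure_nonisotropic_box(1)[of "2 * t" c i] t by simp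
    also have "\<dots> \<le> ennreal (K * t ^ (?N + 1))"
    proof (rule ennreal_leI)
      have "(8 * t) ^ (?N + 1) / 4 \<le> (8 * t) ^ (?N + 1)" using t by simp
      also have "\<dots> \<le> K * t ^ (?N + 1)"
        using t V0 unfolding K_def power_mult_distrib by (intro mult_right_mono) auto
      finally show "(8 * t) ^ (?N + 1) / 4 \<le> K * t ^ (?N + 1)" .
    qed
    finally show ?thesis .
  qed
  moreover have "K > 0" using V0 by (simp add: K_def add_nonneg_pos)
  ultimately show ?thesis by blast
qed

text \<open>Up to constants this set is a nonisotropic box of size \<delta>, but it is also
  invariant under multiplication by phases, as averaging over circles demands. A box inside it gives
  the volume.\<close>

lemma emeasure_circular_nbhd_ge:
  fixes z :: "complex^'n"
  assumes z: "norm z \<le> 1" and \<delta>: "0 < \<delta>" "\<delta> \<le> 1"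
  shows "ennreal ((\<delta> / (3 * CARD('n))) ^ (CARD('n) + 1) / 4)
    \<le> emeasure lborel {x. cmod (hinner x z) < \<delta> / 6 \<and> (norm x)\<^sup>2 < \<delta> / 6}"
proof -
  let ?N = "real CARD('n)"
  obtain i :: 'n where True by simp
  obtain U \<theta> where U: "linear U" "\<And>x y. hinner (U x) (U y) = hinner x y"
    and \<theta>: "cmod \<theta> = 1" "U z = axis i (\<theta> * of_real (norm z))"
    using unitary_to_axis_exists[of z i] by metis
  have orth: "orthogonal_transformation U"
    using U by (rule unitary_orthogonal_transformation)
  \<comment> \<open>Each of the N coordinates will have squared modulus below 2\<kappa>, so the
    squared norm stays below 2N\<kappa> = \<delta>/6; the same \<kappa> gives 2\<kappa> \<le>
    \<delta>/6 for the coordinate i.\<close>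
  define \<kappa> where "\<kappa> = \<delta> / (12 * ?N)"
  have N1: "?N \<ge> 1" using zero_less_card_finite[where 'a='n] by linarith
  have \<kappa>: "\<kappa> > 0" using \<delta> N1 by (simp add: \<kappa>_def)
  have \<kappa>12: "\<kappa> \<le> \<delta> / 12" "\<kappa> \<le> 1"
  proof -
    have "\<delta> / (12 * ?N) \<le> \<delta> / 12"
      using \<delta> N1 by (intro divide_left_mono) auto
    then show "\<kappa> \<le> \<delta> / 12" "\<kappa> \<le> 1" using \<delta> unfolding \<kappa>_def by linarith+
  qed
  let ?D = "nonisotropic_diag i \<kappa>"
  let ?E = "{x. cmod (hinner x z) < \<delta> / 6 \<and> (norm x)\<^sup>2 < \<delta> / 6}"
  have "open ?E"
    by (intro open_Collect_conj open_Collect_less continuous_intros)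
  then have meas: "?E \<in> sets lborel" by simp
  have "U -` box (0 - ?D) (0 + ?D) \<subseteq> ?E"
  proof
    fix x assume "x \<in> U -` box (0 - ?D) (0 + ?D)"
    define y where "y = U x"
    have y: "\<bar>y \<bullet> b\<bar> < ?D \<bullet> b" if "b \<in> Basis" for b
      using \<open>x \<in> _\<close> that by (force simp: y_def mem_box abs_less_iff)
    have yu: "\<bar>y $ j \<bullet> u\<bar> < (if j = i then \<kappa> else sqrt \<kappa>)" if "u \<in> Basis" for j u
      using y[of "axis j u"] that
      by (auto simp: inner_axis nonisotropic_diag_def Basis_complex_def inner_complex_def split: if_splits)
    have yj: "(cmod (y $ j))\<^sup>2 < 2 * \<kappa>" for j
    proof -
      have "\<bar>Re (y $ j)\<bar> < sqrt \<kappa>" "\<bar>Im (y $ j)\<bar> < sqrt \<kappa>"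
      proof -
        have "\<kappa> \<le> sqrt \<kappa>"
          using \<kappa> \<kappa>12 by (intro real_le_rsqrt) (auto simp: power2_eq_square mult_left_le)
        then show "\<bar>Re (y $ j)\<bar> < sqrt \<kappa>" "\<bar>Im (y $ j)\<bar> < sqrt \<kappa>"
          using yu[of 1 j] yu[of \<i> j] by (auto simp: Basis_complex_def inner_complex_def split: if_splits)
      qed
      then have "(Re (y $ j))\<^sup>2 < \<kappa>" "(Im (y $ j))\<^sup>2 < \<kappa>"
        using \<kappa> by (metis abs_le_square_iff abs_of_nonneg less_imp_le not_le real_sqrt_abs real_sqrt_ge_zero real_sqrt_less_iff power2_abs)+
      then show ?thesis by (simp add: cmod_power2)
    qed
    have "(norm x)\<^sup>2 = (norm y)\<^sup>2"
      using orthogonal_transformation_norm[OF orth, of x] by (simp add: y_def)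
    also have "\<dots> = (\<Sum>k\<in>UNIV. (cmod (y $ k))\<^sup>2)"
      by (simp add: norm_vec_def L2_set_def sum_nonneg)
    also have "\<dots> < (\<Sum>k\<in>(UNIV::'n set). 2 * \<kappa>)"
      using yj by (intro sum_strict_mono) auto
    also have "\<dots> = \<delta> / 6" using N1 by (simp add: \<kappa>_def)
    finally have 1: "(norm x)\<^sup>2 < \<delta> / 6" .
    have "hinner x z = y $ i * (cnj \<theta> * norm z)"
      using U(2)[of x z] \<theta>(2) by (simp add: y_def hinner_axis)
    then have "cmod (hinner x z) = cmod (y $ i) * norm z"
      using \<theta>(1) by (simp add: norm_mult)
    also have "\<dots> \<le> cmod (y $ i)" using z by (simp add: mult_right_le_one_le)
    also have "\<dots> \<le> \<bar>Re (y $ i)\<bar> + \<bar>Im (y $ i)\<bar>" by (rule cmod_le)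
    also have "\<dots> < \<kappa> + \<kappa>"
      using yu[of 1 i] yu[of \<i> i] by (auto simp: Basis_complex_def inner_complex_def)
    also have "\<dots> \<le> \<delta> / 6" using \<kappa>12 by simp
    finally show "x \<in> ?E" using 1 by simp
  qed
  then have "emeasure lborel (U -` box (0 - ?D) (0 + ?D)) \<le> emeasure lborel ?E"
    by (rule emeasure_mono[OF _ meas])
  also have "emeasure lborel (U -` box (0 - ?D) (0 + ?D)) = emeasure lborel (box (0 - ?D) (0 + ?D))"
    by (rule emeasure_lborel_orthogonal_vimage[OF orth]) auto
  also have "\<dots> = ennreal ((4 * \<kappa>) ^ (CARD('n) + 1) / 4)"
    using \<kappa> by (intro emeasure_nonisotropic_box(2)) auto
  finally show ?thesis by (simp add: \<kappa>_def)
qed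

section \<open>Kernel integrals and polar coordinates\<close>

text \<open>Dyadic decomposition by the size of |1 - <z, w>|, which is at least 1 - |w|. The
  condition on p beats the volume growth by one factor 2^j at level j, so the series is geometric
  and K depends on neither w nor p.\<close>

lemma nn_integral_kernel_ball_le:
  "\<exists>K>0. \<forall>(w :: complex^'n) p. norm w < 1 \<longrightarrow> p \<ge> CARD('n) + 2 \<longrightarrow>
       (\<integral>\<^sup>+z. indicator (ball 0 1) z * ennreal ((1 / cmod (1 - hinner z w)) ^ p) \<partial>lborel)
         \<le> ennreal (K * (1 - norm w) ^ (CARD('n) + 1) / (1 - norm w) ^ p)"
proof -
  let ?N = "CARD('n)"
  obtain K0 where K0: "K0 > 0" and vol: "\<And>(w :: complex^'n) t. norm w < 1 \<Longrightarrow> t > 0 \<Longrightarrow>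
       emeasure lborel {z \<in> ball 0 1. cmod (1 - hinner z w) < t} \<le> ennreal (K0 * t ^ (?N + 1))"
    using emeasure_nonisotropic_ball_le[where 'n='n] by blast
  have "(\<integral>\<^sup>+z. indicator (ball 0 1) z * ennreal ((1 / cmod (1 - hinner z w)) ^ p) \<partial>lborel)
       \<le> ennreal (K0 * 2 ^ (?N + 2) * (1 - norm w) ^ (?N + 1) / (1 - norm w) ^ p)"
    if w: "norm w < 1" and p: "p \<ge> ?N + 2" for w :: "complex^'n" and p
  proof -
    define \<delta> where "\<delta> = 1 - norm w"
    have \<delta>: "\<delta> > 0" using w by (simp add: \<delta>_def)
    define u where "u z = cmod (1 - hinner z w)" for z
    have u_ge: "u z \<ge> \<delta>" if "norm z < 1" for z
      using norm_diff_hinner_le[of z w] that by (simp add: u_def \<delta>_def)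
    define S where "S j = {z \<in> ball 0 1. u z < 2 ^ Suc j * \<delta>}" for j :: nat
    have "open (S j)" for j
    proof -
      have "S j = ball 0 1 \<inter> {z. u z < 2 ^ Suc j * \<delta>}" by (auto simp: S_def)
      moreover have "open {z. u z < 2 ^ Suc j * \<delta>}"
        unfolding u_def by (intro open_Collect_less continuous_intros)
      ultimately show ?thesis by auto
    qed
    then have [measurable]: "S j \<in> sets borel" for j by simp
    define T where "T j z = ennreal ((1 / (2 ^ j * \<delta>)) ^ p) * indicator (S j) z" for j :: nat and z
    have [measurable]: "T j \<in> borel_measurable borel" for j
      unfolding T_def by measurable
    have pt: "indicator (ball 0 1) z * ennreal ((1 / u z) ^ p) \<le> (\<Sum>j. T j z)" for z
    proof (cases "norm z < 1")
      case True
      \<comment> \<open>The least such n is positive because u z \<ge> \<delta>. Its predecessor j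
        satisfies both 2^j \<delta> \<le> u z and z \<in> S j.\<close>
      define n where "n = (LEAST n. u z / \<delta> < 2 ^ n)"
      have ex: "\<exists>n. u z / \<delta> < 2 ^ n"
        using real_arch_pow[of 2 "u z / \<delta>"] by simp
      have n: "u z / \<delta> < 2 ^ n" unfolding n_def using ex by (rule LeastI_ex)
      have "n \<noteq> 0"
      proof
        assume "n = 0"
        with n show False using u_ge[OF True] \<delta> by (simp add: field_simps)
      qed
      then obtain j where j: "n = Suc j" using not0_implies_Suc by blast
      have "\<not> u z / \<delta> < 2 ^ j"
        using not_less_Least[of j "\<lambda>n. u z / \<delta> < 2 ^ n"] j n_def by auto
      then have ge: "2 ^ j * \<delta> \<le> u z" using \<delta> by (simp add: field_simps)
      have "z \<in> S j" using n \<delta> True unfolding j by (simp add: S_def field_simps)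
      moreover have "(1 / u z) ^ p \<le> (1 / (2 ^ j * \<delta>)) ^ p"
        using ge \<delta> u_ge[OF True] by (intro power_mono divide_left_mono) auto
      ultimately have "indicator (ball 0 1) z * ennreal ((1 / u z) ^ p) \<le> T j z"
        using True by (simp add: T_def ennreal_leI)
      also have "T j z = (\<Sum>i\<in>{j}. T i z)" by simp
      also have "\<dots> \<le> (\<Sum>j. T j z)" by (rule sum_le_suminf) auto
      finally show ?thesis .
    qed simp
    define c where "c = K0 * 2 ^ (?N + 1) * \<delta> ^ (?N + 1) / \<delta> ^ p"
    have c0: "c \<ge> 0" using K0 \<delta> by (simp add: c_def)
    have intT: "(\<integral>\<^sup>+z. T j z \<partial>lborel) \<le> ennreal (c * (1/2) ^ j)" for j
    proof -
      have "(\<integral>\<^sup>+z. T j z \<partial>lborel) = ennreal ((1 / (2 ^ j * \<delta>)) ^ p) * emeasure lborel (S j)"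
        by (simp add: T_def nn_integral_cmult)
      also have "\<dots> \<le> ennreal ((1 / (2 ^ j * \<delta>)) ^ p) * ennreal (K0 * (2 ^ Suc j * \<delta>) ^ (?N + 1))"
        unfolding S_def u_def using \<delta> w by (intro mult_left_mono vol) auto
      also have "\<dots> = ennreal ((1 / (2 ^ j * \<delta>)) ^ p * (K0 * (2 ^ Suc j * \<delta>) ^ (?N + 1)))"
        using \<delta> K0 by (intro ennreal_mult[symmetric]) auto
      also have "\<dots> \<le> ennreal (c * (1/2) ^ j)"
      proof (rule ennreal_leI)
        define q :: real where "q = 2 ^ j"
        have q: "q \<ge> 1" by (simp add: q_def)
        have "q ^ (?N + 1) * q \<le> q ^ p"
          using power_increasing[OF p q] by (simp add: algebra_simps)
        then have "q ^ (?N + 1) / q ^ p \<le> 1 / q" using q by (simp add: field_simps)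
        then have "c * (q ^ (?N + 1) / q ^ p) \<le> c * (1 / q)" using c0 by (rule mult_left_mono)
        moreover have "(1 / (q * \<delta>)) ^ p * (K0 * ((2 * q) * \<delta>) ^ (?N + 1)) = c * (q ^ (?N + 1) / q ^ p)"
          unfolding c_def power_mult_distrib power_divide by (simp add: mult_ac)
        ultimately show "(1 / (2 ^ j * \<delta>)) ^ p * (K0 * (2 ^ Suc j * \<delta>) ^ (?N + 1)) \<le> c * (1/2) ^ j"
          by (simp add: q_def power_divide)
      qed
      finally show ?thesis .
    qed
    have "(\<integral>\<^sup>+z. indicator (ball 0 1) z * ennreal ((1 / u z) ^ p) \<partial>lborel)
        \<le> (\<integral>\<^sup>+z. (\<Sum>j. T j z) \<partial>lborel)"
      by (intro nn_integral_mono pt)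
    also have "\<dots> = (\<Sum>j. \<integral>\<^sup>+z. T j z \<partial>lborel)"
      by (rule nn_integral_suminf) measurable
    also have "\<dots> \<le> (\<Sum>j. ennreal (c * (1/2) ^ j))"
      by (intro suminf_le intT) auto
    also have "\<dots> = ennreal (\<Sum>j. c * (1/2) ^ j)"
      using c0 by (intro suminf_ennreal2 summable_mult summable_geometric) auto
    also have "(\<Sum>j. c * (1/2) ^ j) = c * 2"
      using suminf_mult[of "\<lambda>j. (1/2 :: real) ^ j" c] suminf_geometric[of "1/2 :: real"]
      by (simp add: summable_geometric)
    also have "c * 2 = K0 * 2 ^ (?N + 2) * (1 - norm w) ^ (?N + 1) / (1 - norm w) ^ p"
      by (simp add: c_def \<delta>_def)
    finally show ?thesis by (simp add: u_def)
  qed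
  then show ?thesis using K0 by (intro exI[of _ "K0 * 2 ^ (?N + 2)"]) simp
qed

lemma ball_borel_measurable [measurable]: "ball (a :: 'a :: euclidean_space) r \<in> sets borel"
  by simp

lemma measurable_sgn_euclidean [measurable]:
  "(sgn :: 'a :: euclidean_space \<Rightarrow> 'a) \<in> borel \<rightarrow>\<^sub>M borel"
  unfolding sgn_div_norm[abs_def] by measurable

lemma sgn_dilate: "c > 0 \<Longrightarrow> sgn (c *\<^sub>R x) = sgn (x :: 'a :: real_normed_vector)"
  by (simp add: sgn_div_norm)

text \<open>By dilation, the ball of radius \<rho> carries the share \<rho>^DIM of the integral of a
  function that is constant along rays, so the shell keeps 1 - \<rho>^DIM \<ge> 1 - \<rho>.
  Finiteness allows the subtraction.\<close>

lemma nn_integral_cone_shell_ge: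
  fixes G :: "'a :: euclidean_space \<Rightarrow> ennreal"
  assumes [measurable]: "G \<in> borel_measurable borel" and \<rho>: "0 < \<rho>" "\<rho> < 1"
    and fin: "(\<integral>\<^sup>+z. indicator (ball 0 1) z * G (sgn z) \<partial>lborel) < \<infinity>"
  shows "ennreal (1 - \<rho>) * (\<integral>\<^sup>+z. indicator (ball 0 1) z * G (sgn z) \<partial>lborel)
    \<le> (\<integral>\<^sup>+z. indicator (ball 0 1 - ball 0 \<rho>) z * G (sgn z) \<partial>lborel)"
    (is "_ * ?I \<le> ?X")
proof -
  have "?I = (\<integral>\<^sup>+z. indicator (ball 0 \<rho>) (\<rho> *\<^sub>R z) * G (sgn (\<rho> *\<^sub>R z)) \<partial>lborel)"
    using \<rho> by (intro nn_integral_cong) (auto simp: indicator_def sgn_dilate)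
  also have "\<dots> = ennreal (1 / \<rho> ^ DIM('a)) * (\<integral>\<^sup>+z. indicator (ball 0 \<rho>) z * G (sgn z) \<partial>lborel)"
    using \<rho> by (intro nn_integral_lborel_dilate) auto
  finally have "ennreal (\<rho> ^ DIM('a)) * ?I
      = ennreal (\<rho> ^ DIM('a)) * ennreal (1 / \<rho> ^ DIM('a)) * (\<integral>\<^sup>+z. indicator (ball 0 \<rho>) z * G (sgn z) \<partial>lborel)"
    by (simp add: mult.assoc)
  also have "ennreal (\<rho> ^ DIM('a)) * ennreal (1 / \<rho> ^ DIM('a)) = 1"
    using \<rho> by (simp add: ennreal_mult[symmetric])
  finally have 1: "(\<integral>\<^sup>+z. indicator (ball 0 \<rho>) z * G (sgn z) \<partial>lborel) = ennreal (\<rho> ^ DIM('a)) * ?I"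
    by simp
  have "?I = (\<integral>\<^sup>+z. indicator (ball 0 \<rho>) z * G (sgn z) + indicator (ball 0 1 - ball 0 \<rho>) z * G (sgn z) \<partial>lborel)"
    using \<rho> by (intro nn_integral_cong) (auto simp: indicator_def)
  also have "\<dots> = ennreal (\<rho> ^ DIM('a)) * ?I + ?X"
    by (subst nn_integral_add) (auto simp: 1)
  finally have 2: "?I = ennreal (\<rho> ^ DIM('a)) * ?I + ?X" .
  obtain i where i: "?I = ennreal i" "i \<ge> 0"
    using fin by (cases ?I) auto
  have "?X \<le> ?I" by (intro nn_integral_mono) (auto simp: indicator_def)
  then have "?X < \<infinity>" using fin by order
  then obtain x where x: "?X = ennreal x" "x \<ge> 0" by (cases ?X) auto
  have "ennreal i = ennreal (\<rho> ^ DIM('a) * i + x)"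
    using 2 \<rho> i x by (simp add: ennreal_mult ennreal_plus)
  then have "i = \<rho> ^ DIM('a) * i + x"
    using i(2) x(2) \<rho> by (subst (asm) ennreal_inj) auto
  moreover have "\<rho> ^ DIM('a) * i \<le> \<rho> * i"
    using power_decreasing[of 1 "DIM('a)" \<rho>] \<rho> i by (intro mult_right_mono) (auto simp: Suc_leI)
  ultimately have "(1 - \<rho>) * i \<le> x" by (simp add: algebra_simps)
  then show ?thesis
    using i x \<rho> by (simp add: ennreal_mult[symmetric] ennreal_leI)
qed

text \<open>In a shell of thickness comparable to 1 - |w| the kernels at z and at
  \<open>sgn z\<close> agree up to a factor 2, whose p-th power enters the bound. Dividing the
  estimate for the ball by the thickness lowers the exponent N + 1 to N.\<close>

lemma nn_integral_kernel_sphere_le: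
  "\<exists>K>0. \<forall>(w :: complex^'n) p. norm w < 1 \<longrightarrow> p \<ge> CARD('n) + 2 \<longrightarrow>
       (\<integral>\<^sup>+z. indicator (ball 0 1) z * ennreal ((1 / cmod (1 - hinner (sgn z) w)) ^ p) \<partial>lborel)
         \<le> ennreal (2 ^ p * K * (1 - norm w) ^ CARD('n) / (1 - norm w) ^ p)"
proof -
  let ?N = "CARD('n)"
  obtain K0 where K0: "K0 > 0" and ker: "\<And>(w :: complex^'n) p. norm w < 1 \<Longrightarrow> p \<ge> ?N + 2 \<Longrightarrow>
       (\<integral>\<^sup>+z. indicator (ball 0 1) z * ennreal ((1 / cmod (1 - hinner z w)) ^ p) \<partial>lborel)
         \<le> ennreal (K0 * (1 - norm w) ^ (?N + 1) / (1 - norm w) ^ p)"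
    using nn_integral_kernel_ball_le[where 'n='n] by blast
  have "(\<integral>\<^sup>+z. indicator (ball 0 1) z * ennreal ((1 / cmod (1 - hinner (sgn z) w)) ^ p) \<partial>lborel)
         \<le> ennreal (2 ^ p * (2 * K0) * (1 - norm w) ^ ?N / (1 - norm w) ^ p)" (is "?I \<le> _")
    if w: "norm w < 1" and p: "p \<ge> ?N + 2" for w :: "complex^'n" and p
  proof -
    define \<delta> where "\<delta> = 1 - norm w"
    have \<delta>: "\<delta> > 0" "\<delta> \<le> 1" using w by (auto simp: \<delta>_def)
    \<comment> \<open>In a shell of this thickness, 1 - <z, w> differs from its value at
      \<open>sgn z\<close> by at most \<delta>/2, while the modulus of that value is at least
      \<delta>.\<close>
    define \<rho> where "\<rho> = 1 - \<delta> / 2"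
    have \<rho>: "0 < \<rho>" "\<rho> < 1" using \<delta> by (auto simp: \<rho>_def)
    have [measurable]: "(\<lambda>z. hinner z w) \<in> borel_measurable borel"
      by (intro borel_measurable_continuous_onI continuous_intros)
    define G where "G z = ennreal ((1 / cmod (1 - hinner z w)) ^ p)" for z
    have [measurable]: "G \<in> borel_measurable borel"
      unfolding G_def by measurable
    have u_ge: "cmod (1 - hinner z w) \<ge> \<delta>" if "norm z \<le> 1" for z
      using norm_diff_hinner_le[of z w] that by (simp add: \<delta>_def)
    have ns: "norm (sgn z) \<le> 1" for z :: "complex^'n" by (simp add: norm_sgn)
    \<comment> \<open>This crude bound only supplies the finiteness required for the comparison with
      the shell.\<close>
    have "?I \<le> (\<integral>\<^sup>+z. ennreal ((1 / \<delta>) ^ p) * indicator (ball (0 :: complex^'n) 1) z \<partial>lborel)"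
    proof (rule nn_integral_mono)
      fix z :: "complex^'n"
      have "(1 / cmod (1 - hinner (sgn z) w)) ^ p \<le> (1 / \<delta>) ^ p"
        using u_ge[OF ns, of z] \<delta> by (intro power_mono divide_left_mono mult_pos_pos) auto
      then show "indicator (ball 0 1) z * ennreal ((1 / cmod (1 - hinner (sgn z) w)) ^ p)
          \<le> ennreal ((1 / \<delta>) ^ p) * indicator (ball 0 1) z"
        by (simp add: indicator_def ennreal_leI)
    qed
    also have "\<dots> = ennreal ((1 / \<delta>) ^ p) * emeasure lborel (ball (0 :: complex^'n) 1)"
      by (simp add: nn_integral_cmult)
    also have "\<dots> < \<infinity>"
      using emeasure_lborel_ball_finite[of "0 :: complex^'n" 1] by (simp add: ennreal_mult_less_top)
    finally have fin: "?I < \<infinity>" .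
    have "ennreal (1 - \<rho>) * ?I \<le> (\<integral>\<^sup>+z. indicator (ball 0 1 - ball 0 \<rho>) z * G (sgn z) \<partial>lborel)"
      using nn_integral_cone_shell_ge[of G \<rho>] \<rho> fin by (simp add: G_def)
    also have "\<dots> \<le> (\<integral>\<^sup>+z. ennreal (2 ^ p) * (indicator (ball 0 1) z * ennreal ((1 / cmod (1 - hinner z w)) ^ p)) \<partial>lborel)"
    proof (rule nn_integral_mono)
      fix z :: "complex^'n"
      show "indicator (ball 0 1 - ball 0 \<rho>) z * G (sgn z)
        \<le> ennreal (2 ^ p) * (indicator (ball 0 1) z * ennreal ((1 / cmod (1 - hinner z w)) ^ p))"
      proof (cases "\<rho> \<le> norm z \<and> norm z < 1")
        case True
        have nz: "hinner z w = norm z * hinner (sgn z) w"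
          using True \<rho> by (cases "z = 0") (auto simp: sgn_div_norm hinner_scaleR_left)
        have "cmod (hinner (sgn z) w) \<le> norm (sgn z) * norm w" by (rule cmod_hinner_le)
        also have "\<dots> \<le> 1" using w by (simp add: norm_sgn)
        finally have h1: "cmod (hinner (sgn z) w) \<le> 1" .
        have "1 - hinner z w = (1 - hinner (sgn z) w) + (1 - norm z) * hinner (sgn z) w"
          by (simp add: nz algebra_simps)
        then have "cmod (1 - hinner z w) \<le> cmod (1 - hinner (sgn z) w) + cmod ((1 - norm z) * hinner (sgn z) w)"
          by (metis norm_triangle_ineq)
        also have "cmod ((1 - norm z) * hinner (sgn z) w) = \<bar>1 - norm z\<bar> * cmod (hinner (sgn z) w)"
          unfolding norm_mult norm_of_real ..
        also have "\<dots> \<le> (\<delta> / 2) * 1"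
          using True h1 by (intro mult_mono) (auto simp: \<rho>_def)
        also have "\<dots> \<le> cmod (1 - hinner (sgn z) w)"
          using u_ge[OF ns, of z] \<delta> by simp
        finally have "cmod (1 - hinner z w) \<le> 2 * cmod (1 - hinner (sgn z) w)" by simp
        moreover have "cmod (1 - hinner z w) > 0" "cmod (1 - hinner (sgn z) w) > 0"
          using u_ge[of z] u_ge[OF ns, of z] True \<delta> by linarith+
        ultimately have "1 / cmod (1 - hinner (sgn z) w) \<le> 2 * (1 / cmod (1 - hinner z w))"
          by (simp add: field_simps)
        then have "(1 / cmod (1 - hinner (sgn z) w)) ^ p \<le> (2 * (1 / cmod (1 - hinner z w))) ^ p"
          by (intro power_mono) auto
        then have "(1 / cmod (1 - hinner (sgn z) w)) ^ p \<le> 2 ^ p * (1 / cmod (1 - hinner z w)) ^ p"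
          by (simp only: power_mult_distrib)
        then have "G (sgn z) \<le> ennreal (2 ^ p * (1 / cmod (1 - hinner z w)) ^ p)"
          unfolding G_def by (rule ennreal_leI)
        then show ?thesis using True by (simp add: ennreal_mult)
      qed (auto simp: indicator_def)
    qed
    also have "\<dots> = ennreal (2 ^ p) * (\<integral>\<^sup>+z. indicator (ball 0 1) z * ennreal ((1 / cmod (1 - hinner z w)) ^ p) \<partial>lborel)"
      by (rule nn_integral_cmult) measurable
    also have "\<dots> \<le> ennreal (2 ^ p) * ennreal (K0 * \<delta> ^ (?N + 1) / \<delta> ^ p)"
      unfolding \<delta>_def by (intro mult_left_mono ker w p) auto
    also have "\<dots> = ennreal (2 ^ p * (K0 * \<delta> ^ (?N + 1) / \<delta> ^ p))"
      using K0 \<delta> by (intro ennreal_mult[symmetric]) auto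
    finally have le: "ennreal (\<delta> / 2) * ?I \<le> ennreal (2 ^ p * (K0 * \<delta> ^ (?N + 1) / \<delta> ^ p))"
      by (simp add: \<rho>_def)
    obtain i where i: "?I = ennreal i" "i \<ge> 0" using fin by (cases ?I) auto
    have "\<delta> / 2 * i \<le> 2 ^ p * (K0 * \<delta> ^ (?N + 1) / \<delta> ^ p)"
      using le K0 \<delta> i by (simp add: ennreal_mult[symmetric] ennreal_le_iff)
    then have "(\<delta> / 2) * i \<le> (\<delta> / 2) * (2 ^ p * (2 * K0) * \<delta> ^ ?N / \<delta> ^ p)"
      by (simp add: algebra_simps)
    then have "i \<le> 2 ^ p * (2 * K0) * \<delta> ^ ?N / \<delta> ^ p"
      using \<delta> by (subst (asm) mult_le_cancel_left_pos) auto
    then show ?thesis using i by (simp add: \<delta>_def ennreal_leI)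
  qed
  then show ?thesis using K0 by (intro exI[of _ "2 * K0"]) simp
qed

text \<open>Polar coordinates as an inequality, by Fubini and the substitutions \<open>r = \<rho> |z|\<close>, \<open>y = \<rho> z\<close>.\<close>

lemma nn_integral_polar_le:
  fixes g :: "'a :: euclidean_space \<Rightarrow> ennreal"
  assumes [measurable]: "g \<in> borel_measurable borel"
  shows "(\<integral>\<^sup>+y. indicator (ball 0 1) y * g y \<partial>lborel)
    \<le> ennreal (2 ^ (DIM('a) + 1)) *
       (\<integral>\<^sup>+r. indicator {0<..<1} r * (\<integral>\<^sup>+z. indicator (ball 0 1) z * g (r *\<^sub>R sgn z) \<partial>lborel) \<partial>lborel)"
    (is "_ \<le> _ * ?R")
proof -
  let ?D = "DIM('a)"
  \<comment> \<open>The factor |y| / \<rho> turns into |z| under y = \<rho> z, and is then the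
    Jacobian of r = \<rho> |z|. The condition \<rho> > |y| turns into |z| < 1.\<close>
  define h :: "real \<Rightarrow> 'a \<Rightarrow> ennreal"
    where "h \<rho> y = ennreal (norm y / \<rho>) * (indicator {0..<1} (norm y) * indicator {0<..} (\<rho> - norm y) * g y)" for \<rho> y
  have [measurable]: "(\<lambda>x. h (fst x) (snd x)) \<in> borel_measurable (lborel \<Otimes>\<^sub>M lborel)"
    "(\<lambda>x. h (fst x) (fst x *\<^sub>R snd x)) \<in> borel_measurable (lborel \<Otimes>\<^sub>M lborel)"
    "\<And>\<rho>. h \<rho> \<in> borel_measurable borel"
    unfolding h_def by measurable
  \<comment> \<open>Only the range |y| < \<rho> < 2|y| is kept. The bound is uniform in y because
    |y|^DIM \<le> |y|, so the loss is the constant 2^(DIM + 1).\<close>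
  have inner: "ennreal (1 / 2 ^ (?D + 1)) \<le> (\<integral>\<^sup>+\<rho>. indicator {0<..} \<rho> * ennreal (1 / \<rho> ^ ?D) *
      (ennreal (norm y / \<rho>) * indicator {0<..} (\<rho> - norm y)) \<partial>lborel)"
    if y: "y \<noteq> 0" "norm y < 1" for y :: 'a
  proof -
    define a where "a = norm y"
    have a: "0 < a" "a < 1" using y by (auto simp: a_def)
    have "(1 / 2 ^ (?D + 1)) \<le> 1 / (2 * a) ^ ?D * (1 / 2) * a"
    proof -
      have "a ^ ?D \<le> a" using power_decreasing[of 1 ?D a] a by (auto simp: Suc_leI)
      then have "1 \<le> a / a ^ ?D" using a by simp
      then show ?thesis using a by (simp add: power_mult_distrib field_simps)
    qed
    then have "ennreal (1 / 2 ^ (?D + 1)) \<le> ennreal (1 / (2 * a) ^ ?D * (1 / 2) * a)"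
      by (rule ennreal_leI)
    also have "\<dots> = ennreal (1 / (2 * a) ^ ?D * (1 / 2)) * emeasure lborel {a<..<2 * a}"
      using a by (subst ennreal_mult) auto
    also have "\<dots> = (\<integral>\<^sup>+\<rho>. ennreal (1 / (2 * a) ^ ?D * (1 / 2)) * indicator {a<..<2 * a} \<rho> \<partial>lborel)"
      by (simp add: nn_integral_cmult)
    also have "\<dots> \<le> (\<integral>\<^sup>+\<rho>. indicator {0<..} \<rho> * ennreal (1 / \<rho> ^ ?D) *
      (ennreal (a / \<rho>) * indicator {0<..} (\<rho> - a)) \<partial>lborel)"
    proof (rule nn_integral_mono)
      fix \<rho> :: real
      show "ennreal (1 / (2 * a) ^ ?D * (1 / 2)) * indicator {a<..<2 * a} \<rho>
        \<le> indicator {0<..} \<rho> * ennreal (1 / \<rho> ^ ?D) * (ennreal (a / \<rho>) * indicator {0<..} (\<rho> - a))"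
      proof (cases "a < \<rho> \<and> \<rho> < 2 * a")
        case True
        have "1 / (2 * a) ^ ?D * (1 / 2) \<le> 1 / \<rho> ^ ?D * (a / \<rho>)"
          using True a by (intro mult_mono divide_left_mono power_mono) (auto simp: field_simps)
        then have "ennreal (1 / (2 * a) ^ ?D * (1 / 2)) \<le> ennreal (1 / \<rho> ^ ?D * (a / \<rho>))"
          by (rule ennreal_leI)
        also have "\<dots> = ennreal (1 / \<rho> ^ ?D) * ennreal (a / \<rho>)"
          using True a by (intro ennreal_mult) auto
        finally show ?thesis using True a by simp
      qed (auto simp: indicator_def)
    qed
    finally show ?thesis by (simp add: a_def)
  qed
  have "ennreal (1 / 2 ^ (?D + 1)) * (\<integral>\<^sup>+y. indicator (ball 0 1) y * g y \<partial>lborel)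
      = (\<integral>\<^sup>+y. ennreal (1 / 2 ^ (?D + 1)) * (indicator (ball 0 1) y * g y) \<partial>lborel)"
    by (rule nn_integral_cmult[symmetric]) measurable
  also have "\<dots> \<le> (\<integral>\<^sup>+y. \<integral>\<^sup>+\<rho>. indicator {0<..} \<rho> * ennreal (1 / \<rho> ^ ?D) * h \<rho> y \<partial>lborel \<partial>lborel)"
  proof (rule nn_integral_mono_AE)
    show "AE y :: 'a in lborel. ennreal (1 / 2 ^ (?D + 1)) * (indicator (ball 0 1) y * g y)
        \<le> (\<integral>\<^sup>+\<rho>. indicator {0<..} \<rho> * ennreal (1 / \<rho> ^ ?D) * h \<rho> y \<partial>lborel)"
      using AE_lborel_singleton[of 0]
    proof eventually_elim
      case (elim y)
      show ?case
      proof (cases "norm y < 1")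
        case True
        have "ennreal (1 / 2 ^ (?D + 1)) * g y \<le> (\<integral>\<^sup>+\<rho>. indicator {0<..} \<rho> * ennreal (1 / \<rho> ^ ?D) *
          (ennreal (norm y / \<rho>) * indicator {0<..} (\<rho> - norm y)) \<partial>lborel) * g y"
          by (intro mult_right_mono inner elim True) auto
        also have "\<dots> = (\<integral>\<^sup>+\<rho>. indicator {0<..} \<rho> * ennreal (1 / \<rho> ^ ?D) *
          (ennreal (norm y / \<rho>) * indicator {0<..} (\<rho> - norm y)) * g y \<partial>lborel)"
          by (rule nn_integral_multc[symmetric]) measurable
        also have "\<dots> = (\<integral>\<^sup>+\<rho>. indicator {0<..} \<rho> * ennreal (1 / \<rho> ^ ?D) * h \<rho> y \<partial>lborel)"
          using True by (intro nn_integral_cong) (simp add: h_def mult_ac)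
        finally show ?thesis using True by simp
      qed simp
    qed
  qed
  also have "\<dots> = (\<integral>\<^sup>+\<rho>. \<integral>\<^sup>+y. indicator {0<..} \<rho> * ennreal (1 / \<rho> ^ ?D) * h \<rho> y \<partial>lborel \<partial>lborel)"
    by (rule lborel_pair.Fubini') measurable
  also have "\<dots> = (\<integral>\<^sup>+\<rho>. \<integral>\<^sup>+z. indicator {0<..} \<rho> * h \<rho> (\<rho> *\<^sub>R z) \<partial>lborel \<partial>lborel)"
  proof (rule nn_integral_cong)
    fix \<rho> :: real
    have "(\<integral>\<^sup>+y. indicator {0<..} \<rho> * ennreal (1 / \<rho> ^ ?D) * h \<rho> y \<partial>lborel)
        = indicator {0<..} \<rho> * (ennreal (1 / \<rho> ^ ?D) * (\<integral>\<^sup>+y. h \<rho> y \<partial>lborel))"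
      by (subst nn_integral_cmult) (auto simp: mult.assoc)
    also have "\<dots> = indicator {0<..} \<rho> * (\<integral>\<^sup>+z. h \<rho> (\<rho> *\<^sub>R z) \<partial>lborel)"
      by (cases "\<rho> > 0") (auto simp: nn_integral_lborel_dilate)
    also have "\<dots> = (\<integral>\<^sup>+z. indicator {0<..} \<rho> * h \<rho> (\<rho> *\<^sub>R z) \<partial>lborel)"
      by (rule nn_integral_cmult[symmetric]) measurable
    finally show "(\<integral>\<^sup>+y. indicator {0<..} \<rho> * ennreal (1 / \<rho> ^ ?D) * h \<rho> y \<partial>lborel) = \<dots>" .
  qed
  also have "\<dots> = (\<integral>\<^sup>+z. \<integral>\<^sup>+\<rho>. indicator {0<..} \<rho> * h \<rho> (\<rho> *\<^sub>R z) \<partial>lborel \<partial>lborel)"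
    by (rule lborel_pair.Fubini'[symmetric]) measurable
  also have "\<dots> \<le> (\<integral>\<^sup>+z. \<integral>\<^sup>+r. indicator {0<..<1} r * (indicator (ball 0 1) z * g (r *\<^sub>R sgn z)) \<partial>lborel \<partial>lborel)"
  proof (rule nn_integral_mono)
    fix z :: 'a
    show "(\<integral>\<^sup>+\<rho>. indicator {0<..} \<rho> * h \<rho> (\<rho> *\<^sub>R z) \<partial>lborel)
      \<le> (\<integral>\<^sup>+r. indicator {0<..<1} r * (indicator (ball 0 1) z * g (r *\<^sub>R sgn z)) \<partial>lborel)"
    proof (cases "z = 0")
      case False
      have "(\<integral>\<^sup>+r. indicator {0<..<1} r * (indicator (ball 0 1) z * g (r *\<^sub>R sgn z)) \<partial>lborel)
        = ennreal \<bar>norm z\<bar> * (\<integral>\<^sup>+\<rho>. indicator {0<..<1} (0 + norm z * \<rho>) *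
            (indicator (ball 0 1) z * g ((0 + norm z * \<rho>) *\<^sub>R sgn z)) \<partial>lborel)"
        using False by (intro nn_integral_real_affine) auto
      also have "\<dots> = (\<integral>\<^sup>+\<rho>. ennreal (norm z) * (indicator {0<..<1} (norm z * \<rho>) *
            (indicator (ball 0 1) z * g ((norm z * \<rho>) *\<^sub>R sgn z))) \<partial>lborel)"
        by (subst nn_integral_cmult) auto
      finally have subst: "(\<integral>\<^sup>+r. indicator {0<..<1} r * (indicator (ball 0 1) z * g (r *\<^sub>R sgn z)) \<partial>lborel) = \<dots>" .
      show ?thesis unfolding subst
      proof (rule nn_integral_mono)
        fix \<rho> :: real
        show "indicator {0<..} \<rho> * h \<rho> (\<rho> *\<^sub>R z) \<le> ennreal (norm z) * (indicator {0<..<1} (norm z * \<rho>) *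
            (indicator (ball 0 1) z * g ((norm z * \<rho>) *\<^sub>R sgn z)))"
        proof (cases "\<rho> > 0")
          case True
          have "(norm z * \<rho>) *\<^sub>R sgn z = \<rho> *\<^sub>R z"
            using False by (simp add: sgn_div_norm)
          moreover have "norm z < 1" if "\<rho> * norm z < \<rho>" using that True by simp
          ultimately show ?thesis
            using True False by (auto simp: h_def indicator_def mult.commute)
        qed simp
      qed
    qed (simp add: h_def)
  qed
  also have "\<dots> = (\<integral>\<^sup>+r. \<integral>\<^sup>+z. indicator {0<..<1} r * (indicator (ball 0 1) z * g (r *\<^sub>R sgn z)) \<partial>lborel \<partial>lborel)"
    by (rule lborel_pair.Fubini') measurable
  also have "\<dots> = ?R"
    by (intro nn_integral_cong nn_integral_cmult) measurable
  finally have "ennreal (2 ^ (?D + 1)) * (ennreal (1 / 2 ^ (?D + 1)) * (\<integral>\<^sup>+y. indicator (ball 0 1) y * g y \<partial>lborel))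
     \<le> ennreal (2 ^ (?D + 1)) * ?R"
    by (intro mult_left_mono) auto
  moreover have "ennreal (2 ^ (?D + 1)) * ennreal (1 / 2 ^ (?D + 1)) = 1"
    by (subst ennreal_mult[symmetric]) auto
  ultimately show ?thesis by (simp only: mult.assoc[symmetric] mult_1)
qed

section \<open>Square means of holomorphic functions\<close>

lemma holomorphic_on_ball_continuous:
  "holomorphic_on_ball f \<Longrightarrow> continuous_on (ball 0 1) f"
  unfolding holomorphic_on_ball_def
  by (meson continuous_at_imp_continuous_on has_derivative_continuous)

lemma holomorphic_on_ball_slice:
  fixes f :: "complex^'n \<Rightarrow> complex"
  assumes f: "holomorphic_on_ball f" and "open S" and S: "\<And>c. c \<in> S \<Longrightarrow> z + c *s x \<in> ball 0 1"
  shows "(\<lambda>c. f (z + c *s x)) holomorphic_on S"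
proof (rule holomorphic_onI)
  fix c assume "c \<in> S"
  then obtain L where L: "(f has_derivative L) (at (z + c *s x))" "\<And>a v. L (a *s v) = a * L v"
    using f S unfolding holomorphic_on_ball_def by blast
  have "linear (\<lambda>h :: complex. h *s x)"
    by (rule linearI) (simp_all add: vec_eq_iff algebra_simps)
  then have "((\<lambda>h. h *s x) has_derivative (\<lambda>h. h *s x)) (at c)"
    by (intro bounded_linear_imp_has_derivative) (simp add: linear_conv_bounded_linear)
  then have "((\<lambda>c. z + c *s x) has_derivative (\<lambda>h. h *s x)) (at c)"
    by (auto intro!: derivative_eq_intros)
  then have "((\<lambda>c. f (z + c *s x)) has_derivative (\<lambda>h. L (h *s x))) (at c)"
    by (rule has_derivative_compose) (rule L(1))
  then have "((\<lambda>c. f (z + c *s x)) has_field_derivative L x) (at c)"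
    by (simp add: has_field_derivative_def L(2) mult.commute[of _ "L x"])
  then show "(\<lambda>c. f (z + c *s x)) field_differentiable at c within S"
    by (meson field_differentiable_at_within field_differentiable_def)
qed

text \<open>Cauchy's formula is applied to f^2 instead of f, so that passing to absolute values
  already yields the square mean.\<close>

lemma square_norm_le_circle_mean:
  assumes cont: "continuous_on (cball 0 1) f" and hol: "f holomorphic_on ball 0 1"
  shows "ennreal ((cmod (f 0))\<^sup>2)
    \<le> (\<integral>\<^sup>+t. ennreal ((cmod (f (exp (2 * of_real pi * \<i> * of_real t))))\<^sup>2) * indicator {0..1} t \<partial>lborel)"
proof -
  let ?e = "\<lambda>t :: real. exp (2 * of_real pi * \<i> * of_real t)"
  have e1: "cmod (?e t) = 1" for t
    by (simp add: norm_exp_eq_Re)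
  have "((\<lambda>u. (f u)\<^sup>2 / (u - 0)) has_contour_integral (2 * of_real pi * \<i> * (f 0)\<^sup>2)) (circlepath 0 1)"
    by (rule Cauchy_integral_circlepath) (auto intro!: continuous_intros holomorphic_intros cont hol)
  then have "((\<lambda>t. (f (?e t))\<^sup>2 / ?e t * (2 * pi * \<i> * ?e t)) has_integral (2 * of_real pi * \<i> * (f 0)\<^sup>2)) {0..1}"
    unfolding has_contour_integral_def
    by (rule has_integral_eq[rotated]) (simp add: vector_derivative_circlepath01, simp add: circlepath)
  then have "((\<lambda>t. (2 * of_real pi * \<i>) * (f (?e t))\<^sup>2) has_integral (2 * of_real pi * \<i> * (f 0)\<^sup>2)) {0..1}"
    by (rule has_integral_eq[rotated]) simp
  then have "((\<lambda>t. inverse (2 * of_real pi * \<i>) * ((2 * of_real pi * \<i>) * (f (?e t))\<^sup>2)) has_integral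
      (inverse (2 * of_real pi * \<i>) * (2 * of_real pi * \<i> * (f 0)\<^sup>2))) {0..1}"
    by (rule has_integral_mult_right)
  then have I: "((\<lambda>t. (f (?e t))\<^sup>2) has_integral (f 0)\<^sup>2) {0..1}"
  proof -
    have "inverse (2 * complex_of_real pi * \<i>) * (2 * of_real pi * \<i> * a) = a" for a
      by (simp add: field_simps)
    with \<open>(_ has_integral (inverse _ * _)) _\<close> show ?thesis by (simp only:)
  qed
  have c: "continuous_on {0..1} (\<lambda>t. (cmod (f (?e t)))\<^sup>2)"
    by (intro continuous_intros continuous_on_compose2[OF cont]) (auto simp: e1)
  then have J: "((\<lambda>t. (cmod (f (?e t)))\<^sup>2) has_integral integral {0..1} (\<lambda>t. (cmod (f (?e t)))\<^sup>2)) {0..1}"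
    using integrable_continuous_interval integrable_integral by blast
  have "norm (integral {0..1} (\<lambda>t. (f (?e t))\<^sup>2)) \<le> integral {0..1} (\<lambda>t. (cmod (f (?e t)))\<^sup>2)"
    using I J by (intro integral_norm_bound_integral) (auto simp: norm_power)
  then have "(cmod (f 0))\<^sup>2 \<le> integral {0..1} (\<lambda>t. (cmod (f (?e t)))\<^sup>2)"
    using integral_unique[OF I] by (simp add: norm_power)
  then have "ennreal ((cmod (f 0))\<^sup>2) \<le> ennreal (integral {0..1} (\<lambda>t. (cmod (f (?e t)))\<^sup>2))"
    by (rule ennreal_leI)
  also have "\<dots> = (\<integral>\<^sup>+t. ennreal ((cmod (f (?e t)))\<^sup>2) * indicator {0..1} t \<partial>lborel)"
    by (rule nn_integral_has_integral_lebesgue'[symmetric]) (use J in auto)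
  finally show ?thesis .
qed

lemma borel_measurable_sq_norm_ball:
  assumes "continuous_on (ball 0 1) f"
  shows "(\<lambda>z. indicator (ball 0 1) z * ennreal ((cmod (f z))\<^sup>2)) \<in> borel_measurable borel"
proof -
  have [measurable]: "(\<lambda>z. indicat_real (ball 0 1) z *\<^sub>R f z) \<in> borel_measurable borel"
    using assms by (intro borel_measurable_continuous_on_indicator) auto
  have "(\<lambda>z. indicator (ball 0 1) z * ennreal ((cmod (f z))\<^sup>2))
      = (\<lambda>z. ennreal ((cmod (indicat_real (ball 0 1) z *\<^sub>R f z))\<^sup>2))"
    by (auto simp: indicator_def)
  also have "\<dots> \<in> borel_measurable borel" by measurable
  finally show ?thesis .
qed

text \<open>The mean inequality on the discs c \<mapsto> z + c x is integrated over x in E.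
  Multiplication by a phase preserves both E and Lebesgue measure, so after exchanging the integrals
  the inner one no longer depends on the angle.\<close>

lemma submean_circular:
  fixes f :: "complex^'n \<Rightarrow> complex"
  assumes f: "holomorphic_on_ball f" and [measurable]: "E \<in> sets borel"
    and circ: "\<And>c x. cmod c = 1 \<Longrightarrow> c *s x \<in> E \<longleftrightarrow> x \<in> E"
    and ball: "\<And>c x. x \<in> E \<Longrightarrow> cmod c \<le> 1 \<Longrightarrow> z + c *s x \<in> ball 0 1"
  shows "ennreal ((cmod (f z))\<^sup>2) * emeasure lborel E
    \<le> (\<integral>\<^sup>+x. indicator E x * ennreal ((cmod (f (z + x)))\<^sup>2) \<partial>lborel)"
proof -
  let ?e = "\<lambda>t :: real. exp (2 * of_real pi * \<i> * of_real t)"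
  have e1: "cmod (?e t) = 1" for t
    by (simp add: norm_exp_eq_Re)
  define G where "G z = indicator (ball 0 1) z * ennreal ((cmod (f z))\<^sup>2)" for z
  have [measurable]: "G \<in> borel_measurable borel"
    unfolding G_def[abs_def] by (intro borel_measurable_sq_norm_ball holomorphic_on_ball_continuous f)
  have [measurable]: "(\<lambda>p. z + ?e (snd p) *s fst p) \<in> borel_measurable (borel \<Otimes>\<^sub>M borel)"
    "(\<lambda>p. z + ?e (fst p) *s snd p) \<in> borel_measurable (borel \<Otimes>\<^sub>M borel)"
    unfolding borel_prod by (intro borel_measurable_continuous_onI continuous_intros)+
  have [measurable]: "(\<lambda>p. G (z + ?e (snd p) *s fst p)) \<in> borel_measurable (lborel \<Otimes>\<^sub>M lborel)"
    "(\<lambda>p. G (z + ?e (fst p) *s snd p)) \<in> borel_measurable (lborel \<Otimes>\<^sub>M lborel)"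
    by (intro measurable_compose[OF _ \<open>G \<in> _\<close>], measurable)+
  have pt: "ennreal ((cmod (f z))\<^sup>2) * indicator E x
      \<le> (\<integral>\<^sup>+t. indicator {0..1} t * (indicator E x * G (z + ?e t *s x)) \<partial>lborel)" for x
  proof (cases "x \<in> E")
    case True
    have "ennreal ((cmod (f (z + 0 *s x)))\<^sup>2)
      \<le> (\<integral>\<^sup>+t. ennreal ((cmod (f (z + ?e t *s x)))\<^sup>2) * indicator {0..1} t \<partial>lborel)"
    proof (rule square_norm_le_circle_mean)
      show "continuous_on (cball 0 1) (\<lambda>c. f (z + c *s x))"
        using ball[OF True]
        by (intro continuous_on_compose2[OF holomorphic_on_ball_continuous[OF f]] continuous_intros) auto
      show "(\<lambda>c. f (z + c *s x)) holomorphic_on ball 0 1"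
        using ball[OF True] by (intro holomorphic_on_ball_slice f) auto
    qed
    also have "\<dots> = (\<integral>\<^sup>+t. indicator {0..1} t * (indicator E x * G (z + ?e t *s x)) \<partial>lborel)"
      using ball[OF True] e1 True by (intro nn_integral_cong) (auto simp: G_def mult.commute)
    finally show ?thesis using True by simp
  qed simp
  have "ennreal ((cmod (f z))\<^sup>2) * emeasure lborel E = (\<integral>\<^sup>+x. ennreal ((cmod (f z))\<^sup>2) * indicator E x \<partial>lborel)"
    by (simp add: nn_integral_cmult)
  also have "\<dots> \<le> (\<integral>\<^sup>+x. \<integral>\<^sup>+t. indicator {0..1} t * (indicator E x * G (z + ?e t *s x)) \<partial>lborel \<partial>lborel)"
    by (intro nn_integral_mono pt)
  also have "\<dots> = (\<integral>\<^sup>+t. \<integral>\<^sup>+x. indicator {0..1} t * (indicator E x * G (z + ?e t *s x)) \<partial>lborel \<partial>lborel)"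
    by (rule lborel_pair.Fubini') measurable
  also have "\<dots> = (\<integral>\<^sup>+t. indicator {0..1 :: real} t * (\<integral>\<^sup>+x. indicator E x * G (z + x) \<partial>lborel) \<partial>lborel)"
  proof (rule nn_integral_cong)
    fix t :: real
    have "(\<integral>\<^sup>+x. indicator {0..1} t * (indicator E x * G (z + ?e t *s x)) \<partial>lborel)
        = (\<integral>\<^sup>+x. indicator {0..1} t * (indicator E (?e t *s x) * G (z + ?e t *s x)) \<partial>lborel)"
      using circ[OF e1, of t] by (simp add: indicator_def)
    also have "\<dots> = (\<integral>\<^sup>+x. indicator {0..1} t * (indicator E x * G (z + x)) \<partial>lborel)"
      by (rule nn_integral_lborel_orthogonal[OF orthogonal_transformation_phase[OF e1]]) measurable
    also have "\<dots> = indicator {0..1 :: real} t * (\<integral>\<^sup>+x. indicator E x * G (z + x) \<partial>lborel)"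
      by (rule nn_integral_cmult) measurable
    finally show "(\<integral>\<^sup>+x. indicator {0..1} t * (indicator E x * G (z + ?e t *s x)) \<partial>lborel) = \<dots>" .
  qed
  also have "\<dots> = (\<integral>\<^sup>+x. indicator E x * G (z + x) \<partial>lborel)"
    by (subst nn_integral_multc) auto
  also have "\<dots> = (\<integral>\<^sup>+x. indicator E x * ennreal ((cmod (f (z + x)))\<^sup>2) \<partial>lborel)"
    using ball[of _ 1] by (intro nn_integral_cong) (auto simp: G_def indicator_def)
  finally show ?thesis .
qed

text \<open>A displacement in E changes 1 - |z|^2 by less than 2\<delta>/6 + \<delta>/6 =
  \<delta>/2, so the mean involves only points about as far from the sphere as z. On them a Bergman
  weight is constant up to a factor, and for the Hardy space only a short range of radii
  occurs.\<close>

lemma local_square_mean_bound: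
  fixes f :: "complex^'n \<Rightarrow> complex"
  assumes f: "holomorphic_on_ball f" and z: "norm z < 1" and \<delta>_def: "\<delta> = 1 - (norm z)\<^sup>2"
  shows "ennreal ((cmod (f z))\<^sup>2 * ((\<delta> / (3 * CARD('n))) ^ (CARD('n) + 1) / 4))
    \<le> (\<integral>\<^sup>+y. indicator {y \<in> ball 0 1. \<delta> / 2 \<le> 1 - (norm y)\<^sup>2 \<and> 1 - (norm y)\<^sup>2 \<le> 2 * \<delta>} y
          * ennreal ((cmod (f y))\<^sup>2) \<partial>lborel)"
proof -
  have \<delta>: "0 < \<delta>" "\<delta> \<le> 1"
    using z by (auto simp: \<delta>_def power_less_one_iff)
  define E where "E = {x :: complex^'n. cmod (hinner x z) < \<delta> / 6 \<and> (norm x)\<^sup>2 < \<delta> / 6}"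
  let ?A = "{y :: complex^'n. y \<in> ball 0 1 \<and> \<delta> / 2 \<le> 1 - (norm y)\<^sup>2 \<and> 1 - (norm y)\<^sup>2 \<le> 2 * \<delta>}"
  have "open E"
    unfolding E_def by (intro open_Collect_conj open_Collect_less continuous_intros)
  then have [measurable]: "E \<in> sets borel" by simp
  have nrm: "(norm (z + x))\<^sup>2 = (norm z)\<^sup>2 + 2 * Re (hinner x z) + (norm x)\<^sup>2" for x
    by (simp add: Re_hinner power2_norm_eq_inner inner_add_left inner_add_right inner_commute)
  have inA: "z + x \<in> ?A" if "x \<in> E" for x
  proof -
    have "\<bar>Re (hinner x z)\<bar> < \<delta> / 6"
      using that abs_Re_le_cmod[of "hinner x z"] by (auto simp: E_def)
    moreover have "(norm x)\<^sup>2 < \<delta> / 6" "(norm x)\<^sup>2 \<ge> 0" using that by (auto simp: E_def)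
    ultimately have *: "\<delta> / 2 \<le> 1 - (norm (z + x))\<^sup>2" "1 - (norm (z + x))\<^sup>2 \<le> 2 * \<delta>"
      unfolding nrm \<delta>_def[symmetric] using \<delta> \<delta>_def by linarith+
    then have "(norm (z + x))\<^sup>2 < 1" using \<delta> by linarith
    then have "norm (z + x) < 1" by (metis abs_norm_cancel abs_square_less_1)
    with * show ?thesis by simp
  qed
  have scaleE: "c *s x \<in> E" if "x \<in> E" "cmod c \<le> 1" for c x
  proof -
    have "cmod c * cmod (hinner x z) \<le> cmod (hinner x z)" "(cmod c)\<^sup>2 * (norm x)\<^sup>2 \<le> (norm x)\<^sup>2"
      using that(2) by (auto simp: mult_left_le_one_le power_le_one)
    then show ?thesis
      using that by (auto simp: E_def hinner_simps norm_mult norm_scale_vec power_mult_distrib)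
  qed
  have circ: "c *s x \<in> E \<longleftrightarrow> x \<in> E" if "cmod c = 1" for c x
    using that by (simp add: E_def hinner_simps norm_mult norm_scale_vec)
  define G where "G z = indicator (ball 0 1) z * ennreal ((cmod (f z))\<^sup>2)" for z
  have [measurable]: "G \<in> borel_measurable borel"
    unfolding G_def[abs_def] by (intro borel_measurable_sq_norm_ball holomorphic_on_ball_continuous f)
  have [measurable]: "?A \<in> sets borel"
  proof -
    have "?A = ball 0 1 \<inter> {y. \<delta> / 2 \<le> 1 - (norm y)\<^sup>2} \<inter> {y. 1 - (norm y)\<^sup>2 \<le> 2 * \<delta>}" by auto
    also have "\<dots> \<in> sets borel"
    proof (intro sets.Int)
      show "{y :: complex^'n. \<delta> / 2 \<le> 1 - (norm y)\<^sup>2} \<in> sets borel"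
        "{y :: complex^'n. 1 - (norm y)\<^sup>2 \<le> 2 * \<delta>} \<in> sets borel"
        by (intro borel_closed closed_Collect_le continuous_intros)+
    qed simp
    finally show ?thesis .
  qed
  have "ennreal ((cmod (f z))\<^sup>2 * ((\<delta> / (3 * CARD('n))) ^ (CARD('n) + 1) / 4))
      = ennreal ((cmod (f z))\<^sup>2) * ennreal ((\<delta> / (3 * CARD('n))) ^ (CARD('n) + 1) / 4)"
    using \<delta> by (intro ennreal_mult) auto
  also have "\<dots> \<le> ennreal ((cmod (f z))\<^sup>2) * emeasure lborel E"
    unfolding E_def using emeasure_circular_nbhd_ge[of z \<delta>] z \<delta> by (intro mult_left_mono) auto
  also have "\<dots> \<le> (\<integral>\<^sup>+x. indicator E x * ennreal ((cmod (f (z + x)))\<^sup>2) \<partial>lborel)"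
    using inA scaleE circ by (intro submean_circular f) auto
  also have "\<dots> \<le> (\<integral>\<^sup>+x. indicator ?A (x + z) * G (x + z) \<partial>lborel)"
  proof (rule nn_integral_mono)
    fix x
    show "indicator E x * ennreal ((cmod (f (z + x)))\<^sup>2) \<le> indicator ?A (x + z) * G (x + z)"
      using inA[of x] by (cases "x \<in> E") (auto simp: G_def add.commute)
  qed
  also have "\<dots> = (\<integral>\<^sup>+y. indicator ?A y * G y \<partial>lborel)"
    by (rule nn_integral_lborel_translate) measurable
  also have "\<dots> = (\<integral>\<^sup>+y. indicator ?A y * ennreal ((cmod (f y))\<^sup>2) \<partial>lborel)"
    by (intro nn_integral_cong) (auto simp: G_def indicator_def)
  finally show ?thesis .
qed

section \<open>Integration against the normalized measures, and a radial integral\<close>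

lemma nn_integral_ball_measure:
  fixes h :: "complex^'n \<Rightarrow> ennreal"
  assumes [measurable]: "(\<lambda>z. indicator (ball 0 1) z * h z) \<in> borel_measurable borel"
  shows "(\<integral>\<^sup>+z. h z \<partial>ball_measure)
    = (\<integral>\<^sup>+z. indicator (ball 0 1) z * h z \<partial>lborel) / emeasure lborel (ball (0 :: complex^'n) 1)"
proof -
  have "(\<integral>\<^sup>+z. h z \<partial>ball_measure)
      = (\<integral>\<^sup>+z. indicator (ball 0 1) z * h z \<partial>uniform_measure lborel (ball (0 :: complex^'n) 1))"
    unfolding ball_measure_def by (subst nn_integral_restrict_space) (auto simp: mult.commute)
  also have "\<dots> = (\<integral>\<^sup>+z. (indicator (ball 0 1) z * h z) * indicator (ball 0 1) z \<partial>lborel)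
      / emeasure lborel (ball (0 :: complex^'n) 1)"
    by (rule nn_integral_uniform_measure) auto
  also have "(\<integral>\<^sup>+z. (indicator (ball 0 1) z * h z) * indicator (ball 0 1) z \<partial>lborel)
      = (\<integral>\<^sup>+z. indicator (ball 0 1) z * h z \<partial>lborel)"
    by (intro nn_integral_cong) (auto simp: indicator_def)
  finally show ?thesis .
qed

lemma nn_integral_sphere_measure:
  fixes h :: "complex^'n \<Rightarrow> ennreal"
  assumes [measurable]: "(\<lambda>z. indicator (sphere 0 1) z * h z) \<in> borel_measurable borel"
  shows "(\<integral>\<^sup>+z. h z \<partial>sphere_measure)
    = (\<integral>\<^sup>+z. indicator (ball 0 1) z * h (sgn z) \<partial>lborel) / emeasure lborel (ball (0 :: complex^'n) 1)"
proof -
  have "(\<integral>\<^sup>+z. h z \<partial>sphere_measure)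
      = (\<integral>\<^sup>+z. indicator (sphere 0 1) z * h z \<partial>distr (uniform_measure lborel (ball (0 :: complex^'n) 1)) borel sgn)"
    unfolding sphere_measure_def by (subst nn_integral_restrict_space) (auto simp: mult.commute)
  also have "\<dots> = (\<integral>\<^sup>+z. indicator (sphere 0 1) (sgn z) * h (sgn z) \<partial>uniform_measure lborel (ball (0 :: complex^'n) 1))"
    by (rule nn_integral_distr) measurable
  also have "\<dots> = (\<integral>\<^sup>+z. (indicator (sphere 0 1) (sgn z) * h (sgn z)) * indicator (ball 0 1) z \<partial>lborel)
      / emeasure lborel (ball (0 :: complex^'n) 1)"
    by (rule nn_integral_uniform_measure) auto
  also have "(\<integral>\<^sup>+z. (indicator (sphere 0 1) (sgn z) * h (sgn z)) * indicator (ball 0 1) z \<partial>lborel)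
      = (\<integral>\<^sup>+z. indicator (ball 0 1) z * h (sgn z) \<partial>lborel)"
  proof (rule nn_integral_cong_AE)
    show "AE z in lborel. (indicator (sphere 0 1) (sgn z) * h (sgn z)) * indicator (ball 0 1) z
        = indicator (ball 0 1) z * h (sgn z)"
      using AE_lborel_singleton[of "0 :: complex^'n"]
      by eventually_elim (simp add: norm_sgn indicator_def)
  qed
  finally show ?thesis .
qed

text \<open>The integral is split at x = \<delta>, where the minimum changes its branch. Convergence
  at 0 comes from s > -1 and at infinity from q > s + 1; both pieces scale like \<delta>^(s + 1 -
  q).\<close>

lemma nn_integral_powr_cutoff_le:
  assumes s: "s > -1" and q: "q > s + 1" and \<delta>: "\<delta> > 0"
  shows "(\<integral>\<^sup>+x. indicator {0<..} x * ennreal (x powr s * min (\<delta> powr -q) (x powr -q)) \<partial>lborel)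
    \<le> ennreal ((1 / (s + 1) + 1 / (q - s - 1)) * \<delta> powr (s + 1 - q))"
proof -
  have "(\<integral>\<^sup>+x. indicator {0<..} x * ennreal (x powr s * min (\<delta> powr -q) (x powr -q)) \<partial>lborel)
    \<le> (\<integral>\<^sup>+x. ennreal (\<delta> powr -q) * (ennreal (x powr s) * indicator {0..\<delta>} x)
          + ennreal (x powr (s - q)) * indicator {\<delta>..} x \<partial>lborel)"
  proof (rule nn_integral_mono)
    fix x :: real
    show "indicator {0<..} x * ennreal (x powr s * min (\<delta> powr -q) (x powr -q))
      \<le> ennreal (\<delta> powr -q) * (ennreal (x powr s) * indicator {0..\<delta>} x)
          + ennreal (x powr (s - q)) * indicator {\<delta>..} x"
    proof (cases "x > 0")
      case x: True
      show ?thesis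
      proof (cases "x \<le> \<delta>")
        case True
        have "ennreal (x powr s * min (\<delta> powr -q) (x powr -q)) \<le> ennreal (\<delta> powr -q * x powr s)"
          by (intro ennreal_leI) (simp add: mult.commute mult_left_mono)
        also have "\<dots> = ennreal (\<delta> powr -q) * ennreal (x powr s)" by (simp add: ennreal_mult)
        finally show ?thesis using True x by (simp add: add_increasing2)
      next
        case False
        have "x powr s * min (\<delta> powr -q) (x powr -q) \<le> x powr s * x powr -q"
          by (intro mult_left_mono) auto
        also have "\<dots> = x powr (s - q)" by (simp add: powr_add[symmetric])
        finally show ?thesis using False x by (simp add: ennreal_leI)
      qed
    qed simp
  qed
  also have "\<dots> = ennreal (\<delta> powr -q) * (\<integral>\<^sup>+x. ennreal (x powr s) * indicator {0..\<delta>} x \<partial>lborel)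
      + (\<integral>\<^sup>+x. ennreal (x powr (s - q)) * indicator {\<delta>..} x \<partial>lborel)"
    by (subst nn_integral_add) (auto simp: nn_integral_cmult)
  also have "(\<integral>\<^sup>+x. ennreal (x powr s) * indicator {0..\<delta>} x \<partial>lborel) = ennreal (\<delta> powr (s + 1) / (s + 1))"
    by (rule nn_integral_has_integral_lebesgue') (use has_integral_powr_from_0[of s \<delta>] s \<delta> in auto)
  also have "(\<integral>\<^sup>+x. ennreal (x powr (s - q)) * indicator {\<delta>..} x \<partial>lborel)
      = ennreal (- (\<delta> powr (s - q + 1)) / (s - q + 1))"
    by (rule nn_integral_has_integral_lebesgue') (use has_integral_powr_to_inf[of "s - q" \<delta>] q \<delta> in auto)
  also have "ennreal (\<delta> powr -q) * ennreal (\<delta> powr (s + 1) / (s + 1)) + ennreal (- (\<delta> powr (s - q + 1)) / (s - q + 1))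
      = ennreal (\<delta> powr -q * (\<delta> powr (s + 1) / (s + 1)) + (- (\<delta> powr (s - q + 1)) / (s - q + 1)))"
  proof -
    have "0 \<le> - (\<delta> powr (s - q + 1)) / (s - q + 1)"
      using q by (intro divide_nonpos_neg) auto
    moreover have "0 \<le> \<delta> powr (s + 1) / (s + 1)" using s by simp
    ultimately show ?thesis
      by (subst ennreal_plus) (auto intro: mult_nonneg_nonneg simp: ennreal_mult simp del: times_divide_eq_right)
  qed
  also have "\<delta> powr -q * (\<delta> powr (s + 1) / (s + 1)) + (- (\<delta> powr (s - q + 1)) / (s - q + 1))
      = (1 / (s + 1) + 1 / (q - s - 1)) * \<delta> powr (s + 1 - q)"
  proof -
    have "\<delta> powr -q * \<delta> powr (s + 1) = \<delta> powr (s + 1 - q)"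
      by (simp add: powr_add[symmetric] algebra_simps)
    moreover have "- (\<delta> powr (s - q + 1)) / (s - q + 1) = \<delta> powr (s + 1 - q) / (q - s - 1)"
    proof -
      have "s - q + 1 = - (q - s - 1)" "s - q + 1 = s + 1 - q" by auto
      then show ?thesis by (metis minus_divide_divide minus_minus)
    qed
    ultimately show ?thesis by (simp add: algebra_simps)
  qed
  finally show ?thesis .
qed

section \<open>The Hardy space\<close>

text \<open>The growth scale \<open>\<gamma>\<close> is \<open>N\<close> for the Hardy space and \<open>N + s + 1\<close> for the weighted Bergman
  space: point evaluations grow at most like \<open>(1 - |z|\<^sup>2)\<^bsup>-\<gamma>/2\<^esup>\<close>, and powers of the Szego
  kernel have the matching norm.\<close>

locale kernel_growth_space =
  fixes H :: "(complex^'n \<Rightarrow> complex) set" and nrm :: "(complex^'n \<Rightarrow> complex) \<Rightarrow> real"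
    and \<gamma> :: real
  assumes growth_pos: "\<gamma> > 0"
    and diff_mem: "f \<in> H \<Longrightarrow> g \<in> H \<Longrightarrow> (\<lambda>z. f z - g z) \<in> H"
    and eval_bound: "\<exists>K. \<forall>f\<in>H. \<forall>z. norm z < 1 \<longrightarrow>
      cmod (f z) \<le> K * (1 - (norm z)\<^sup>2) powr (-\<gamma>/2) * nrm f"
    and kernel_bound: "\<exists>m0. \<forall>m\<ge>m0. \<exists>K. \<forall>w c. norm w < 1 \<longrightarrow>
      (\<lambda>z. c / (1 - hinner z w) ^ m) \<in> H \<and>
      nrm (\<lambda>z. c / (1 - hinner z w) ^ m) \<le> K * cmod c * (1 - (norm w)\<^sup>2) powr (\<gamma>/2 - real m)"

lemma holomorphic_on_ball_diff:
  fixes f g :: "complex^'n \<Rightarrow> complex"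
  assumes "holomorphic_on_ball f" "holomorphic_on_ball g"
  shows "holomorphic_on_ball (\<lambda>z. f z - g z)"
  unfolding holomorphic_on_ball_def
proof
  fix z :: "complex^'n" assume z: "z \<in> ball 0 1"
  obtain L where L: "(f has_derivative L) (at z)" "\<And>c v. L (c *s v) = c * L v"
    using assms(1) z unfolding holomorphic_on_ball_def by blast
  obtain M where M: "(g has_derivative M) (at z)" "\<And>c v. M (c *s v) = c * M v"
    using assms(2) z unfolding holomorphic_on_ball_def by blast
  have "((\<lambda>z. f z - g z) has_derivative (\<lambda>v. L v - M v)) (at z)"
    using L(1) M(1) by (rule has_derivative_diff)
  then show "\<exists>L. ((\<lambda>z. f z - g z) has_derivative L) (at z) \<and> (\<forall>c v. L (c *s v) = c * L v)"
    using L(2) M(2) by (intro exI[of _ "\<lambda>v. L v - M v"]) (auto simp: algebra_simps)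
qed

lemma one_minus_hinner_nonzero:
  assumes "norm z \<le> 1" "norm w < 1"
  shows "1 - hinner z w \<noteq> 0"
  using norm_diff_hinner_le[of z w] assms by auto

lemma holomorphic_on_ball_kernel:
  fixes w :: "complex^'n"
  assumes w: "norm w < 1"
  shows "holomorphic_on_ball (\<lambda>z. c / (1 - hinner z w) ^ m)"
  unfolding holomorphic_on_ball_def
proof
  fix z :: "complex^'n" assume "z \<in> ball 0 1"
  then have nz: "1 - hinner z w \<noteq> 0"
    using one_minus_hinner_nonzero[of z w] w by simp
  have "(\<lambda>u. c / (1 - u) ^ m) field_differentiable at (hinner z w)"
    using nz by (intro derivative_intros) auto
  then obtain D where "((\<lambda>u. c / (1 - u) ^ m) has_field_derivative D) (at (hinner z w))"
    by (auto simp: field_differentiable_def)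
  then have D: "((\<lambda>u. c / (1 - u) ^ m) has_derivative (\<lambda>h. D * h)) (at (hinner z w))"
    by (simp add: has_field_derivative_def)
  have "((\<lambda>z. hinner z w) has_derivative (\<lambda>v. hinner v w)) (at z)"
    using linear_hinner[of w] by (intro bounded_linear_imp_has_derivative) (simp add: linear_conv_bounded_linear)
  then have "((\<lambda>z. c / (1 - hinner z w) ^ m) has_derivative (\<lambda>v. D * hinner v w)) (at z)"
    by (rule has_derivative_compose) (rule D)
  then show "\<exists>L. ((\<lambda>z. c / (1 - hinner z w) ^ m) has_derivative L) (at z) \<and> (\<forall>c v. L (c *s v) = c * L v)"
    by (intro exI[of _ "\<lambda>v. D * hinner v w"]) (auto simp: hinner_simps)
qed

text \<open>The last step of the growth bound for both spaces: n = N + 1 comes from the volume of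
  the neighbourhood, and e is 1 for the Hardy space and -s for the Bergman space, so that (e - n)/2
  = -\<gamma>/2.\<close>

lemma square_eval_bound:
  fixes S :: ennreal and n :: nat
  assumes le: "ennreal (a\<^sup>2 * (c * \<delta> ^ n)) \<le> ennreal (K * \<delta> powr e) * S"
    and S: "S < \<infinity>" and pos: "\<delta> > 0" "c > 0" "K \<ge> 0" "a \<ge> 0"
  shows "a \<le> sqrt (K / c) * \<delta> powr ((e - real n) / 2) * sqrt (enn2real S)"
proof -
  define t where "t = enn2real S"
  have t: "S = ennreal t" "t \<ge> 0" using S by (auto simp: t_def)
  have "ennreal (a\<^sup>2 * (c * \<delta> ^ n)) \<le> ennreal (K * \<delta> powr e * t)"
    using le t pos by (simp add: ennreal_mult)
  then have "a\<^sup>2 * (c * \<delta> ^ n) \<le> K * \<delta> powr e * t"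
    using t pos by (subst (asm) ennreal_le_iff) auto
  then have "a\<^sup>2 \<le> K * \<delta> powr e * t / (c * \<delta> ^ n)"
    using pos by (subst pos_le_divide_eq) auto
  also have "\<dots> = (K / c) * (\<delta> powr (e - real n)) * t"
    using pos by (simp add: powr_diff powr_realpow)
  also have "\<dots> = (sqrt (K / c) * \<delta> powr ((e - real n) / 2) * sqrt t)\<^sup>2"
  proof -
    have "(\<delta> powr ((e - real n) / 2))\<^sup>2 = \<delta> powr (e - real n)"
      using pos by (simp add: power2_eq_square powr_add[symmetric])
    then show ?thesis using pos t by (simp add: power_mult_distrib)
  qed
  finally show ?thesis
    unfolding t_def[symmetric] by (rule power2_le_imp_le) (use pos t in auto)
qed

text \<open>The exponent \<gamma> - 2m is not positive, so passing from 1 - |w| to 1 - |w|^2 needs 1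
  - |w| \<ge> (1 - |w|^2)/2; this costs the power of 2.\<close>

lemma square_kernel_bound:
  fixes S :: ennreal and w :: "complex^'n"
  assumes le: "S \<le> ennreal (K * (cmod c)\<^sup>2 * (1 - norm w) powr (\<gamma> - 2 * real m))"
    and K: "K \<ge> 0" and w: "norm w < 1" and m: "\<gamma> \<le> 2 * real m"
  shows "S < \<infinity>"
    "sqrt (enn2real S) \<le> sqrt (K * 2 powr (2 * real m - \<gamma>)) * cmod c * (1 - (norm w)\<^sup>2) powr (\<gamma>/2 - real m)"
proof -
  show "S < \<infinity>" using le by (simp add: order_le_less_trans)
  define \<Delta> where "\<Delta> = 1 - (norm w)\<^sup>2"
  have \<Delta>: "\<Delta> > 0" using w by (simp add: \<Delta>_def power_less_one_iff)
  have "\<Delta> = (1 - norm w) * (1 + norm w)" by (simp add: \<Delta>_def power2_eq_square algebra_simps)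
  also have "\<dots> \<le> (1 - norm w) * 2" using w by (intro mult_left_mono) auto
  finally have "\<Delta> / 2 \<le> 1 - norm w" by simp
  then have "(1 - norm w) powr (\<gamma> - 2 * real m) \<le> (\<Delta> / 2) powr (\<gamma> - 2 * real m)"
    using \<Delta> m by (intro powr_mono2') auto
  also have "\<dots> = 2 powr (2 * real m - \<gamma>) * \<Delta> powr (\<gamma> - 2 * real m)"
    using \<Delta> powr_minus_divide[of 2 "\<gamma> - 2 * real m"] by (simp add: powr_divide)
  finally have 1: "(1 - norm w) powr (\<gamma> - 2 * real m) \<le> 2 powr (2 * real m - \<gamma>) * \<Delta> powr (\<gamma> - 2 * real m)" .
  have "enn2real S \<le> K * (cmod c)\<^sup>2 * (1 - norm w) powr (\<gamma> - 2 * real m)"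
    using le K by (metis enn2real_leI mult_nonneg_nonneg powr_ge_zero zero_le_power2)
  also have "\<dots> \<le> K * (cmod c)\<^sup>2 * (2 powr (2 * real m - \<gamma>) * \<Delta> powr (\<gamma> - 2 * real m))"
    using 1 K by (intro mult_left_mono) auto
  also have "\<dots> = (sqrt (K * 2 powr (2 * real m - \<gamma>)) * cmod c * \<Delta> powr (\<gamma>/2 - real m))\<^sup>2"
  proof -
    have "(\<Delta> powr (\<gamma>/2 - real m))\<^sup>2 = \<Delta> powr (\<gamma> - 2 * real m)"
      using \<Delta> by (simp add: power2_eq_square powr_add[symmetric])
    then show ?thesis using K by (simp add: power_mult_distrib)
  qed
  finally show "sqrt (enn2real S) \<le> sqrt (K * 2 powr (2 * real m - \<gamma>)) * cmod c * (1 - (norm w)\<^sup>2) powr (\<gamma>/2 - real m)"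
    unfolding \<Delta>_def[symmetric] using K by (intro real_le_lsqrt) auto
qed

lemma emeasure_unit_ball:
  obtains V where "emeasure lborel (ball (0 :: 'a :: euclidean_space) 1) = ennreal V" "V > 0"
proof
  show "emeasure lborel (ball (0 :: 'a) 1) = ennreal (measure lborel (ball (0 :: 'a) 1))"
    using emeasure_lborel_ball_finite[of "0 :: 'a" 1] by (intro emeasure_eq_ennreal_measure) auto
  show "measure lborel (ball (0 :: 'a) 1) > 0" by (rule content_ball_pos) simp
qed

lemma ennreal_mult_divide_cancel:
  assumes "V > 0"
  shows "ennreal V * (a / ennreal V) = a"
  using assms by (simp add: ennreal_times_divide mult.commute[of _ a] ennreal_mult_divide_eq)

lemma cmod_diff_square_le: "(cmod (a - b))\<^sup>2 \<le> 2 * (cmod a)\<^sup>2 + 2 * (cmod b)\<^sup>2"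
proof -
  have "(cmod (a - b))\<^sup>2 \<le> (cmod a + cmod b)\<^sup>2"
    by (intro power_mono norm_triangle_ineq4) auto
  also have "\<dots> \<le> 2 * (cmod a)\<^sup>2 + 2 * (cmod b)\<^sup>2"
    using sum_squares_bound[of "cmod a" "cmod b"] by (simp add: power2_sum)
  finally show ?thesis .
qed

lemma continuous_on_dilated_sphere:
  assumes "holomorphic_on_ball f" "0 < r" "r < 1"
  shows "continuous_on (sphere 0 1) (\<lambda>z. f (r *\<^sub>R z))"
  using assms by (intro continuous_on_compose2[OF holomorphic_on_ball_continuous] continuous_intros) auto

lemma nn_integral_sphere_measure_holomorphic:
  fixes f :: "complex^'n \<Rightarrow> complex"
  assumes f: "holomorphic_on_ball f" and r: "0 < r" "r < 1"
  shows "(\<integral>\<^sup>+z. indicator (ball 0 1) z * ennreal ((cmod (f (r *\<^sub>R sgn z)))\<^sup>2) \<partial>lborel)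
    = emeasure lborel (ball (0 :: complex^'n) 1) * (\<integral>\<^sup>+\<zeta>. ennreal ((cmod (f (r *\<^sub>R \<zeta>)))\<^sup>2) \<partial>sphere_measure)"
proof -
  have [measurable]: "(\<lambda>z. indicat_real (sphere 0 1) z *\<^sub>R f (r *\<^sub>R z)) \<in> borel_measurable borel"
    using continuous_on_dilated_sphere[OF f r] by (intro borel_measurable_continuous_on_indicator) auto
  have "(\<lambda>z. indicator (sphere 0 1) z * ennreal ((cmod (f (r *\<^sub>R z)))\<^sup>2))
      = (\<lambda>z. ennreal ((cmod (indicat_real (sphere 0 1) z *\<^sub>R f (r *\<^sub>R z)))\<^sup>2))"
    by (auto simp: indicator_def)
  also have "\<dots> \<in> borel_measurable borel" by measurable
  finally have "(\<integral>\<^sup>+\<zeta>. ennreal ((cmod (f (r *\<^sub>R \<zeta>)))\<^sup>2) \<partial>sphere_measure)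
    = (\<integral>\<^sup>+z. indicator (ball 0 1) z * ennreal ((cmod (f (r *\<^sub>R sgn z)))\<^sup>2) \<partial>lborel) / emeasure lborel (ball (0 :: complex^'n) 1)"
    by (rule nn_integral_sphere_measure)
  moreover obtain V where "emeasure lborel (ball (0 :: complex^'n) 1) = ennreal V" "V > 0"
    by (rule emeasure_unit_ball)
  ultimately show ?thesis by (simp add: ennreal_mult_divide_cancel)
qed

lemma borel_measurable_sphere_measure:
  fixes f :: "complex^'n \<Rightarrow> 'b :: topological_space"
  assumes "continuous_on (sphere 0 1) f"
  shows "f \<in> borel_measurable sphere_measure"
proof -
  have "sets sphere_measure = sets (restrict_space borel (sphere (0 :: complex^'n) 1))"
    unfolding sphere_measure_def by (rule sets_restrict_space_cong) simp
  then show ?thesis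
    using borel_measurable_continuous_on_restrict[OF assms] measurable_cong_sets by blast
qed

lemma hardy_sqnorm_diff_le:
  fixes f g :: "complex^'n \<Rightarrow> complex"
  assumes f: "holomorphic_on_ball f" and g: "holomorphic_on_ball g"
  shows "hardy_sqnorm (\<lambda>z. f z - g z) \<le> 2 * hardy_sqnorm f + 2 * hardy_sqnorm g"
  unfolding hardy_sqnorm_def[of "\<lambda>z. f z - g z"]
proof (rule SUP_least)
  fix r :: real assume r: "r \<in> {0<..<1}"
  have [measurable]: "(\<lambda>\<zeta>. f (r *\<^sub>R \<zeta>)) \<in> borel_measurable sphere_measure"
    "(\<lambda>\<zeta>. g (r *\<^sub>R \<zeta>)) \<in> borel_measurable sphere_measure"
    using r f g by (auto intro!: borel_measurable_sphere_measure continuous_on_dilated_sphere)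
  have "(\<integral>\<^sup>+\<zeta>. ennreal ((cmod (f (r *\<^sub>R \<zeta>) - g (r *\<^sub>R \<zeta>)))\<^sup>2) \<partial>sphere_measure)
    \<le> (\<integral>\<^sup>+\<zeta>. 2 * ennreal ((cmod (f (r *\<^sub>R \<zeta>)))\<^sup>2) + 2 * ennreal ((cmod (g (r *\<^sub>R \<zeta>)))\<^sup>2) \<partial>sphere_measure)"
  proof (rule nn_integral_mono)
    fix \<zeta> :: "complex^'n"
    have "ennreal ((cmod (f (r *\<^sub>R \<zeta>) - g (r *\<^sub>R \<zeta>)))\<^sup>2)
      \<le> ennreal (2 * (cmod (f (r *\<^sub>R \<zeta>)))\<^sup>2 + 2 * (cmod (g (r *\<^sub>R \<zeta>)))\<^sup>2)"
      by (intro ennreal_leI cmod_diff_square_le)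
    also have "\<dots> = 2 * ennreal ((cmod (f (r *\<^sub>R \<zeta>)))\<^sup>2) + 2 * ennreal ((cmod (g (r *\<^sub>R \<zeta>)))\<^sup>2)"
      by (simp add: ennreal_plus ennreal_mult)
    finally show "ennreal ((cmod (f (r *\<^sub>R \<zeta>) - g (r *\<^sub>R \<zeta>)))\<^sup>2) \<le> \<dots>" .
  qed
  also have "\<dots> = 2 * (\<integral>\<^sup>+\<zeta>. ennreal ((cmod (f (r *\<^sub>R \<zeta>)))\<^sup>2) \<partial>sphere_measure)
      + 2 * (\<integral>\<^sup>+\<zeta>. ennreal ((cmod (g (r *\<^sub>R \<zeta>)))\<^sup>2) \<partial>sphere_measure)"
    by (simp add: nn_integral_add nn_integral_cmult)
  also have "\<dots> \<le> 2 * hardy_sqnorm f + 2 * hardy_sqnorm g"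
    unfolding hardy_sqnorm_def using r by (intro add_mono mult_left_mono SUP_upper) auto
  finally show "(\<integral>\<^sup>+\<zeta>. ennreal ((cmod (f (r *\<^sub>R \<zeta>) - g (r *\<^sub>R \<zeta>)))\<^sup>2) \<partial>sphere_measure) \<le> \<dots>" .
qed

lemma hardy_kernel_growth_space:
  "kernel_growth_space (hardy_space :: (complex^'n \<Rightarrow> complex) set) hardy_norm (real CARD('n))"
proof
  let ?N = "CARD('n)"
  obtain V where V: "emeasure lborel (ball (0 :: complex^'n) 1) = ennreal V" "V > 0"
    by (rule emeasure_unit_ball)
  show "real ?N > 0" by simp
  show "(\<lambda>z. f z - g z) \<in> hardy_space" if "f \<in> hardy_space" "g \<in> hardy_space" for f g :: "complex^'n \<Rightarrow> complex"
  proof -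
    have "hardy_sqnorm (\<lambda>z. f z - g z) \<le> 2 * hardy_sqnorm f + 2 * hardy_sqnorm g"
      using that by (intro hardy_sqnorm_diff_le) (auto simp: hardy_space_def)
    also have "\<dots> < \<infinity>" using that by (simp add: hardy_space_def ennreal_mult_less_top)
    finally show ?thesis using that by (simp add: hardy_space_def holomorphic_on_ball_diff)
  qed
  define c :: real where "c = (1 / (3 * ?N)) ^ (?N + 1) / 4"
  define D where "D = DIM(complex^'n)"
  define K where "K = 2 ^ (D + 1) * (2 * V)"
  have "cmod (f z) \<le> sqrt (K / c) * (1 - (norm z)\<^sup>2) powr (- real ?N / 2) * hardy_norm f"
    if f: "f \<in> hardy_space" and z: "norm z < 1" for f :: "complex^'n \<Rightarrow> complex" and z
  proof -
    have hol: "holomorphic_on_ball f" and fin: "hardy_sqnorm f < \<infinity>"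
      using f by (auto simp: hardy_space_def)
    define \<delta> where "\<delta> = 1 - (norm z)\<^sup>2"
    have \<delta>: "0 < \<delta>" using z by (simp add: \<delta>_def power_less_one_iff)
    define G where "G z = indicator (ball 0 1) z * ennreal ((cmod (f z))\<^sup>2)" for z
    have [measurable]: "G \<in> borel_measurable borel"
      unfolding G_def[abs_def] by (intro borel_measurable_sq_norm_ball holomorphic_on_ball_continuous hol)
    \<comment> \<open>The cutoff keeps the points that occur in the local mean. As r^2 \<le> r, it
      confines the radius to r \<ge> 1 - 2\<delta>, and the length 2\<delta> of this range is the
      gain from the exponent N + 1 to N.\<close>
    define g where "g y = indicator {x. x \<le> 2 * \<delta>} (1 - (norm y)\<^sup>2) * G y" for y
    have [measurable]: "g \<in> borel_measurable borel"
      unfolding g_def by measurable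
    have inner: "(\<integral>\<^sup>+y. indicator (ball 0 1) y * g (r *\<^sub>R sgn y) \<partial>lborel)
      \<le> indicator {1 - 2 * \<delta>..1} r * (ennreal V * hardy_sqnorm f)" if r: "0 < r" "r < 1" for r
    proof (cases "1 - 2 * \<delta> \<le> r")
      case True
      have "(\<integral>\<^sup>+y. indicator (ball 0 1) y * g (r *\<^sub>R sgn y) \<partial>lborel)
        \<le> (\<integral>\<^sup>+y. indicator (ball 0 1) y * ennreal ((cmod (f (r *\<^sub>R sgn y)))\<^sup>2) \<partial>lborel)"
        by (intro nn_integral_mono) (auto simp: g_def G_def indicator_def)
      also have "\<dots> = ennreal V * (\<integral>\<^sup>+\<zeta>. ennreal ((cmod (f (r *\<^sub>R \<zeta>)))\<^sup>2) \<partial>sphere_measure)"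
        using nn_integral_sphere_measure_holomorphic[OF hol r] V by simp
      also have "\<dots> \<le> ennreal V * hardy_sqnorm f"
        unfolding hardy_sqnorm_def using r by (intro mult_left_mono SUP_upper) auto
      finally show ?thesis using True r by simp
    next
      case False
      have "g (r *\<^sub>R sgn y) = 0" for y
      proof -
        have "norm (r *\<^sub>R sgn y) \<le> r" using r by (simp add: norm_sgn)
        then have "(norm (r *\<^sub>R sgn y))\<^sup>2 \<le> r\<^sup>2" by (intro power_mono) auto
        moreover have "r\<^sup>2 \<le> r" using r by (simp add: power2_eq_square mult_left_le)
        ultimately show ?thesis using False by (simp add: g_def)
      qed
      then show ?thesis by simp
    qed
    have "ennreal ((cmod (f z))\<^sup>2 * ((\<delta> / (3 * ?N)) ^ (?N + 1) / 4))
      \<le> (\<integral>\<^sup>+y. indicator {y \<in> ball 0 1. \<delta> / 2 \<le> 1 - (norm y)\<^sup>2 \<and> 1 - (norm y)\<^sup>2 \<le> 2 * \<delta>} y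
          * ennreal ((cmod (f y))\<^sup>2) \<partial>lborel)"
      by (rule local_square_mean_bound[OF hol z \<delta>_def])
    also have "\<dots> \<le> (\<integral>\<^sup>+y. indicator (ball 0 1) y * g y \<partial>lborel)"
      by (intro nn_integral_mono) (auto simp: g_def G_def indicator_def)
    also have "\<dots> \<le> ennreal (2 ^ (D + 1)) * (\<integral>\<^sup>+r. indicator {0<..<1} r *
        (\<integral>\<^sup>+y. indicator (ball 0 1) y * g (r *\<^sub>R sgn y) \<partial>lborel) \<partial>lborel)"
      unfolding D_def by (rule nn_integral_polar_le) measurable
    also have "\<dots> \<le> ennreal (2 ^ (D + 1)) * (\<integral>\<^sup>+r. indicator {1 - 2 * \<delta>..1} r * (ennreal V * hardy_sqnorm f) \<partial>lborel)"
    proof (intro mult_left_mono nn_integral_mono)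
      fix r :: real
      show "indicator {0<..<1} r * (\<integral>\<^sup>+y. indicator (ball 0 1) y * g (r *\<^sub>R sgn y) \<partial>lborel)
        \<le> indicator {1 - 2 * \<delta>..1} r * (ennreal V * hardy_sqnorm f)"
        using inner[of r] by (cases "0 < r \<and> r < 1") (auto simp: indicator_def)
    qed simp
    also have "\<dots> = ennreal (2 ^ (D + 1)) * (ennreal (2 * \<delta>) * (ennreal V * hardy_sqnorm f))"
      using \<delta> by (subst nn_integral_multc) auto
    also have "\<dots> = ennreal (K * \<delta> powr 1) * hardy_sqnorm f"
      using V \<delta> by (simp add: K_def ennreal_mult mult_ac)
    finally have "ennreal ((cmod (f z))\<^sup>2 * (c * \<delta> ^ (?N + 1))) \<le> ennreal (K * \<delta> powr 1) * hardy_sqnorm f"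
      by (simp add: c_def power_divide)
    then have "cmod (f z) \<le> sqrt (K / c) * \<delta> powr ((1 - real (?N + 1)) / 2) * sqrt (enn2real (hardy_sqnorm f))"
      using fin \<delta> V by (intro square_eval_bound) (auto simp: c_def K_def)
    then show ?thesis by (simp add: \<delta>_def hardy_norm_def)
  qed
  then show "\<exists>K. \<forall>f\<in>hardy_space. \<forall>z. norm z < 1 \<longrightarrow>
      cmod (f z) \<le> K * (1 - (norm z)\<^sup>2) powr (- real ?N / 2) * hardy_norm (f :: complex^'n \<Rightarrow> complex)"
    by blast
  obtain K0 where K0: "K0 > 0" and ker: "\<And>(w :: complex^'n) p. norm w < 1 \<Longrightarrow> p \<ge> ?N + 2 \<Longrightarrow>
       (\<integral>\<^sup>+z. indicator (ball 0 1) z * ennreal ((1 / cmod (1 - hinner (sgn z) w)) ^ p) \<partial>lborel)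
         \<le> ennreal (2 ^ p * K0 * (1 - norm w) ^ ?N / (1 - norm w) ^ p)"
    using nn_integral_kernel_sphere_le[where 'n='n] by blast
  have "(\<lambda>z. c / (1 - hinner z w) ^ m) \<in> hardy_space \<and>
      hardy_norm (\<lambda>z. c / (1 - hinner z w) ^ m) \<le> sqrt (2 ^ (2 * m) * K0 / V * 2 powr (2 * real m - real ?N)) *
        cmod c * (1 - (norm w)\<^sup>2) powr (real ?N / 2 - real m)"
    if m: "m \<ge> ?N + 2" and w: "norm w < 1" for m c and w :: "complex^'n"
  proof -
    let ?F = "\<lambda>z. c / (1 - hinner z w) ^ m"
    have hol: "holomorphic_on_ball ?F" using w by (rule holomorphic_on_ball_kernel)
    have "hardy_sqnorm ?F \<le> ennreal ((2 ^ (2 * m) * K0 / V) * (cmod c)\<^sup>2 * (1 - norm w) powr (real ?N - 2 * real m))"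
      unfolding hardy_sqnorm_def
    proof (rule SUP_least)
      fix r :: real assume "r \<in> {0<..<1}"
      then have r: "0 < r" "r < 1" by auto
      have rw: "norm (r *\<^sub>R w) \<le> norm w" using r by (simp add: mult_left_le_one_le)
      then have rw1: "norm (r *\<^sub>R w) < 1" using w by simp
      \<comment> \<open>The dilation is moved onto w. Since |r w| \<le> |w| and the exponent N - 2m
        is negative, the bound at w itself then covers every r.\<close>
      have sw: "hinner (r *\<^sub>R z) w = hinner z (r *\<^sub>R w)" for z
        by (simp add: scaleR_eq_scale hinner_simps)
      have sq: "(cmod (c / (1 - hinner (r *\<^sub>R z) w) ^ m))\<^sup>2 = (cmod c)\<^sup>2 * (1 / cmod (1 - hinner z (r *\<^sub>R w))) ^ (2 * m)" for z
        by (simp add: sw norm_divide norm_power power_divide power_mult[symmetric] mult.commute)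
      have "ennreal V * (\<integral>\<^sup>+\<zeta>. ennreal ((cmod (c / (1 - hinner (r *\<^sub>R \<zeta>) w) ^ m))\<^sup>2) \<partial>sphere_measure)
          = (\<integral>\<^sup>+z. indicator (ball 0 1) z * ennreal ((cmod (c / (1 - hinner (r *\<^sub>R sgn z) w) ^ m))\<^sup>2) \<partial>lborel)"
        using nn_integral_sphere_measure_holomorphic[OF hol r] V by simp
      also have "\<dots> = (\<integral>\<^sup>+z. ennreal ((cmod c)\<^sup>2) * (indicator (ball 0 1) z *
          ennreal ((1 / cmod (1 - hinner (sgn z) (r *\<^sub>R w))) ^ (2 * m))) \<partial>lborel)"
        unfolding sq by (intro nn_integral_cong) (simp add: ennreal_mult mult_ac)
      also have "\<dots> = ennreal ((cmod c)\<^sup>2) * (\<integral>\<^sup>+z. indicator (ball 0 1) z *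
          ennreal ((1 / cmod (1 - hinner (sgn z) (r *\<^sub>R w))) ^ (2 * m)) \<partial>lborel)"
      proof (rule nn_integral_cmult)
        have [measurable]: "(\<lambda>z. hinner z (r *\<^sub>R w)) \<in> borel_measurable borel"
          by (intro borel_measurable_continuous_onI continuous_intros)
        show "(\<lambda>z. indicator (ball 0 1) z * ennreal ((1 / cmod (1 - hinner (sgn z) (r *\<^sub>R w))) ^ (2 * m)))
          \<in> borel_measurable lborel" by measurable
      qed
      also have "\<dots> \<le> ennreal ((cmod c)\<^sup>2) * ennreal (2 ^ (2 * m) * K0 * (1 - norm (r *\<^sub>R w)) ^ ?N / (1 - norm (r *\<^sub>R w)) ^ (2 * m))"
        using m by (intro mult_left_mono ker rw1) auto
      also have "\<dots> = ennreal ((cmod c)\<^sup>2 * (2 ^ (2 * m) * K0 * (1 - norm (r *\<^sub>R w)) powr (real ?N - 2 * real m)))"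
      proof -
        have "1 - norm (r *\<^sub>R w) > 0" using rw1 by simp
        then have "2 ^ (2 * m) * K0 * (1 - norm (r *\<^sub>R w)) ^ ?N / (1 - norm (r *\<^sub>R w)) ^ (2 * m)
          = 2 ^ (2 * m) * K0 * (1 - norm (r *\<^sub>R w)) powr (real ?N - 2 * real m)"
          using powr_realpow[of "1 - norm (r *\<^sub>R w)" "2 * m"] by (simp add: powr_diff powr_realpow)
        then show ?thesis using K0 by (simp add: ennreal_mult)
      qed
      also have "\<dots> \<le> ennreal ((cmod c)\<^sup>2 * (2 ^ (2 * m) * K0 * (1 - norm w) powr (real ?N - 2 * real m)))"
        using rw w K0 m by (intro ennreal_leI mult_left_mono powr_mono2') auto
      also have "\<dots> = ennreal V * ennreal ((2 ^ (2 * m) * K0 / V) * (cmod c)\<^sup>2 * (1 - norm w) powr (real ?N - 2 * real m))"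
        using V K0 by (subst ennreal_mult[symmetric]) (auto simp: mult_ac)
      finally show "(\<integral>\<^sup>+\<zeta>. ennreal ((cmod (c / (1 - hinner (r *\<^sub>R \<zeta>) w) ^ m))\<^sup>2) \<partial>sphere_measure)
          \<le> ennreal ((2 ^ (2 * m) * K0 / V) * (cmod c)\<^sup>2 * (1 - norm w) powr (real ?N - 2 * real m))"
        using V(2) by (subst (asm) ennreal_mult_le_mult_iff) auto
    qed
    from square_kernel_bound[OF this _ w] show ?thesis
      using hol K0 V m by (simp add: hardy_space_def hardy_norm_def)
  qed
  then show "\<exists>m0. \<forall>m\<ge>m0. \<exists>K. \<forall>(w :: complex^'n) c. norm w < 1 \<longrightarrow>
      (\<lambda>z. c / (1 - hinner z w) ^ m) \<in> hardy_space \<and>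
      hardy_norm (\<lambda>z. c / (1 - hinner z w) ^ m) \<le> K * cmod c * (1 - (norm w)\<^sup>2) powr (real ?N / 2 - real m)"
    by blast
qed

section \<open>The weighted Bergman spaces\<close>

definition bergman_const :: "nat \<Rightarrow> real \<Rightarrow> real" where
  "bergman_const n s = Gamma (real n + s + 1) / (Gamma (real n + 1) * Gamma (s + 1))"

lemma bergman_const_pos: "s > -1 \<Longrightarrow> bergman_const n s > 0"
  unfolding bergman_const_def by (intro divide_pos_pos mult_pos_pos Gamma_real_pos) auto

lemma bergman_weight_eq:
  "bergman_weight s (z :: complex^'n) = bergman_const CARD('n) s * (1 - (norm z)\<^sup>2) powr s"
  by (simp add: bergman_weight_def bergman_const_def)

lemma borel_measurable_bergman_weight [measurable]: "bergman_weight s \<in> borel_measurable borel"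
  unfolding bergman_weight_eq[abs_def] by measurable

lemma bergman_sqnorm_eq:
  fixes f :: "complex^'n \<Rightarrow> complex"
  assumes f: "holomorphic_on_ball f" and s: "s > -1"
  shows "emeasure lborel (ball (0 :: complex^'n) 1) * bergman_sqnorm s f
    = (\<integral>\<^sup>+z. (indicator (ball 0 1) z * ennreal ((cmod (f z))\<^sup>2)) * ennreal (bergman_weight s z) \<partial>lborel)"
proof -
  have [measurable]: "(\<lambda>z. indicator (ball 0 1) z * ennreal ((cmod (f z))\<^sup>2)) \<in> borel_measurable borel"
    by (intro borel_measurable_sq_norm_ball holomorphic_on_ball_continuous f)
  have eq: "(\<lambda>z. indicator (ball 0 1) z * ennreal ((cmod (f z))\<^sup>2 * bergman_weight s z))
      = (\<lambda>z. (indicator (ball 0 1) z * ennreal ((cmod (f z))\<^sup>2)) * ennreal (bergman_weight s z))"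
    by (simp add: ennreal_mult' mult.assoc)
  have "bergman_sqnorm s f = (\<integral>\<^sup>+z. indicator (ball 0 1) z * ennreal ((cmod (f z))\<^sup>2 * bergman_weight s z) \<partial>lborel)
      / emeasure lborel (ball (0 :: complex^'n) 1)"
    unfolding bergman_sqnorm_def by (rule nn_integral_ball_measure) (unfold eq, measurable)
  moreover obtain V where "emeasure lborel (ball (0 :: complex^'n) 1) = ennreal V" "V > 0"
    by (rule emeasure_unit_ball)
  ultimately show ?thesis by (simp only: ennreal_mult_divide_cancel eq)
qed

lemma bergman_sqnorm_diff_le:
  fixes f g :: "complex^'n \<Rightarrow> complex"
  assumes f: "holomorphic_on_ball f" and g: "holomorphic_on_ball g" and s: "s > -1"
  shows "bergman_sqnorm s (\<lambda>z. f z - g z) \<le> 2 * bergman_sqnorm s f + 2 * bergman_sqnorm s g"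
proof -
  have sets: "sets ball_measure = sets (restrict_space borel (ball (0 :: complex^'n) 1))"
    unfolding ball_measure_def by (rule sets_restrict_space_cong) simp
  have [measurable]: "h \<in> borel_measurable ball_measure" if "holomorphic_on_ball h" for h :: "complex^'n \<Rightarrow> complex"
    using borel_measurable_continuous_on_restrict[OF holomorphic_on_ball_continuous[OF that]]
      measurable_cong_sets[OF sets refl] by blast
  note f[measurable] g[measurable]
  have [measurable]: "bergman_weight s \<in> borel_measurable (ball_measure :: (complex^'n) measure)"
    using measurable_restrict_space1[OF borel_measurable_bergman_weight] measurable_cong_sets[OF sets refl] by blast
  have "bergman_sqnorm s (\<lambda>z. f z - g z)
      \<le> (\<integral>\<^sup>+z. 2 * ennreal ((cmod (f z))\<^sup>2 * bergman_weight s z) + 2 * ennreal ((cmod (g z))\<^sup>2 * bergman_weight s z) \<partial>ball_measure)"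
    unfolding bergman_sqnorm_def
  proof (rule nn_integral_mono)
    fix z :: "complex^'n"
    have w: "bergman_weight s z \<ge> 0"
      using bergman_const_pos[OF s, of "CARD('n)"] by (simp add: bergman_weight_eq)
    have "ennreal ((cmod (f z - g z))\<^sup>2 * bergman_weight s z)
        \<le> ennreal ((2 * (cmod (f z))\<^sup>2 + 2 * (cmod (g z))\<^sup>2) * bergman_weight s z)"
      using w by (intro ennreal_leI mult_right_mono cmod_diff_square_le)
    also have "\<dots> = 2 * ennreal ((cmod (f z))\<^sup>2 * bergman_weight s z) + 2 * ennreal ((cmod (g z))\<^sup>2 * bergman_weight s z)"
      using w by (simp add: ennreal_plus ennreal_mult distrib_right mult.assoc)
    finally show "ennreal ((cmod (f z - g z))\<^sup>2 * bergman_weight s z) \<le> \<dots>" .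
  qed
  also have "\<dots> = 2 * bergman_sqnorm s f + 2 * bergman_sqnorm s g"
    unfolding bergman_sqnorm_def by (simp add: nn_integral_add nn_integral_cmult)
  finally show ?thesis .
qed

lemma bergman_kernel_growth_space:
  assumes s: "s > -1"
  shows "kernel_growth_space (bergman_space s :: (complex^'n \<Rightarrow> complex) set) (bergman_norm s)
    (real CARD('n) + 1 + s)"
proof
  let ?N = "CARD('n)"
  let ?\<gamma> = "real ?N + 1 + s"
  obtain V where V: "emeasure lborel (ball (0 :: complex^'n) 1) = ennreal V" "V > 0"
    by (rule emeasure_unit_ball)
  show "?\<gamma> > 0" using s by simp
  define b where "b = bergman_const ?N s"
  have b: "b > 0" unfolding b_def using s by (rule bergman_const_pos)
  show "(\<lambda>z. f z - g z) \<in> bergman_space s" if "f \<in> bergman_space s" "g \<in> bergman_space s"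
    for f g :: "complex^'n \<Rightarrow> complex"
  proof -
    have "bergman_sqnorm s (\<lambda>z. f z - g z) \<le> 2 * bergman_sqnorm s f + 2 * bergman_sqnorm s g"
      using that s by (intro bergman_sqnorm_diff_le) (auto simp: bergman_space_def)
    also have "\<dots> < \<infinity>" using that by (simp add: bergman_space_def ennreal_mult_less_top)
    finally show ?thesis using that by (simp add: bergman_space_def holomorphic_on_ball_diff)
  qed
  define c :: real where "c = (1 / (3 * ?N)) ^ (?N + 1) / 4"
  define K where "K = 2 powr \<bar>s\<bar> * V / b"
  have "cmod (f z) \<le> sqrt (K / c) * (1 - (norm z)\<^sup>2) powr (- ?\<gamma> / 2) * bergman_norm s f"
    if f: "f \<in> bergman_space s" and z: "norm z < 1" for f :: "complex^'n \<Rightarrow> complex" and z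
  proof -
    have hol: "holomorphic_on_ball f" and fin: "bergman_sqnorm s f < \<infinity>"
      using f by (auto simp: bergman_space_def)
    define \<delta> where "\<delta> = 1 - (norm z)\<^sup>2"
    have \<delta>: "0 < \<delta>" using z by (simp add: \<delta>_def power_less_one_iff)
    define G where "G z = indicator (ball 0 1) z * ennreal ((cmod (f z))\<^sup>2)" for z
    have [measurable]: "G \<in> borel_measurable borel"
      unfolding G_def[abs_def] by (intro borel_measurable_sq_norm_ball holomorphic_on_ball_continuous hol)
    let ?A = "{y :: complex^'n. y \<in> ball 0 1 \<and> \<delta> / 2 \<le> 1 - (norm y)\<^sup>2 \<and> 1 - (norm y)\<^sup>2 \<le> 2 * \<delta>}"
    \<comment> \<open>On \<open>?A\<close> the quantity 1 - |y|^2 lies within a factor 2 of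
      \<delta>, so for either sign of s the weight is at least b \<delta>^s / 2^|s|.\<close>
    define L where "L = 2 powr \<bar>s\<bar> * \<delta> powr (-s) / b"
    have L0: "L \<ge> 0" using b by (simp add: L_def)
    have wt: "1 \<le> L * bergman_weight s y" if "y \<in> ?A" for y
    proof -
      define x where "x = 1 - (norm y)\<^sup>2"
      have x: "\<delta> / 2 \<le> x" "x \<le> 2 * \<delta>" "x > 0" using that \<delta> by (auto simp: x_def)
      have "1 \<le> 2 powr \<bar>s\<bar> * (x / \<delta>) powr s"
      proof (cases "s \<ge> 0")
        case True
        have "(1/2) powr s \<le> (x / \<delta>) powr s"
          using x \<delta> True by (intro powr_mono2) (auto simp: field_simps)
        then have "2 powr s * (1/2) powr s \<le> 2 powr s * (x / \<delta>) powr s"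
          by (intro mult_left_mono) auto
        moreover have "2 powr s * (1/2) powr s = 1"
          by (simp add: powr_mult[symmetric])
        ultimately show ?thesis using True by simp
      next
        case False
        have "2 powr s \<le> (x / \<delta>) powr s"
          using x \<delta> False by (intro powr_mono2') (auto simp: field_simps)
        then have "2 powr (-s) * 2 powr s \<le> 2 powr (-s) * (x / \<delta>) powr s"
          by (intro mult_left_mono) auto
        moreover have "2 powr (-s) * 2 powr s = 1"
          by (simp add: powr_add[symmetric])
        ultimately show ?thesis using False by simp
      qed
      also have "\<dots> = L * bergman_weight s y"
        using b x \<delta> by (simp add: L_def bergman_weight_eq b_def[symmetric] x_def[symmetric] powr_divide powr_minus field_simps)
      finally show ?thesis .
    qed
    have "ennreal ((cmod (f z))\<^sup>2 * ((\<delta> / (3 * ?N)) ^ (?N + 1) / 4))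
      \<le> (\<integral>\<^sup>+y. indicator ?A y * ennreal ((cmod (f y))\<^sup>2) \<partial>lborel)"
      by (rule local_square_mean_bound[OF hol z \<delta>_def])
    also have "\<dots> \<le> (\<integral>\<^sup>+y. ennreal L * (G y * ennreal (bergman_weight s y)) \<partial>lborel)"
    proof (rule nn_integral_mono)
      fix y :: "complex^'n"
      show "indicator ?A y * ennreal ((cmod (f y))\<^sup>2) \<le> ennreal L * (G y * ennreal (bergman_weight s y))"
      proof (cases "y \<in> ?A")
        case True
        have "ennreal 1 \<le> ennreal (L * bergman_weight s y)" using wt[OF True] by (rule ennreal_leI)
        then have "1 \<le> ennreal L * ennreal (bergman_weight s y)" using L0 by (simp add: ennreal_mult')
        then have "G y * 1 \<le> G y * (ennreal L * ennreal (bergman_weight s y))" by (intro mult_left_mono) auto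
        then show ?thesis using True by (simp add: G_def mult_ac)
      qed simp
    qed
    also have "\<dots> = ennreal L * (\<integral>\<^sup>+y. G y * ennreal (bergman_weight s y) \<partial>lborel)"
      by (rule nn_integral_cmult) measurable
    also have "\<dots> = ennreal L * (ennreal V * bergman_sqnorm s f)"
      using bergman_sqnorm_eq[OF hol s] V by (simp add: G_def)
    also have "\<dots> = ennreal (K * \<delta> powr (-s)) * bergman_sqnorm s f"
    proof -
      have "K * \<delta> powr (-s) = L * V" by (simp add: K_def L_def)
      then show ?thesis using L0 V by (simp add: ennreal_mult mult.assoc)
    qed
    finally have "ennreal ((cmod (f z))\<^sup>2 * (c * \<delta> ^ (?N + 1))) \<le> ennreal (K * \<delta> powr (-s)) * bergman_sqnorm s f"
      by (simp add: c_def power_divide)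
    then have "cmod (f z) \<le> sqrt (K / c) * \<delta> powr ((-s - real (?N + 1)) / 2) * sqrt (enn2real (bergman_sqnorm s f))"
      using fin \<delta> V b by (intro square_eval_bound) (auto simp: c_def K_def)
    moreover have "- s - real (?N + 1) = - ?\<gamma>" by simp
    ultimately show ?thesis by (simp only: \<delta>_def bergman_norm_def)
  qed
  then show "\<exists>K. \<forall>f\<in>bergman_space s. \<forall>z. norm z < 1 \<longrightarrow>
      cmod (f z) \<le> K * (1 - (norm z)\<^sup>2) powr (- ?\<gamma> / 2) * bergman_norm s (f :: complex^'n \<Rightarrow> complex)"
    by blast
  obtain K0 where K0: "K0 > 0" and ker: "\<And>(w :: complex^'n) p. norm w < 1 \<Longrightarrow> p \<ge> ?N + 2 \<Longrightarrow>
       (\<integral>\<^sup>+z. indicator (ball 0 1) z * ennreal ((1 / cmod (1 - hinner (sgn z) w)) ^ p) \<partial>lborel)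
         \<le> ennreal (2 ^ p * K0 * (1 - norm w) ^ ?N / (1 - norm w) ^ p)"
    using nn_integral_kernel_sphere_le[where 'n='n] by blast
  define D where "D = DIM(complex^'n)"
  have "\<exists>K. \<forall>(w :: complex^'n) c. norm w < 1 \<longrightarrow>
      (\<lambda>z. c / (1 - hinner z w) ^ m) \<in> bergman_space s \<and>
      bergman_norm s (\<lambda>z. c / (1 - hinner z w) ^ m) \<le> K * cmod c * (1 - (norm w)\<^sup>2) powr (?\<gamma> / 2 - real m)"
    if m: "m \<ge> ?N + 2 + nat \<lceil>s + 1\<rceil>" for m
  proof -
    have mN: "m \<ge> ?N + 2" using m by simp
    have ms: "real m > real ?N + 1 + s" using m s by linarith
    \<comment> \<open>The spherical square mean of the kernel power at radius r is of order (1 - |r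
      w|)^(-q). The lower bound on m makes q exceed s + 1, as the radial integral requires.\<close>
    define q where "q = 2 * real m - real ?N"
    have q: "q > s + 1" using ms s by (simp add: q_def)
    define P where "P = 1 / (s + 1) + 1 / (q - s - 1)"
    have P: "P \<ge> 0" using s q by (simp add: P_def)
    define K1 where "K1 = 2 ^ (D + 1) * (b * 2 powr \<bar>s\<bar> * 2 ^ (2 * m) * K0 * P) / V"
    have K1: "K1 \<ge> 0" using b K0 P V by (simp add: K1_def)
    have "(\<lambda>z. c / (1 - hinner z w) ^ m) \<in> bergman_space s \<and>
      bergman_norm s (\<lambda>z. c / (1 - hinner z w) ^ m)
        \<le> sqrt (K1 * 2 powr (2 * real m - ?\<gamma>)) * cmod c * (1 - (norm w)\<^sup>2) powr (?\<gamma> / 2 - real m)"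
      if w: "norm w < 1" for w :: "complex^'n" and c
    proof -
      let ?F = "\<lambda>z. c / (1 - hinner z w) ^ m"
      have hol: "holomorphic_on_ball ?F" using w by (rule holomorphic_on_ball_kernel)
      define \<delta> where "\<delta> = 1 - norm w"
      have \<delta>: "\<delta> > 0" using w by (simp add: \<delta>_def)
      have hm [measurable]: "(\<lambda>z. hinner z v) \<in> borel_measurable borel" for v :: "complex^'n"
        by (intro borel_measurable_continuous_onI continuous_intros)
      define C where "C = (cmod c)\<^sup>2 * (b * 2 powr \<bar>s\<bar> * 2 ^ (2 * m) * K0)"
      have C: "C \<ge> 0" using b K0 by (simp add: C_def)
      define g where "g y = ennreal ((cmod c)\<^sup>2 * (1 / cmod (1 - hinner y w)) ^ (2 * m)) * ennreal (bergman_weight s y)" for y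
      have [measurable]: "g \<in> borel_measurable borel" unfolding g_def by measurable
      have inner: "(\<integral>\<^sup>+y. indicator (ball 0 1) y * g (r *\<^sub>R sgn y) \<partial>lborel)
        \<le> ennreal (C * ((1 - r) powr s * min (\<delta> powr -q) ((1 - r) powr -q)))" if r: "0 < r" "r < 1" for r
      proof -
        have rw: "norm (r *\<^sub>R w) \<le> norm w" "norm (r *\<^sub>R w) \<le> r"
          using r w by (auto simp: mult_left_le_one_le mult_left_le)
        then have rw1: "norm (r *\<^sub>R w) < 1" using w by simp
        have sw: "hinner (r *\<^sub>R z) w = hinner z (r *\<^sub>R w)" for z
          by (simp add: scaleR_eq_scale hinner_simps)
        have "(\<integral>\<^sup>+y. indicator (ball 0 1) y * g (r *\<^sub>R sgn y) \<partial>lborel)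
          = (\<integral>\<^sup>+y. ennreal ((cmod c)\<^sup>2 * (b * (1 - r\<^sup>2) powr s)) * (indicator (ball 0 1) y *
              ennreal ((1 / cmod (1 - hinner (sgn y) (r *\<^sub>R w))) ^ (2 * m))) \<partial>lborel)"
        proof (rule nn_integral_cong_AE)
          show "AE y in lborel. indicator (ball 0 1) y * g (r *\<^sub>R sgn y)
            = ennreal ((cmod c)\<^sup>2 * (b * (1 - r\<^sup>2) powr s)) * (indicator (ball 0 1) y *
              ennreal ((1 / cmod (1 - hinner (sgn y) (r *\<^sub>R w))) ^ (2 * m)))"
            using AE_lborel_singleton[of "0 :: complex^'n"]
          proof eventually_elim
            case (elim y)
            then have "norm (r *\<^sub>R sgn y) = r" using r by (simp add: norm_sgn)
            then have "bergman_weight s (r *\<^sub>R sgn y) = b * (1 - r\<^sup>2) powr s"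
              by (simp only: bergman_weight_eq b_def)
            moreover have "ennreal (u * v) * ennreal x = ennreal (u * x) * ennreal v"
              if "u \<ge> 0" "v \<ge> 0" "x \<ge> 0" for u v x
              using that by (simp add: ennreal_mult ac_simps)
            ultimately show ?case
              using b by (cases "norm y < 1") (simp_all add: g_def sw)
          qed
        qed
        also have "\<dots> = ennreal ((cmod c)\<^sup>2 * (b * (1 - r\<^sup>2) powr s)) * (\<integral>\<^sup>+y. indicator (ball 0 1) y *
              ennreal ((1 / cmod (1 - hinner (sgn y) (r *\<^sub>R w))) ^ (2 * m)) \<partial>lborel)"
          by (rule nn_integral_cmult) measurable
        also have "\<dots> \<le> ennreal ((cmod c)\<^sup>2 * (b * (1 - r\<^sup>2) powr s)) *
            ennreal (2 ^ (2 * m) * K0 * (1 - norm (r *\<^sub>R w)) ^ ?N / (1 - norm (r *\<^sub>R w)) ^ (2 * m))"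
          using mN by (intro mult_left_mono ker rw1) auto
        also have "\<dots> = ennreal ((cmod c)\<^sup>2 * (b * (1 - r\<^sup>2) powr s) *
            (2 ^ (2 * m) * K0 * (1 - norm (r *\<^sub>R w)) powr -q))"
        proof -
          have "1 - norm (r *\<^sub>R w) > 0" using rw1 by simp
          then have "2 ^ (2 * m) * K0 * (1 - norm (r *\<^sub>R w)) ^ ?N / (1 - norm (r *\<^sub>R w)) ^ (2 * m)
            = 2 ^ (2 * m) * K0 * (1 - norm (r *\<^sub>R w)) powr -q"
            using powr_realpow[of "1 - norm (r *\<^sub>R w)" "2 * m"] by (simp add: q_def powr_diff powr_realpow)
          then show ?thesis using K0 b by (simp add: ennreal_mult)
        qed
        also have "\<dots> \<le> ennreal ((cmod c)\<^sup>2 * (b * (2 powr \<bar>s\<bar> * (1 - r) powr s)) *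
            (2 ^ (2 * m) * K0 * min (\<delta> powr -q) ((1 - r) powr -q)))"
        proof (intro ennreal_leI mult_mono order_refl)
          have "(1 - r\<^sup>2) powr s = (1 - r) powr s * (1 + r) powr s"
            using r by (subst powr_mult[symmetric]) (auto simp: power2_eq_square algebra_simps)
          also have "\<dots> \<le> (1 - r) powr s * 2 powr \<bar>s\<bar>"
          proof (rule mult_left_mono)
            have "(1 + r) powr s \<le> (1 + r) powr \<bar>s\<bar>" using r by (intro powr_mono) auto
            also have "\<dots> \<le> 2 powr \<bar>s\<bar>" using r by (intro powr_mono2) auto
            finally show "(1 + r) powr s \<le> 2 powr \<bar>s\<bar>" .
          qed simp
          finally show "(1 - r\<^sup>2) powr s \<le> 2 powr \<bar>s\<bar> * (1 - r) powr s" by (simp add: mult.commute)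
          \<comment> \<open>|r w| is at most |w| and at most r. The first bound serves 1 - r \<le>
            \<delta>; for larger 1 - r the second one decays, and it saves the factor \<delta>^(s +
            1) in the radial integral.\<close>
          have "(1 - norm (r *\<^sub>R w)) powr -q \<le> \<delta> powr -q" "(1 - norm (r *\<^sub>R w)) powr -q \<le> (1 - r) powr -q"
            using rw \<delta> r q s by (auto intro!: powr_mono2' simp: \<delta>_def)
          then show "(1 - norm (r *\<^sub>R w)) powr -q \<le> min (\<delta> powr -q) ((1 - r) powr -q)" by simp
        qed (use b K0 in auto)
        also have "\<dots> = ennreal (C * ((1 - r) powr s * min (\<delta> powr -q) ((1 - r) powr -q)))"
          by (simp add: C_def mult_ac)
        finally show ?thesis .
      qed
      have "ennreal V * bergman_sqnorm s ?F = (\<integral>\<^sup>+y. indicator (ball 0 1) y * g y \<partial>lborel)"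
      proof -
        have "(cmod (?F z))\<^sup>2 = (cmod c)\<^sup>2 * (1 / cmod (1 - hinner z w)) ^ (2 * m)" for z
          by (simp add: norm_divide norm_power power_divide power_mult[symmetric] mult.commute)
        then show ?thesis
          using bergman_sqnorm_eq[OF hol s] V by (simp add: g_def mult.assoc)
      qed
      also have "\<dots> \<le> ennreal (2 ^ (D + 1)) * (\<integral>\<^sup>+r. indicator {0<..<1} r *
          (\<integral>\<^sup>+y. indicator (ball 0 1) y * g (r *\<^sub>R sgn y) \<partial>lborel) \<partial>lborel)"
        unfolding D_def by (rule nn_integral_polar_le) measurable
      also have "\<dots> \<le> ennreal (2 ^ (D + 1)) * (\<integral>\<^sup>+r. ennreal C * (indicator {0<..} (1 + (-1) * r) *
          ennreal ((1 + (-1) * r) powr s * min (\<delta> powr -q) ((1 + (-1) * r) powr -q))) \<partial>lborel)"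
      proof (intro mult_left_mono nn_integral_mono)
        fix r :: real
        show "indicator {0<..<1} r * (\<integral>\<^sup>+y. indicator (ball 0 1) y * g (r *\<^sub>R sgn y) \<partial>lborel)
          \<le> ennreal C * (indicator {0<..} (1 + (-1) * r) *
              ennreal ((1 + (-1) * r) powr s * min (\<delta> powr -q) ((1 + (-1) * r) powr -q)))"
          using inner[of r] C by (cases "0 < r \<and> r < 1") (auto simp: ennreal_mult' indicator_def)
      qed simp
      also have "\<dots> = ennreal (2 ^ (D + 1)) * (ennreal C * (\<integral>\<^sup>+r. indicator {0<..} (1 + (-1) * r) *
          ennreal ((1 + (-1) * r) powr s * min (\<delta> powr -q) ((1 + (-1) * r) powr -q)) \<partial>lborel))"
        by (subst nn_integral_cmult) auto
      also have "(\<integral>\<^sup>+r. indicator {0<..} (1 + (-1) * r) *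
          ennreal ((1 + (-1) * r) powr s * min (\<delta> powr -q) ((1 + (-1) * r) powr -q)) \<partial>lborel)
          = (\<integral>\<^sup>+x. indicator {0<..} x * ennreal (x powr s * min (\<delta> powr -q) (x powr -q)) \<partial>lborel)"
        by (subst nn_integral_real_affine[where c = "-1" and t = 1]) auto
      also have "ennreal (2 ^ (D + 1)) * (ennreal C * \<dots>)
          \<le> ennreal (2 ^ (D + 1)) * (ennreal C * ennreal (P * \<delta> powr (s + 1 - q)))"
        unfolding P_def by (intro mult_left_mono nn_integral_powr_cutoff_le s q \<delta>) auto
      also have "\<dots> = ennreal (2 ^ (D + 1) * (C * (P * \<delta> powr (s + 1 - q))))"
        using C P by (simp add: ennreal_mult)
      also have "\<dots> = ennreal V * ennreal (K1 * (cmod c)\<^sup>2 * (1 - norm w) powr (?\<gamma> - 2 * real m))"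
      proof -
        have e: "s + 1 - q = ?\<gamma> - 2 * real m" by (simp add: q_def)
        have "2 ^ (D + 1) * (C * (P * \<delta> powr (s + 1 - q)))
            = V * (K1 * (cmod c)\<^sup>2 * (1 - norm w) powr (?\<gamma> - 2 * real m))"
          unfolding e using V by (simp add: K1_def C_def \<delta>_def)
        then show ?thesis using V K1 by (simp add: ennreal_mult)
      qed
      finally have "bergman_sqnorm s ?F \<le> ennreal (K1 * (cmod c)\<^sup>2 * (1 - norm w) powr (?\<gamma> - 2 * real m))"
        using V(2) by (subst (asm) ennreal_mult_le_mult_iff) auto
      from square_kernel_bound[OF this K1 w] show ?thesis
        using hol ms s by (simp add: bergman_space_def bergman_norm_def)
    qed
    then show ?thesis by blast
  qed
  then show "\<exists>m0. \<forall>m\<ge>m0. \<exists>K. \<forall>(w :: complex^'n) c. norm w < 1 \<longrightarrow>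
      (\<lambda>z. c / (1 - hinner z w) ^ m) \<in> bergman_space s \<and>
      bergman_norm s (\<lambda>z. c / (1 - hinner z w) ^ m) \<le> K * cmod c * (1 - (norm w)\<^sup>2) powr (?\<gamma> / 2 - real m)"
    by blast
qed

section \<open>Compact differences and linear fractional maps\<close>

context kernel_growth_space
begin

text \<open>The normalized kernel powers are bounded in norm and tend to 0 at each point, so a norm
  limit of their images vanishes on the ball. At z k the growth bound and the normalization together
  cost at most (\<kappa> t)^(-m), which is exactly the scale of the two kernel values.\<close>

lemma compact_difference_limits_eq:
  fixes z w :: "nat \<Rightarrow> complex^'n" and t :: "nat \<Rightarrow> real"
  assumes cpt: "compact_operator_on H nrm (\<lambda>f z. comp_op \<psi>1 f z - comp_op \<psi>2 f z)"
    and self1: "\<And>x. norm x < 1 \<Longrightarrow> norm (\<psi>1 x) < 1" and self2: "\<And>x. norm x < 1 \<Longrightarrow> norm (\<psi>2 x) < 1"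
    and z: "\<And>k. norm (z k) < 1" and w: "\<And>k. norm (w k) < 1"
    and t: "\<And>k. t k > 0" and \<kappa>: "\<kappa> > 0"
    and zt: "\<And>k. \<kappa> * t k \<le> 1 - (norm (z k))\<^sup>2" and wt: "\<And>k. \<kappa> * t k \<le> 1 - (norm (w k))\<^sup>2"
    and w1: "(\<lambda>k. 1 - (norm (w k))\<^sup>2) \<longlonglongrightarrow> 0"
    and lim1: "(\<lambda>k. of_real (t k) / (1 - hinner (\<psi>1 (z k)) (w k))) \<longlonglongrightarrow> a"
    and lim2: "(\<lambda>k. of_real (t k) / (1 - hinner (\<psi>2 (z k)) (w k))) \<longlonglongrightarrow> b"
    and a: "a \<noteq> 0"
  shows "a = b"
proof -
  let ?T = "\<lambda>f z. comp_op \<psi>1 f z - comp_op \<psi>2 f z"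
  obtain K where K: "\<And>f x. f \<in> H \<Longrightarrow> norm x < 1 \<Longrightarrow> cmod (f x) \<le> K * (1 - (norm x)\<^sup>2) powr (-\<gamma>/2) * nrm f"
    using eval_bound by blast
  obtain m0 where m0: "\<And>m. m \<ge> m0 \<Longrightarrow> \<exists>K. \<forall>w c. norm w < 1 \<longrightarrow>
      (\<lambda>z. c / (1 - hinner z w) ^ m) \<in> H \<and>
      nrm (\<lambda>z. c / (1 - hinner z w) ^ m) \<le> K * cmod c * (1 - (norm w)\<^sup>2) powr (\<gamma>/2 - real m)"
    using kernel_bound by blast
  define \<Delta> where "\<Delta> x = 1 - (norm x)\<^sup>2" for x :: "complex^'n"
  have \<Delta>: "\<Delta> x > 0" if "norm x < 1" for x
    using that by (simp add: \<Delta>_def power_less_one_iff)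
  have pow: "a ^ m = b ^ m" if m: "m \<ge> m0" "real m > \<gamma>/2" for m
  proof -
    obtain K' where K': "\<And>w c. norm w < 1 \<Longrightarrow> (\<lambda>z. c / (1 - hinner z w) ^ m) \<in> H"
      "\<And>w c. norm w < 1 \<Longrightarrow>
        nrm (\<lambda>z. c / (1 - hinner z w) ^ m) \<le> K' * cmod c * \<Delta> w powr (\<gamma>/2 - real m)"
      using m0[OF m(1)] unfolding \<Delta>_def by blast
    define c where "c k = \<Delta> (w k) powr (real m - \<gamma>/2)" for k
    define F where "F k x = complex_of_real (c k) / (1 - hinner x (w k)) ^ m" for k and x :: "complex^'n"
    have FH: "F k \<in> H" for k unfolding F_def using K'(1)[OF w] .
    have "nrm (F k) \<le> K'" for k
    proof -
      have "nrm (F k) \<le> K' * cmod (of_real (c k)) * \<Delta> (w k) powr (\<gamma>/2 - real m)"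
        unfolding F_def using K'(2)[OF w] .
      also have "\<dots> = K' * (\<Delta> (w k) powr (real m - \<gamma>/2) * \<Delta> (w k) powr (\<gamma>/2 - real m))"
        by (simp add: c_def)
      also have "\<dots> = K'"
        using \<Delta>[OF w, of k] by (simp add: powr_add[symmetric])
      finally show ?thesis .
    qed
    then have "\<exists>g\<in>H. \<exists>r :: nat \<Rightarrow> nat. strict_mono r \<and> (\<lambda>k. nrm (\<lambda>x. ?T (F (r k)) x - g x)) \<longlonglongrightarrow> 0"
      using cpt FH unfolding compact_operator_on_def by blast
    then obtain g r where g: "g \<in> H" and r: "strict_mono r"
      and lim: "(\<lambda>k. nrm (\<lambda>x. ?T (F (r k)) x - g x)) \<longlonglongrightarrow> 0"
      by blast
    define e where "e k = nrm (\<lambda>x. ?T (F (r k)) x - g x)" for k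
    have e: "e \<longlonglongrightarrow> 0" using lim by (simp add: e_def[abs_def])
    have TH: "?T f \<in> H" if "f \<in> H" for f
      using cpt that unfolding compact_operator_on_def by blast
    have bound: "cmod (?T (F (r k)) x - g x) \<le> K * \<Delta> x powr (-\<gamma>/2) * e k" if "norm x < 1" for k x
      unfolding e_def \<Delta>_def using K[OF diff_mem[OF TH[OF FH] g] that] .
    \<comment> \<open>The normalizing factor vanishes in the limit because m > \<gamma>/2. At a
      fixed x in the ball the denominators of F stay away from 0, so F tends to 0 there.\<close>
    have c0: "c \<longlonglongrightarrow> 0"
    proof -
      have "(\<lambda>k. \<Delta> (w k) powr (real m - \<gamma>/2)) \<longlonglongrightarrow> 0 powr (real m - \<gamma>/2)"
        using w1 m(2) less_imp_le[OF \<Delta>[OF w]]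
        by (intro tendsto_powr') (auto simp: \<Delta>_def[symmetric] always_eventually)
      then show ?thesis by (simp add: c_def[abs_def])
    qed
    have F0: "(\<lambda>k. F k x) \<longlonglongrightarrow> 0" if x: "norm x < 1" for x
    proof (rule Lim_null_comparison)
      show "\<forall>\<^sub>F k in sequentially. norm (F k x) \<le> c k / (1 - norm x) ^ m"
      proof (rule always_eventually, rule allI)
        fix k
        have "1 - norm x \<le> cmod (1 - hinner (w k) x)"
          using norm_diff_hinner_le[of "w k" x] w[of k] by simp
        also have "\<dots> = cmod (1 - hinner x (w k))"
          by (metis cnj_hinner complex_cnj_diff complex_cnj_one complex_mod_cnj)
        finally have "(1 - norm x) ^ m \<le> cmod (1 - hinner x (w k)) ^ m"
          using x by (intro power_mono) auto
        then have "c k / cmod (1 - hinner x (w k)) ^ m \<le> c k / (1 - norm x) ^ m"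
          using x by (intro divide_left_mono mult_pos_pos zero_less_power)
            (use one_minus_hinner_nonzero[of x "w k"] w[of k] in \<open>auto simp: c_def\<close>)
        then show "norm (F k x) \<le> c k / (1 - norm x) ^ m"
          by (simp add: F_def norm_divide norm_power c_def)
      qed
      show "(\<lambda>k. c k / (1 - norm x) ^ m) \<longlonglongrightarrow> 0"
        using tendsto_divide[OF c0 tendsto_const, of "(1 - norm x) ^ m"] x by simp
    qed
    \<comment> \<open>By the growth bound, norm convergence implies convergence at x. So g x is the
      limit of the images at x, and these tend to 0.\<close>
    have g0: "g x = 0" if x: "norm x < 1" for x
    proof -
      have "(\<lambda>k. ?T (F (r k)) x - g x) \<longlonglongrightarrow> 0"
      proof (rule Lim_null_comparison)
        show "\<forall>\<^sub>F k in sequentially. norm (?T (F (r k)) x - g x) \<le> K * \<Delta> x powr (-\<gamma>/2) * e k"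
          using bound[OF x] by (intro always_eventually) blast
        show "(\<lambda>k. K * \<Delta> x powr (-\<gamma>/2) * e k) \<longlonglongrightarrow> 0"
          using tendsto_mult[OF tendsto_const e] by force
      qed
      moreover have "(\<lambda>k. ?T (F (r k)) x - g x) \<longlonglongrightarrow> (0 - 0) - g x"
        using LIMSEQ_subseq_LIMSEQ[OF F0[OF self1[OF x]] r] LIMSEQ_subseq_LIMSEQ[OF F0[OF self2[OF x]] r]
        unfolding comp_op_def o_def by (intro tendsto_diff tendsto_const) auto
      ultimately show ?thesis using LIMSEQ_unique by force
    qed
    define X Y where "X k = of_real (t k) / (1 - hinner (\<psi>1 (z k)) (w k))"
      and "Y k = of_real (t k) / (1 - hinner (\<psi>2 (z k)) (w k))" for k
    have key: "\<kappa> ^ m * cmod (X (r k) ^ m - Y (r k) ^ m) \<le> K * e k" for k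
    proof -
      let ?j = "r k"
      define Q where "Q = 1 / (1 - hinner (\<psi>1 (z ?j)) (w ?j)) ^ m - 1 / (1 - hinner (\<psi>2 (z ?j)) (w ?j)) ^ m"
      have zj: "\<Delta> (z ?j) > 0" "\<kappa> * t ?j > 0" using \<Delta>[OF z] \<kappa> t by auto
      have "cmod (?T (F ?j) (z ?j) - g (z ?j)) = c ?j * cmod Q"
      proof -
        have "?T (F ?j) (z ?j) - g (z ?j) = of_real (c ?j) * Q"
          by (simp add: g0[OF z] comp_op_def F_def Q_def right_diff_distrib)
        then show ?thesis by (simp add: norm_mult c_def)
      qed
      then have "c ?j * cmod Q \<le> K * \<Delta> (z ?j) powr (-\<gamma>/2) * e k"
        using bound[OF z[of ?j], of k] by simp
      then have "\<Delta> (z ?j) powr (\<gamma>/2) * (c ?j * cmod Q)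
          \<le> \<Delta> (z ?j) powr (\<gamma>/2) * (K * \<Delta> (z ?j) powr (-\<gamma>/2) * e k)"
        by (intro mult_left_mono) auto
      also have "\<dots> = (\<Delta> (z ?j) powr (\<gamma>/2) * \<Delta> (z ?j) powr (-\<gamma>/2)) * (K * e k)" by simp
      also have "\<dots> = K * e k" using zj by (simp add: powr_add[symmetric])
      finally have 1: "\<Delta> (z ?j) powr (\<gamma>/2) * c ?j * cmod Q \<le> K * e k" by (simp add: mult.assoc)
      \<comment> \<open>The exponents \<gamma>/2 of the evaluation at z and m - \<gamma>/2 of the
        normalization at w add up to the integer m, whatever \<gamma> is.\<close>
      have "(\<kappa> * t ?j) ^ m = (\<kappa> * t ?j) powr (\<gamma>/2) * (\<kappa> * t ?j) powr (real m - \<gamma>/2)"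
        using zj by (simp add: powr_add[symmetric] powr_realpow)
      also have "\<dots> \<le> \<Delta> (z ?j) powr (\<gamma>/2) * c ?j"
        unfolding c_def using zt[of ?j] wt[of ?j] zj growth_pos m(2)
        by (intro mult_mono powr_mono2) (auto simp: \<Delta>_def)
      finally have "(\<kappa> * t ?j) ^ m * cmod Q \<le> K * e k"
        using 1 mult_right_mono[of "(\<kappa> * t ?j) ^ m" "\<Delta> (z ?j) powr (\<gamma>/2) * c ?j" "cmod Q"] by auto
      moreover have "X ?j ^ m - Y ?j ^ m = of_real (t ?j) ^ m * Q"
        by (simp add: X_def Y_def Q_def power_divide right_diff_distrib)
      then have "cmod (X ?j ^ m - Y ?j ^ m) = t ?j ^ m * cmod Q"
        using t[of ?j] by (simp add: norm_mult norm_power)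
      ultimately show ?thesis by (simp add: power_mult_distrib)
    qed
    have "(\<lambda>k. \<kappa> ^ m * cmod (X (r k) ^ m - Y (r k) ^ m)) \<longlonglongrightarrow> \<kappa> ^ m * cmod (a ^ m - b ^ m)"
    proof -
      have "(\<lambda>k. X (r k)) \<longlonglongrightarrow> a" "(\<lambda>k. Y (r k)) \<longlonglongrightarrow> b"
        using LIMSEQ_subseq_LIMSEQ[OF lim1 r] LIMSEQ_subseq_LIMSEQ[OF lim2 r]
        by (auto simp: X_def Y_def o_def)
      then show ?thesis by (intro tendsto_intros)
    qed
    moreover have "(\<lambda>k. K * e k) \<longlonglongrightarrow> 0" using tendsto_mult[OF tendsto_const e] by force
    ultimately have "\<kappa> ^ m * cmod (a ^ m - b ^ m) \<le> 0"
      using key by (intro LIMSEQ_le) auto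
    then have "\<kappa> ^ m * cmod (a ^ m - b ^ m) \<le> \<kappa> ^ m * 0" by simp
    then have "cmod (a ^ m - b ^ m) \<le> 0"
      using \<kappa> by (subst (asm) mult_le_cancel_left_pos) auto
    then show ?thesis by simp
  qed
  define m where "m = max m0 (nat \<lceil>\<gamma>\<rceil> + 1)"
  have "m \<ge> m0" "real m > \<gamma>/2"
    using growth_pos unfolding m_def by linarith+
  \<comment> \<open>A single exponent determines a only up to a root of unity; two consecutive ones
    and a \<noteq> 0 leave no freedom.\<close>
  then have "a ^ m = b ^ m" "a ^ Suc m = b ^ Suc m"
    by (intro pow; simp)+
  then have "a * a ^ m = b * a ^ m" by simp
  then show ?thesis using a by simp
qed

end

section \<open>Hermitian forms and boundary fixed points\<close>

text \<open>For the linear fractional map with matrix \<open>M\<close>, \<open>hform\<close> is \<open>-M\<^sup>*JM\<close> on affine lifts, where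
  \<open>J = diag(I, -1)\<close>; \<open>hform_lin\<close> is its purely quadratic part.\<close>

definition hform ::
  "complex^'n^'n \<Rightarrow> complex^'n \<Rightarrow> complex^'n \<Rightarrow> complex \<Rightarrow> complex^'n \<Rightarrow> complex^'n \<Rightarrow> complex" where
  "hform A B C d z w = (hinner z C + d) * cnj (hinner w C + d) - hinner (A *v z + B) (A *v w + B)"

definition hform_lin :: "complex^'n^'n \<Rightarrow> complex^'n \<Rightarrow> complex^'n \<Rightarrow> complex^'n \<Rightarrow> complex" where
  "hform_lin A C z w = hinner z C * cnj (hinner w C) - hinner (A *v z) (A *v w)"

lemma hform_cnj: "cnj (hform A B C d z w) = hform A B C d w z"
  by (simp add: hform_def cnj_hinner mult.commute)

lemma matrix_vector_scale: "A *v (c *s x) = c *s (A *v (x :: complex^'n))"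
  by (rule vector_scalar_commute)

lemma hform_lin_add:
  "hform_lin A C (x + x') y = hform_lin A C x y + hform_lin A C x' y"
  "hform_lin A C x (y + y') = hform_lin A C x y + hform_lin A C x y'"
  by (simp_all add: hform_lin_def hinner_simps matrix_vector_right_distrib algebra_simps)

lemma hform_lin_scale:
  "hform_lin A C (c *s x) y = c * hform_lin A C x y"
  "hform_lin A C x (c *s y) = cnj c * hform_lin A C x y"
  by (simp_all add: hform_lin_def hinner_simps matrix_vector_scale algebra_simps)

text \<open>The form is affine in its first and conjugate affine in its second variable, so its
  mixed second difference at any base point u is the quadratic part.\<close>

lemma hform_expand:
  "hform A B C d (u + x) (u + y) = hform A B C d (u + x) u + hform A B C d u (u + y)
     - hform A B C d u u + hform_lin A C x y"
  by (simp add: hform_def hform_lin_def hinner_simps matrix_vector_right_distrib algebra_simps)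

lemma tendsto_hinner [tendsto_intros]:
  "(f \<longlongrightarrow> a) F \<Longrightarrow> (g \<longlongrightarrow> b) F \<Longrightarrow> ((\<lambda>x. hinner (f x) (g x)) \<longlongrightarrow> hinner a b) F"
  unfolding hinner_def by (intro tendsto_intros)

lemma tendsto_matrix_vector_mult [tendsto_intros]:
  fixes A :: "complex^'n^'m"
  shows "(f \<longlongrightarrow> a) F \<Longrightarrow> ((\<lambda>x. A *v f x) \<longlongrightarrow> A *v a) F"
  unfolding matrix_vector_mult_def by (intro tendsto_intros)

lemma tendsto_hform [tendsto_intros]:
  "(f \<longlongrightarrow> a) F \<Longrightarrow> (g \<longlongrightarrow> b) F \<Longrightarrow>
   ((\<lambda>x. hform A B C d (f x) (g x)) \<longlongrightarrow> hform A B C d a b) F"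
  unfolding hform_def by (intro tendsto_intros)

lemma tendsto_hform_lin [tendsto_intros]:
  "(f \<longlongrightarrow> a) F \<Longrightarrow> (g \<longlongrightarrow> b) F \<Longrightarrow>
   ((\<lambda>x. hform_lin A C (f x) (g x)) \<longlongrightarrow> hform_lin A C a b) F"
  unfolding hform_lin_def by (intro tendsto_intros)

text \<open>The data A, B, C, d will be those of the map applied first: of \<sigma> for \<phi>
  \<circ> \<sigma>, and of \<phi> for \<sigma> \<circ> \<phi>. In \<open>form\<close> the point w
  ranges over the whole space, so quotients of values of the form determine \<psi>.\<close>

locale hermitian_form_map =
  fixes \<psi> :: "complex^'n \<Rightarrow> complex^'n" and A :: "complex^'n^'n" and B C :: "complex^'n" and d :: complex
  assumes form: "norm z \<le> 1 \<Longrightarrow> 1 - hinner (\<psi> z) w = hform A B C d z w / hform A B C d z 0"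
    and den: "norm z \<le> 1 \<Longrightarrow> hform A B C d z 0 \<noteq> 0"
    and self: "norm z < 1 \<Longrightarrow> norm (\<psi> z) < 1"
    and self_closed: "norm z \<le> 1 \<Longrightarrow> norm (\<psi> z) \<le> 1"
begin

abbreviation "N \<equiv> hform A B C d"
abbreviation "Q \<equiv> hform_lin A C"

text \<open>The formula at the point \<eta> determines the form with \<eta> in its first slot;
  Hermitian symmetry transports this to the second.\<close>

lemma fixed_point_form:
  assumes "norm \<eta> = 1" "\<psi> \<eta> = \<eta>"
  shows "N z \<eta> = N 0 \<eta> * (1 - hinner z \<eta>)"
proof -
  have "N \<eta> z = N \<eta> 0 * (1 - hinner \<eta> z)"
    using form[of \<eta> z] den[of \<eta>] assms by (simp add: field_simps)
  then have "cnj (N \<eta> z) = cnj (N \<eta> 0) * cnj (1 - hinner \<eta> z)" by simp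
  then show ?thesis by (simp add: hform_cnj cnj_hinner)
qed

text \<open>The normal derivative at a boundary fixed point is \<open>r / cnj r\<close> for \<open>r = N 0 \<eta>\<close>; it is
  positive since the ball is mapped to itself.\<close>

lemma fixed_point_real:
  assumes \<eta>: "norm \<eta> = 1" "\<psi> \<eta> = \<eta>"
  shows "cnj (N 0 \<eta>) = N 0 \<eta>"
proof -
  define r where "r = N 0 \<eta>"
  have r0: "N \<eta> 0 = cnj r" by (simp add: r_def hform_cnj)
  have rn: "cnj r \<noteq> 0" using den[of \<eta>] \<eta> r0 by simp
  have h1: "hinner \<eta> \<eta> = 1" using \<eta> by (simp add: hinner_self)
  \<comment> \<open>For small s > 0 the point z = (1 - s y)\<eta> lies in the ball, where
    \<open>1 - hinner (\<psi> z) \<eta>\<close> equals s r y / \<open>N z 0\<close> and has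
    nonnegative real part. Dividing by s and letting s tend to 0 gives the claim.\<close>
  have pos: "Re (r * y / cnj r) \<ge> 0" if y: "Re y > 0" for y
  proof -
    define z where "z k = (1 - of_real (1 / real (Suc k)) * y) *s \<eta>" for k
    have s0: "(\<lambda>k. 1 / real (Suc k)) \<longlonglongrightarrow> 0" by (rule LIMSEQ_Suc[OF lim_1_over_n])
    have zlim: "z \<longlonglongrightarrow> \<eta>"
    proof -
      have "(\<lambda>k. \<chi> i. (1 - complex_of_real (1 / real (Suc k)) * y) * \<eta> $ i) \<longlonglongrightarrow> (\<chi> i. (1 - of_real 0 * y) * \<eta> $ i)"
        by (intro tendsto_vec_lambda tendsto_intros s0)
      then show ?thesis by (simp add: z_def[abs_def] vector_scalar_mult_def)
    qed
    have "\<forall>\<^sub>F k in sequentially. norm (z k) < 1"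
    proof -
      have "(\<lambda>k. 2 * Re y - (1 / real (Suc k)) * (cmod y)\<^sup>2) \<longlonglongrightarrow> 2 * Re y - 0 * (cmod y)\<^sup>2"
        by (intro tendsto_intros s0)
      then have "\<forall>\<^sub>F k in sequentially. 0 < 2 * Re y - (1 / real (Suc k)) * (cmod y)\<^sup>2"
        by (rule order_tendstoD(1)) (use y in simp)
      then show ?thesis
      proof eventually_elim
        case (elim k)
        define s where "s = 1 / real (Suc k)"
        have s: "s > 0" by (simp add: s_def)
        have "(cmod (1 - of_real s * y))\<^sup>2 = 1 - s * (2 * Re y - s * (cmod y)\<^sup>2)"
          unfolding cmod_power2 by (simp add: power2_eq_square algebra_simps)
        also have "\<dots> < 1" using s elim unfolding s_def[symmetric] by simp
        finally have "cmod (1 - of_real s * y) < 1" by (simp add: power_less_one_iff abs_square_less_1)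
        then show ?case unfolding z_def norm_scale_vec by (simp add: \<eta> s_def)
      qed
    qed
    then have "\<forall>\<^sub>F k in sequentially. 0 \<le> Re (r * y / N (z k) 0)"
    proof eventually_elim
      case (elim k)
      define s where "s = 1 / real (Suc k)"
      have s: "s > 0" by (simp add: s_def)
      have "1 - hinner (\<psi> (z k)) \<eta> = N (z k) \<eta> / N (z k) 0"
        using elim by (intro form) auto
      also have "N (z k) \<eta> = r * (of_real s * y)"
        by (subst fixed_point_form[OF \<eta>, of "z k"], unfold r_def[symmetric])
          (simp add: z_def hinner_simps h1 s_def)
      finally have e: "1 - hinner (\<psi> (z k)) \<eta> = of_real s * (r * y / N (z k) 0)" by simp
      have "cmod (hinner (\<psi> (z k)) \<eta>) \<le> norm (\<psi> (z k)) * norm \<eta>" by (rule cmod_hinner_le)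
      also have "\<dots> \<le> 1" using self[OF elim] \<eta> by simp
      finally have "Re (hinner (\<psi> (z k)) \<eta>) \<le> 1" using complex_Re_le_cmod order_trans by blast
      then have "0 \<le> Re (1 - hinner (\<psi> (z k)) \<eta>)" by simp
      moreover have "Re (of_real s * x) = s * Re x" for x by simp
      ultimately show ?case using s unfolding e by (simp only: zero_le_mult_iff) auto
    qed
    moreover have "(\<lambda>k. Re (r * y / N (z k) 0)) \<longlonglongrightarrow> Re (r * y / cnj r)"
      unfolding r0[symmetric] using rn r0 by (intro tendsto_intros zlim) auto
    ultimately show ?thesis by (intro tendsto_lowerbound) auto
  qed
  define u where "u = r / cnj r"
  have u1: "cmod u = 1" using rn by (simp add: u_def norm_divide)
  \<comment> \<open>Testing with y = 1 + i\<tau> for all real \<tau>: if Im u were not 0, the value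
    at \<tau> = (Re u + 1) / Im u would be -1.\<close>
  have "Re u - \<tau> * Im u \<ge> 0" for \<tau>
    using pos[of "Complex 1 \<tau>"] by (simp add: u_def[symmetric] times_divide_eq_left[symmetric] mult.commute del: times_divide_eq_left)
  from this[of 0] this[of "(Re u + 1) / Im u"] have "Im u = 0" "Re u \<ge> 0"
    by (cases "Im u = 0"; simp)+
  then have "u = 1" using u1 by (simp add: complex_eq_iff cmod_def)
  then show ?thesis using rn by (simp add: u_def r_def field_simps)
qed

text \<open>The constant term at \<eta> vanishes. The two linear terms have the factors r =
  \<open>N 0 \<eta>\<close> and its conjugate, which coincide because r is real.\<close>

lemma fixed_point_expand:
  assumes \<eta>: "norm \<eta> = 1" "\<psi> \<eta> = \<eta>"
  shows "N (\<eta> + x) (\<eta> + y) = - N 0 \<eta> * (hinner x \<eta> + cnj (hinner y \<eta>)) + Q x y"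
proof -
  have h1: "hinner \<eta> \<eta> = 1" using \<eta> by (simp add: hinner_self)
  have "N \<eta> (\<eta> + y) = cnj (N (\<eta> + y) \<eta>)" by (simp add: hform_cnj)
  also have "\<dots> = - N 0 \<eta> * cnj (hinner y \<eta>)"
    by (simp add: fixed_point_form[OF \<eta>, of "\<eta> + y"] fixed_point_real[OF \<eta>] hinner_simps h1)
  finally show ?thesis
    by (simp add: hform_expand fixed_point_form[OF \<eta>, of "\<eta> + x"] fixed_point_form[OF \<eta>, of \<eta>] hinner_simps h1 algebra_simps)
qed

end

section \<open>Parabolic approach to a boundary fixed point\<close>

text \<open>A step along \<alpha> with \<langle>\<alpha>, \<eta>\<rangle> imaginary is tangential to
  the sphere and leaves the ball at second order. The inward term of size s^2 \<kappa> compensates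
  this once 2\<kappa> > |\<alpha>|^2. The factor s is pulled out so that the sesquilinear part Q
  yields s^2 at once.\<close>

definition parabolic_curve :: "complex^'n \<Rightarrow> real \<Rightarrow> complex^'n \<Rightarrow> real \<Rightarrow> complex^'n" where
  "parabolic_curve \<eta> \<kappa> \<alpha> s = \<eta> + of_real s *s (\<alpha> - of_real (s * \<kappa>) *s \<eta>)"

lemma tendsto_scale_vec [tendsto_intros]:
  fixes f :: "'a \<Rightarrow> complex"
  shows "(f \<longlongrightarrow> a) F \<Longrightarrow> (g \<longlongrightarrow> b) F \<Longrightarrow> ((\<lambda>x. f x *s g x) \<longlongrightarrow> a *s b) F"
  unfolding vector_scalar_mult_def by (intro tendsto_intros)

lemma tendsto_parabolic_direction:
  assumes "s \<longlonglongrightarrow> 0"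
  shows "(\<lambda>k. \<alpha> - complex_of_real (s k * \<kappa>) *s \<eta>) \<longlonglongrightarrow> \<alpha>"
proof -
  have "(\<lambda>k. \<alpha> - complex_of_real (s k * \<kappa>) *s \<eta>) \<longlonglongrightarrow> \<alpha> - complex_of_real (0 * \<kappa>) *s \<eta>"
    by (intro tendsto_intros assms)
  then show ?thesis by simp
qed

lemma tendsto_parabolic_curve:
  assumes "s \<longlonglongrightarrow> 0"
  shows "(\<lambda>k. parabolic_curve \<eta> \<kappa> \<alpha> (s k)) \<longlonglongrightarrow> \<eta>"
proof -
  have "(\<lambda>k. parabolic_curve \<eta> \<kappa> \<alpha> (s k)) \<longlonglongrightarrow> \<eta> + complex_of_real 0 *s \<alpha>"
    unfolding parabolic_curve_def by (intro tendsto_add tendsto_const tendsto_scale_vec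
        tendsto_of_real assms tendsto_parabolic_direction)
  then show ?thesis by simp
qed

lemma parabolic_curve_hinner:
  assumes "norm \<eta> = 1" "hinner \<alpha> \<eta> = - \<i>"
  shows "hinner (of_real s *s (\<alpha> - of_real (s * \<kappa>) *s \<eta>)) \<eta> = - of_real s * \<i> - of_real (\<kappa> * s\<^sup>2)"
  using assms by (simp add: hinner_simps hinner_self algebra_simps power2_eq_square)

lemma parabolic_curve_norm:
  assumes "norm \<eta> = 1" "hinner \<alpha> \<eta> = - \<i>"
  shows "1 - (norm (parabolic_curve \<eta> \<kappa> \<alpha> s))\<^sup>2 = s\<^sup>2 * (2 * \<kappa> - (norm (\<alpha> - of_real (s * \<kappa>) *s \<eta>))\<^sup>2)"
proof -
  define y where "y = \<alpha> - complex_of_real (s * \<kappa>) *s \<eta>"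
  define x where "x = complex_of_real s *s y"
  have "x \<bullet> \<eta> = - \<kappa> * s\<^sup>2"
    using parabolic_curve_hinner[OF assms, of s \<kappa>] Re_hinner[of x \<eta>] by (simp add: x_def y_def)
  moreover have "(norm (\<eta> + x))\<^sup>2 = (norm \<eta>)\<^sup>2 + 2 * (x \<bullet> \<eta>) + (norm x)\<^sup>2"
    by (simp add: power2_norm_eq_inner inner_add_left inner_add_right inner_commute)
  moreover have "(norm x)\<^sup>2 = s\<^sup>2 * (norm y)\<^sup>2"
    by (simp add: x_def norm_scale_vec power_mult_distrib)
  ultimately have "1 - (norm (\<eta> + x))\<^sup>2 = s\<^sup>2 * (2 * \<kappa> - (norm y)\<^sup>2)"
    using assms(1) by (simp add: algebra_simps)
  then show ?thesis by (simp add: parabolic_curve_def x_def y_def)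
qed

text \<open>The gap of 1 in the hypotheses on \<kappa> yields the comparison with s^2 with constant
  1 for small s. Dropping an initial segment of the sequence 1/(k + 1) makes it hold for all k and
  for both curves.\<close>

lemma parabolic_parameters_exist:
  fixes \<eta> :: "complex^'n"
  assumes \<eta>: "norm \<eta> = 1" and \<alpha>: "hinner \<alpha> \<eta> = - \<i>" and \<beta>: "hinner \<beta> \<eta> = - \<i>"
    and \<kappa>: "2 * \<kappa> > (norm \<alpha>)\<^sup>2 + 1" "2 * \<kappa> > (norm \<beta>)\<^sup>2 + 1"
  shows "\<exists>s. (\<forall>k. s k > 0) \<and> s \<longlonglongrightarrow> 0
    \<and> (\<forall>k. (s k)\<^sup>2 \<le> 1 - (norm (parabolic_curve \<eta> \<kappa> \<alpha> (s k)))\<^sup>2)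
    \<and> (\<forall>k. (s k)\<^sup>2 \<le> 1 - (norm (parabolic_curve \<eta> \<kappa> \<beta> (s k)))\<^sup>2)"
proof -
  define s0 where "s0 k = 1 / real (Suc k)" for k
  have s0: "s0 \<longlonglongrightarrow> 0" unfolding s0_def by (rule LIMSEQ_Suc[OF lim_1_over_n])
  have ev: "\<forall>\<^sub>F k in sequentially. (s0 k)\<^sup>2 \<le> 1 - (norm (parabolic_curve \<eta> \<kappa> a (s0 k)))\<^sup>2"
    if a: "hinner a \<eta> = - \<i>" "2 * \<kappa> > (norm a)\<^sup>2 + 1" for a
  proof -
    have "(\<lambda>k. 2 * \<kappa> - (norm (a - complex_of_real (s0 k * \<kappa>) *s \<eta>))\<^sup>2) \<longlonglongrightarrow> 2 * \<kappa> - (norm a)\<^sup>2"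
      by (intro tendsto_intros tendsto_parabolic_direction s0)
    then have "\<forall>\<^sub>F k in sequentially. 1 < 2 * \<kappa> - (norm (a - complex_of_real (s0 k * \<kappa>) *s \<eta>))\<^sup>2"
      by (rule order_tendstoD(1)) (use a in simp)
    then show ?thesis
    proof eventually_elim
      case (elim k)
      then have "(s0 k)\<^sup>2 * 1 \<le> (s0 k)\<^sup>2 * (2 * \<kappa> - (norm (a - complex_of_real (s0 k * \<kappa>) *s \<eta>))\<^sup>2)"
        by (intro mult_left_mono) auto
      then show ?case using parabolic_curve_norm[OF \<eta> a(1)] by simp
    qed
  qed
  obtain k0 where k0: "\<And>k. k \<ge> k0 \<Longrightarrow> (s0 k)\<^sup>2 \<le> 1 - (norm (parabolic_curve \<eta> \<kappa> \<alpha> (s0 k)))\<^sup>2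
      \<and> (s0 k)\<^sup>2 \<le> 1 - (norm (parabolic_curve \<eta> \<kappa> \<beta> (s0 k)))\<^sup>2"
    using eventually_conj[OF ev[OF \<alpha> \<kappa>(1)] ev[OF \<beta> \<kappa>(2)]] unfolding eventually_sequentially by blast
  show ?thesis
  proof (intro exI conjI allI)
    show "s0 (k + k0) > 0" for k by (simp add: s0_def)
    show "(\<lambda>k. s0 (k + k0)) \<longlonglongrightarrow> 0" using s0 by (rule LIMSEQ_ignore_initial_segment)
  qed (use k0 in auto)
qed

context hermitian_form_map
begin

text \<open>Since \<alpha> and \<beta> have the same imaginary component along \<eta>, the terms of
  order s cancel, and N is s^2 times a convergent factor. The denominator \<open>N z 0\<close> tends
  to the real number \<open>N 0 \<eta>\<close>, so the limit depends on the form only through the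
  normalized Q.\<close>

lemma fixed_point_limit:
  assumes \<eta>: "norm \<eta> = 1" "\<psi> \<eta> = \<eta>" and \<alpha>: "hinner \<alpha> \<eta> = - \<i>" and \<beta>: "hinner \<beta> \<eta> = - \<i>"
    and s: "\<And>k. s k > 0" "s \<longlonglongrightarrow> 0" and ball: "\<And>k. norm (parabolic_curve \<eta> \<kappa> \<alpha> (s k)) < 1"
    and nz: "2 * of_real \<kappa> + Q \<alpha> \<beta> / N 0 \<eta> \<noteq> 0"
  shows "(\<lambda>k. of_real ((s k)\<^sup>2) / (1 - hinner (\<psi> (parabolic_curve \<eta> \<kappa> \<alpha> (s k))) (parabolic_curve \<eta> \<kappa> \<beta> (s k))))
    \<longlonglongrightarrow> 1 / (2 * of_real \<kappa> + Q \<alpha> \<beta> / N 0 \<eta>)"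
proof -
  define r where "r = N 0 \<eta>"
  have r0: "N \<eta> 0 = r" using fixed_point_real[OF \<eta>] by (metis hform_cnj r_def)
  have rn: "r \<noteq> 0" using den[of \<eta>] \<eta> r0 by simp
  define L where "L k = 2 * r * of_real \<kappa> + Q (\<alpha> - of_real (s k * \<kappa>) *s \<eta>) (\<beta> - of_real (s k * \<kappa>) *s \<eta>)" for k
  let ?z = "\<lambda>k. parabolic_curve \<eta> \<kappa> \<alpha> (s k)" and ?w = "\<lambda>k. parabolic_curve \<eta> \<kappa> \<beta> (s k)"
  have "N (?z k) (?w k) = of_real ((s k)\<^sup>2) * L k" for k
  proof -
    have "N (?z k) (?w k) = - r * (- of_real (s k) * \<i> - of_real (\<kappa> * (s k)\<^sup>2)
        + cnj (- of_real (s k) * \<i> - of_real (\<kappa> * (s k)\<^sup>2)))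
        + of_real (s k) * (of_real (s k) * Q (\<alpha> - of_real (s k * \<kappa>) *s \<eta>) (\<beta> - of_real (s k * \<kappa>) *s \<eta>))"
      unfolding parabolic_curve_def fixed_point_expand[OF \<eta>] parabolic_curve_hinner[OF \<eta>(1) \<alpha>]
        parabolic_curve_hinner[OF \<eta>(1) \<beta>] r_def[symmetric] hform_lin_scale by simp
    also have "\<dots> = of_real ((s k)\<^sup>2) * L k"
      by (simp add: L_def algebra_simps power2_eq_square)
    finally show ?thesis .
  qed
  then have eq: "of_real ((s k)\<^sup>2) / (1 - hinner (\<psi> (?z k)) (?w k)) = N (?z k) 0 / L k" for k
    using form[of "?z k" "?w k"] ball[of k] s(1)[of k] by simp
  have L: "L \<longlonglongrightarrow> 2 * r * of_real \<kappa> + Q \<alpha> \<beta>"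
    unfolding L_def by (intro tendsto_intros tendsto_parabolic_direction s)
  have L0: "2 * r * of_real \<kappa> + Q \<alpha> \<beta> = r * (2 * of_real \<kappa> + Q \<alpha> \<beta> / N 0 \<eta>)"
    using rn by (simp add: r_def[symmetric] algebra_simps)
  have "(\<lambda>k. N (?z k) 0 / L k) \<longlonglongrightarrow> N \<eta> 0 / (2 * r * of_real \<kappa> + Q \<alpha> \<beta>)"
    using L0 rn nz by (intro tendsto_divide L tendsto_hform tendsto_parabolic_curve tendsto_const s) auto
  also have "N \<eta> 0 / (2 * r * of_real \<kappa> + Q \<alpha> \<beta>) = 1 / (2 * of_real \<kappa> + Q \<alpha> \<beta> / N 0 \<eta>)"
    unfolding L0 r0 using rn by simp
  finally show ?thesis unfolding eq .
qed

text \<open>By the equality case of Cauchy-Schwarz, 1 - <\<psi> \<eta>, \<eta>> is not 0 if \<psi>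
  moves \<eta>. The denominators then stay away from 0 while s^2 tends to 0.\<close>

lemma not_fixed_point_limit:
  assumes \<eta>: "norm \<eta> = 1" "\<psi> \<eta> \<noteq> \<eta>"
    and s: "s \<longlonglongrightarrow> 0" and ball: "\<And>k. norm (parabolic_curve \<eta> \<kappa> \<alpha> (s k)) < 1"
  shows "(\<lambda>k. of_real ((s k)\<^sup>2) / (1 - hinner (\<psi> (parabolic_curve \<eta> \<kappa> \<alpha> (s k))) (parabolic_curve \<eta> \<kappa> \<beta> (s k))))
    \<longlonglongrightarrow> 0"
proof -
  let ?z = "\<lambda>k. parabolic_curve \<eta> \<kappa> \<alpha> (s k)" and ?w = "\<lambda>k. parabolic_curve \<eta> \<kappa> \<beta> (s k)"
  have "hinner (\<psi> \<eta>) \<eta> \<noteq> 1"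
    using hinner_eq_1_unit[of "\<psi> \<eta>" \<eta>] self_closed[of \<eta>] \<eta> by auto
  then have nz: "N \<eta> \<eta> / N \<eta> 0 \<noteq> 0"
    using form[of \<eta> \<eta>] \<eta> by (metis diff_eq_diff_eq diff_self order_refl)
  have d: "N \<eta> 0 \<noteq> 0" using den[of \<eta>] \<eta> by simp
  have "(\<lambda>k. complex_of_real ((s k)\<^sup>2) / (N (?z k) (?w k) / N (?z k) 0))
      \<longlonglongrightarrow> complex_of_real (0\<^sup>2) / (N \<eta> \<eta> / N \<eta> 0)"
    by (intro tendsto_divide tendsto_of_real tendsto_power tendsto_hform tendsto_parabolic_curve tendsto_const s d nz)
  moreover have "N (?z k) (?w k) / N (?z k) 0 = 1 - hinner (\<psi> (?z k)) (?w k)" for k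
    using form[of "?z k" "?w k"] ball[of k] by simp
  ultimately show ?thesis by simp
qed

end

text \<open>A fixed point of one map is enough, as compactness passes it on to the other. Only the
  forms divided by \<open>N 0 \<eta>\<close> can be recovered, but each map depends just on
  quotients of values of its form.\<close>

theorem (in kernel_growth_space) compact_difference_imp_eq:
  assumes f1: "hermitian_form_map \<psi>1 A1 B1 C1 d1" and f2: "hermitian_form_map \<psi>2 A2 B2 C2 d2"
    and cpt: "compact_operator_on H nrm (\<lambda>f z. comp_op \<psi>1 f z - comp_op \<psi>2 f z)"
    and \<eta>: "norm \<eta> = 1" and fix1: "\<psi>1 \<eta> = \<eta>" and x: "norm x < 1"
  shows "\<psi>1 x = \<psi>2 x"
proof -
  interpret F1: hermitian_form_map \<psi>1 A1 B1 C1 d1 by fact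
  interpret F2: hermitian_form_map \<psi>2 A2 B2 C2 d2 by fact
  define r1 r2 where "r1 = F1.N 0 \<eta>" and "r2 = F2.N 0 \<eta>"
  have h1: "hinner \<eta> \<eta> = 1" using \<eta> by (simp add: hinner_self)
  have large: "2 * of_real \<kappa> + a \<noteq> 0" if "\<kappa> > cmod a" for \<kappa> a
  proof
    assume "2 * of_real \<kappa> + a = 0"
    then have "2 * complex_of_real \<kappa> = - a" by (simp add: eq_neg_iff_add_eq_0)
    then have "cmod (2 * complex_of_real \<kappa>) = cmod a" by simp
    then show False using that norm_ge_zero[of a] by (simp add: norm_mult)
  qed
  have ball: "norm y < 1" if "s\<^sup>2 \<le> 1 - (norm y)\<^sup>2" "s > 0" for s :: real and y :: "complex^'n"
  proof -
    have "s\<^sup>2 > 0" using that by simp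
    then have "(norm y)\<^sup>2 < 1" using that by linarith
    then show ?thesis by (simp add: abs_square_less_1)
  qed
  have to1: "(\<lambda>k. 1 - (norm (parabolic_curve \<eta> \<kappa> \<beta> (s k)))\<^sup>2) \<longlonglongrightarrow> 0" if "s \<longlonglongrightarrow> 0" for s \<kappa> \<beta>
  proof -
    have "(\<lambda>k. 1 - (norm (parabolic_curve \<eta> \<kappa> \<beta> (s k)))\<^sup>2) \<longlonglongrightarrow> 1 - (norm \<eta>)\<^sup>2"
      by (intro tendsto_intros tendsto_parabolic_curve that)
    then show ?thesis using \<eta> by simp
  qed
  \<comment> \<open>If \<psi>2 moved \<eta>, the limits along one and the same curve would be
    nonzero for \<psi>1 and 0 for \<psi>2.\<close>
  have fix2: "\<psi>2 \<eta> = \<eta>"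
  proof (rule ccontr)
    assume nf: "\<psi>2 \<eta> \<noteq> \<eta>"
    define \<alpha> where "\<alpha> = (- \<i>) *s \<eta>"
    have \<alpha>: "hinner \<alpha> \<eta> = - \<i>" by (simp add: \<alpha>_def hinner_simps h1)
    \<comment> \<open>The squared norm keeps the curve inside the ball, and the last summand keeps
      the denominator of the limit away from 0.\<close>
    define \<kappa> where "\<kappa> = (norm \<alpha>)\<^sup>2 + 1 + cmod (F1.Q \<alpha> \<alpha> / r1)"
    have \<kappa>: "2 * \<kappa> > (norm \<alpha>)\<^sup>2 + 1" by (simp add: \<kappa>_def add_pos_nonneg add_strict_increasing)
    obtain s where s: "\<And>k. s k > 0" "s \<longlonglongrightarrow> 0"
      "\<And>k. (s k)\<^sup>2 \<le> 1 - (norm (parabolic_curve \<eta> \<kappa> \<alpha> (s k)))\<^sup>2"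
      using parabolic_parameters_exist[OF \<eta> \<alpha> \<alpha> \<kappa> \<kappa>] by blast
    have "cmod (F1.Q \<alpha> \<alpha> / r1) < \<kappa>" unfolding \<kappa>_def using zero_le_power2[of "norm \<alpha>"] by linarith
    then have nz: "2 * of_real \<kappa> + F1.Q \<alpha> \<alpha> / r1 \<noteq> 0" by (rule large)
    have "1 / (2 * of_real \<kappa> + F1.Q \<alpha> \<alpha> / r1) = 0"
    proof (rule compact_difference_limits_eq[OF cpt F1.self F2.self, where \<kappa> = 1])
      show "(\<lambda>k. of_real ((s k)\<^sup>2) / (1 - hinner (\<psi>1 (parabolic_curve \<eta> \<kappa> \<alpha> (s k))) (parabolic_curve \<eta> \<kappa> \<alpha> (s k))))
        \<longlonglongrightarrow> 1 / (2 * of_real \<kappa> + F1.Q \<alpha> \<alpha> / r1)"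
        unfolding r1_def
        by (rule F1.fixed_point_limit[OF \<eta> fix1 \<alpha> \<alpha> s(1,2) ball[OF s(3,1)] nz[unfolded r1_def]])
      show "(\<lambda>k. of_real ((s k)\<^sup>2) / (1 - hinner (\<psi>2 (parabolic_curve \<eta> \<kappa> \<alpha> (s k))) (parabolic_curve \<eta> \<kappa> \<alpha> (s k))))
        \<longlonglongrightarrow> 0"
        by (rule F2.not_fixed_point_limit[OF \<eta> nf s(2) ball[OF s(3,1)]])
      show "(s k)\<^sup>2 > 0" for k using s(1)[of k] by simp
    qed (use s(1) s(3) nz ball[OF s(3,1)] to1[OF s(2)] in auto)
    then show False using nz by simp
  qed
  have r1: "cnj r1 = r1" "r1 \<noteq> 0" and r2: "cnj r2 = r2" "r2 \<noteq> 0"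
    using F1.fixed_point_real[OF \<eta> fix1] F2.fixed_point_real[OF \<eta> fix2] F1.den[of \<eta>] F2.den[of \<eta>] \<eta>
      hform_cnj[of A1 B1 C1 d1 0 \<eta>] hform_cnj[of A2 B2 C2 d2 0 \<eta>]
    by (auto simp: r1_def r2_def)
  have slice: "F1.Q \<alpha> \<beta> / r1 = F2.Q \<alpha> \<beta> / r2" if \<alpha>: "hinner \<alpha> \<eta> = - \<i>" and \<beta>: "hinner \<beta> \<eta> = - \<i>" for \<alpha> \<beta>
  proof -
    define p1 p2 where "p1 = cmod (F1.Q \<alpha> \<beta> / r1)" and "p2 = cmod (F2.Q \<alpha> \<beta> / r2)"
    \<comment> \<open>\<kappa> may depend on \<alpha> and \<beta>, since it cancels when the two
      limits are equated.\<close>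
    define \<kappa> where "\<kappa> = (norm \<alpha>)\<^sup>2 + (norm \<beta>)\<^sup>2 + 1 + p1 + p2"
    have nn: "(norm \<alpha>)\<^sup>2 \<ge> 0" "(norm \<beta>)\<^sup>2 \<ge> 0" "p1 \<ge> 0" "p2 \<ge> 0"
      unfolding p1_def p2_def by simp_all
    have \<kappa>: "2 * \<kappa> > (norm \<alpha>)\<^sup>2 + 1" "2 * \<kappa> > (norm \<beta>)\<^sup>2 + 1"
    proof -
      have "x + 1 < 2 * (x + y + 1 + p1 + p2)" if "x \<ge> 0" "y \<ge> 0" for x y :: real
        using that nn(3,4) by argo
      from this[OF nn(1,2)] this[OF nn(2,1)] show "2 * \<kappa> > (norm \<alpha>)\<^sup>2 + 1" "2 * \<kappa> > (norm \<beta>)\<^sup>2 + 1"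
        by (simp_all add: \<kappa>_def algebra_simps)
    qed
    obtain s where s: "\<And>k. s k > 0" "s \<longlonglongrightarrow> 0"
      "\<And>k. (s k)\<^sup>2 \<le> 1 - (norm (parabolic_curve \<eta> \<kappa> \<alpha> (s k)))\<^sup>2"
      "\<And>k. (s k)\<^sup>2 \<le> 1 - (norm (parabolic_curve \<eta> \<kappa> \<beta> (s k)))\<^sup>2"
      using parabolic_parameters_exist[OF \<eta> \<alpha> \<beta> \<kappa>] by blast
    have c12: "cmod (F1.Q \<alpha> \<beta> / r1) < \<kappa>" "cmod (F2.Q \<alpha> \<beta> / r2) < \<kappa>"
    proof -
      have "p1 < x + y + 1 + p1 + p2" "p2 < x + y + 1 + p1 + p2" if "x \<ge> 0" "y \<ge> 0" for x y
        using that nn(3,4) by linarith+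
      from this[OF nn(1,2)] show "cmod (F1.Q \<alpha> \<beta> / r1) < \<kappa>" "cmod (F2.Q \<alpha> \<beta> / r2) < \<kappa>"
        by (simp_all only: \<kappa>_def p1_def p2_def)
    qed
    note nz = large[OF c12(1)] large[OF c12(2)]
    have "1 / (2 * of_real \<kappa> + F1.Q \<alpha> \<beta> / r1) = 1 / (2 * of_real \<kappa> + F2.Q \<alpha> \<beta> / r2)"
    proof (rule compact_difference_limits_eq[OF cpt F1.self F2.self, where \<kappa> = 1])
      show "(\<lambda>k. of_real ((s k)\<^sup>2) / (1 - hinner (\<psi>1 (parabolic_curve \<eta> \<kappa> \<alpha> (s k))) (parabolic_curve \<eta> \<kappa> \<beta> (s k))))
        \<longlonglongrightarrow> 1 / (2 * of_real \<kappa> + F1.Q \<alpha> \<beta> / r1)"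
        unfolding r1_def
        by (rule F1.fixed_point_limit[OF \<eta> fix1 \<alpha> \<beta> s(1,2) ball[OF s(3,1)] nz(1)[unfolded r1_def]])
      show "(\<lambda>k. of_real ((s k)\<^sup>2) / (1 - hinner (\<psi>2 (parabolic_curve \<eta> \<kappa> \<alpha> (s k))) (parabolic_curve \<eta> \<kappa> \<beta> (s k))))
        \<longlonglongrightarrow> 1 / (2 * of_real \<kappa> + F2.Q \<alpha> \<beta> / r2)"
        unfolding r2_def
        by (rule F2.fixed_point_limit[OF \<eta> fix2 \<alpha> \<beta> s(1,2) ball[OF s(3,1)] nz(2)[unfolded r2_def]])
      show "(s k)\<^sup>2 > 0" for k using s(1)[of k] by simp
    qed (use s(1) s(3,4) nz ball[OF s(3,1)] ball[OF s(4,1)] to1[OF s(2)] in auto)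
    then show ?thesis using nz by (simp add: field_simps)
  qed
  \<comment> \<open>So far E vanishes if both arguments have component -i along \<eta>. Scaling
    extends this to all pairs with nonzero components, and every vector is a sum of two vectors with
    nonzero component.\<close>
  define E where "E u v = F1.Q u v / r1 - F2.Q u v / r2" for u v
  have E_add: "E (u + u') v = E u v + E u' v" "E u (v + v') = E u v + E u v'" for u u' v v'
    by (simp_all add: E_def hform_lin_add add_divide_distrib)
  have E_scale: "E (c *s u) v = c * E u v" "E u (c *s v) = cnj c * E u v" for c u v
    by (simp_all add: E_def hform_lin_scale algebra_simps)
  have E_transversal: "E u v = 0" if "hinner u \<eta> \<noteq> 0" "hinner v \<eta> \<noteq> 0" for u v
  proof -
    define a b where "a = - \<i> / hinner u \<eta>" and "b = - \<i> / hinner v \<eta>"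
    have "E (a *s u) (b *s v) = 0"
      unfolding E_def using that by (subst slice) (simp_all add: a_def b_def hinner_simps)
    then have "cnj b * (a * E u v) = 0" by (simp only: E_scale)
    moreover have "a \<noteq> 0" "cnj b \<noteq> 0" using that by (simp_all add: a_def b_def)
    ultimately show ?thesis by (metis mult_eq_0_iff)
  qed
  have split: "\<exists>p q. u = p + q \<and> hinner p \<eta> \<noteq> 0 \<and> hinner q \<eta> \<noteq> 0" for u
  proof -
    define c where "c = (if hinner u \<eta> = 1 then 2 else 1 :: complex)"
    have "u = (u - c *s \<eta>) + c *s \<eta>" "hinner (u - c *s \<eta>) \<eta> \<noteq> 0" "hinner (c *s \<eta>) \<eta> \<noteq> 0"
      by (auto simp: c_def hinner_simps h1)
    then show ?thesis by blast
  qed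
  have "E u v = 0" for u v
  proof -
    obtain p q where "u = p + q" "hinner p \<eta> \<noteq> 0" "hinner q \<eta> \<noteq> 0" using split by blast
    moreover obtain p' q' where "v = p' + q'" "hinner p' \<eta> \<noteq> 0" "hinner q' \<eta> \<noteq> 0" using split by blast
    ultimately show ?thesis by (simp add: E_add E_transversal)
  qed
  then have QQ: "F1.Q u v / r1 = F2.Q u v / r2" for u v by (simp add: E_def)
  have NN: "F1.N u v / r1 = F2.N u v / r2" for u v
  proof -
    have "F1.N (\<eta> + (u - \<eta>)) (\<eta> + (v - \<eta>)) / r1 = F2.N (\<eta> + (u - \<eta>)) (\<eta> + (v - \<eta>)) / r2"
      unfolding F1.fixed_point_expand[OF \<eta> fix1] F2.fixed_point_expand[OF \<eta> fix2]
        r1_def[symmetric] r2_def[symmetric]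
      using r1(2) r2(2) QQ[of "u - \<eta>" "v - \<eta>"] by (simp add: diff_divide_distrib)
    then show ?thesis by simp
  qed
  show ?thesis
  proof (rule hinner_ext)
    fix w
    have "1 - hinner (\<psi>1 x) w = (F1.N x w / r1) / (F1.N x 0 / r1)"
      using F1.form[of x w] x r1(2) by simp
    also have "\<dots> = (F2.N x w / r2) / (F2.N x 0 / r2)" by (simp only: NN)
    also have "\<dots> = 1 - hinner (\<psi>2 x) w"
      using F2.form[of x w] x r2(2) by simp
    finally show "hinner (\<psi>1 x) w = hinner (\<psi>2 x) w" by simp
  qed
qed

section \<open>The adjoint map and its boundary behaviour\<close>

lemma conj_transpose_involution [simp]: "conj_transpose (conj_transpose A) = A"
  by (simp add: conj_transpose_def vec_eq_iff)

text \<open>The defining relation of the adjoint with denominators cleared: 1 - <\<phi> x, w> times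
  the denominator of \<phi> at x equals 1 - <x, \<sigma> w> times the conjugate of the denominator
  of \<sigma> at w.\<close>

lemma lin_frac_pairing:
  "hinner x C + d - hinner (A *v x + B) w
     = cnj (hinner w (- B) + cnj d) - hinner x (conj_transpose A *v w + - C)"
  by (simp add: hinner_simps hinner_conj_transpose' cnj_hinner)

lemma hinner_lin_frac_map:
  "hinner (lin_frac_map A B C d z) w = hinner (A *v z + B) w / (hinner z C + d)"
  by (simp only: lin_frac_map_def hinner_scale_left times_divide_eq_left mult_1)

lemma lin_frac_self_mapD:
  assumes "lin_frac_self_map A B C d"
  shows "norm z \<le> 1 \<Longrightarrow> hinner z C + d \<noteq> 0"
    and "norm z < 1 \<Longrightarrow> norm (lin_frac_map A B C d z) < 1"
  using assms by (auto simp: lin_frac_self_map_def image_subset_iff)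

lemma continuous_on_lin_frac_map:
  assumes "lin_frac_self_map A B C d"
  shows "continuous_on (cball 0 1) (lin_frac_map A B C d)"
  unfolding lin_frac_map_def
  by (intro continuous_intros) (use lin_frac_self_mapD(1)[OF assms] in auto)

lemma lin_frac_self_map_closed:
  assumes "lin_frac_self_map A B C d" "norm z \<le> 1"
  shows "norm (lin_frac_map A B C d z) \<le> 1"
proof -
  have "lin_frac_map A B C d ` closure (ball 0 1) \<subseteq> cball 0 1"
  proof (rule image_closure_subset)
    show "continuous_on (closure (ball 0 1)) (lin_frac_map A B C d)"
      using continuous_on_lin_frac_map[OF assms(1)] by simp
    show "lin_frac_map A B C d ` ball 0 1 \<subseteq> cball 0 1"
      using lin_frac_self_mapD(2)[OF assms(1)] by (force simp: less_imp_le)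
  qed simp
  then show ?thesis using assms(2) by (auto simp: image_subset_iff)
qed

text \<open>For x, w in the closed ball, one of them in the open ball, 1 - <\<phi> x, w> is not 0,
  hence neither is the other side of the pairing. If \<sigma> sent a point w out of the open ball,
  some x in the closed ball would make it 0.\<close>

lemma adjoint_lin_frac_self_map:
  assumes L: "lin_frac_self_map A B C d"
  shows "lin_frac_self_map (conj_transpose A) (- C) (- B) (cnj d)"
proof -
  let ?\<delta> = "\<lambda>w. hinner w (- B) + cnj d" and ?a = "\<lambda>w. conj_transpose A *v w + - C"
  have nz: "cnj (?\<delta> w) - hinner x (?a w) \<noteq> 0"
    if x: "norm x \<le> 1" and w: "norm w \<le> 1" and xw: "norm x < 1 \<or> norm w < 1" for x w
  proof -
    have d: "hinner x C + d \<noteq> 0" using lin_frac_self_mapD(1)[OF L x] .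
    have "1 - hinner (lin_frac_map A B C d x) w \<noteq> 0"
    proof (cases "norm w < 1")
      case True
      then show ?thesis using lin_frac_self_map_closed[OF L x] by (intro one_minus_hinner_nonzero)
    next
      case False
      then have "1 - hinner w (lin_frac_map A B C d x) \<noteq> 0"
        using lin_frac_self_mapD(2)[OF L] xw w by (intro one_minus_hinner_nonzero) auto
      then show ?thesis by (metis cnj_hinner complex_cnj_one complex_cnj_cancel_iff right_minus_eq)
    qed
    then have "hinner x C + d - hinner (A *v x + B) w \<noteq> 0"
      using d by (simp add: hinner_lin_frac_map field_simps)
    then show ?thesis by (simp only: lin_frac_pairing not_False_eq_True)
  qed
  \<comment> \<open>At x = 0 the pairing reduces to the conjugate denominator. As 0 is an interior
    point, this also covers |w| = 1.\<close>
  have \<delta>: "?\<delta> w \<noteq> 0" if "norm w \<le> 1" for w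
    using nz[of 0 w] that by (simp del: complex_cnj_add)
  have "norm (lin_frac_map (conj_transpose A) (- C) (- B) (cnj d) w) < 1" if w: "norm w < 1" for w
  proof -
    have "norm (?a w) < cmod (?\<delta> w)"
    proof (rule ccontr)
      assume "\<not> norm (?a w) < cmod (?\<delta> w)"
      then have ge: "cmod (?\<delta> w) \<le> norm (?a w)" by simp
      moreover have "cmod (?\<delta> w) > 0" using \<delta>[of w] w by simp
      ultimately have a: "norm (?a w) > 0" by linarith
      \<comment> \<open>The multiple of \<open>?a w\<close> whose product with \<open>?a w\<close>
        is the conjugate denominator. It lies in the closed ball precisely because \<sigma> w is
        assumed not to lie in the open one.\<close>
      define x where "x = (cnj (?\<delta> w) / of_real ((norm (?a w))\<^sup>2)) *s ?a w"
      have "norm x = cmod (?\<delta> w) / norm (?a w)"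
        unfolding x_def norm_scale_vec using a by (simp add: norm_divide norm_mult power2_eq_square del: complex_cnj_add)
      then have "norm x \<le> 1" using ge a by simp
      moreover have "hinner x (?a w) = cnj (?\<delta> w)"
        unfolding x_def hinner_scale_left hinner_self using a by (simp del: complex_cnj_add)
      ultimately show False using nz[of x w] w by simp
    qed
    moreover have "norm (lin_frac_map (conj_transpose A) (- C) (- B) (cnj d) w) = norm (?a w) / cmod (?\<delta> w)"
      unfolding lin_frac_map_def norm_scale_vec by (simp add: norm_divide)
    ultimately show ?thesis using \<delta>[of w] w by (simp add: divide_less_eq)
  qed
  with \<delta> show ?thesis by (auto simp: lin_frac_self_map_def)
qed

text \<open>The pairing moves \<phi> from the first slot to \<sigma> in the second: up to
  denominators, 1 - <\<phi> (\<sigma> z), w> becomes 1 - <\<sigma> z, \<sigma> w>, which is the form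
  of \<sigma>. The case w = 0 gives the denominator of \<phi> at \<sigma> z.\<close>

lemma comp_adjoint_hermitian_form_map:
  fixes A :: "complex^'n^'n"
  assumes L: "lin_frac_self_map A B C d"
  shows "hermitian_form_map (lin_frac_map A B C d \<circ> adjoint_map A B C d) (conj_transpose A) (- C) (- B) (cnj d)"
proof
  let ?\<sigma> = "adjoint_map A B C d" and ?N = "hform (conj_transpose A) (- C) (- B) (cnj d)"
  note L' = adjoint_lin_frac_self_map[OF L]
  fix z :: "complex^'n"
  show "norm ((lin_frac_map A B C d \<circ> ?\<sigma>) z) < 1" if "norm z < 1"
    using that lin_frac_self_mapD(2)[OF L'] lin_frac_self_mapD(2)[OF L] by (simp add: adjoint_map_def)
  show "norm ((lin_frac_map A B C d \<circ> ?\<sigma>) z) \<le> 1" if "norm z \<le> 1"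
    using that lin_frac_self_map_closed[OF L'] lin_frac_self_map_closed[OF L] by (simp add: adjoint_map_def)
  assume z: "norm z \<le> 1"
  define \<delta> where "\<delta> w = hinner w (- B) + cnj d" for w
  define P where "P = hinner (?\<sigma> z) C + d"
  have \<delta>: "\<delta> z \<noteq> 0" unfolding \<delta>_def using lin_frac_self_mapD(1)[OF L' z] .
  have P: "P \<noteq> 0"
    unfolding P_def using lin_frac_self_map_closed[OF L' z]
    by (intro lin_frac_self_mapD(1)[OF L]) (simp add: adjoint_map_def)
  have num: "P - hinner (A *v ?\<sigma> z + B) w = ?N z w / \<delta> z" for w
  proof -
    have "hinner (?\<sigma> z) (conj_transpose A *v w + - C)
        = hinner (conj_transpose A *v z + - C) (conj_transpose A *v w + - C) / \<delta> z"
      unfolding adjoint_map_def hinner_lin_frac_map \<delta>_def ..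
    then have "P - hinner (A *v ?\<sigma> z + B) w
        = cnj (\<delta> w) - hinner (conj_transpose A *v z + - C) (conj_transpose A *v w + - C) / \<delta> z"
      unfolding P_def lin_frac_pairing \<delta>_def by simp
    also have "\<dots> = ?N z w / \<delta> z"
      unfolding hform_def \<delta>_def[symmetric] using \<delta> by (simp add: diff_divide_distrib)
    finally show ?thesis .
  qed
  have P0: "P = ?N z 0 / \<delta> z" using num[of 0] by simp
  show den: "?N z 0 \<noteq> 0" using P P0 by auto
  fix w
  have "1 - hinner ((lin_frac_map A B C d \<circ> ?\<sigma>) z) w = (P - hinner (A *v ?\<sigma> z + B) w) / P"
    unfolding o_def hinner_lin_frac_map P_def[symmetric] using P by (simp add: diff_divide_distrib)
  also have "\<dots> = ?N z w / ?N z 0"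
    using \<delta> by (simp only: num) (subst P0, simp)
  finally show "1 - hinner ((lin_frac_map A B C d \<circ> ?\<sigma>) z) w = ?N z w / ?N z 0" .
qed

text \<open>Taking adjoints is an involution on the data, so this is the preceding fact for \<sigma>
  in place of \<phi>.\<close>

lemma adjoint_comp_hermitian_form_map:
  assumes "lin_frac_self_map A B C d"
  shows "hermitian_form_map (adjoint_map A B C d \<circ> lin_frac_map A B C d) A B C d"
  using comp_adjoint_hermitian_form_map[OF adjoint_lin_frac_self_map[OF assms]]
  by (simp add: adjoint_map_def)

text \<open>By compactness the supremum is attained, at some \<zeta> with |\<phi> \<zeta>| = 1. For
  \<eta> = \<phi> \<zeta> the pairing of \<zeta> and \<eta> vanishes, so <\<sigma> \<eta>, \<zeta>>
  = 1 and the equality case of Cauchy-Schwarz gives \<sigma> \<eta> = \<zeta>.\<close>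

lemma boundary_fixed_point:
  fixes A :: "complex^'n^'n"
  assumes L: "lin_frac_self_map A B C d" and sup: "sup_norm_ball (lin_frac_map A B C d) = 1"
  shows "\<exists>\<eta>. norm \<eta> = 1 \<and> (lin_frac_map A B C d \<circ> adjoint_map A B C d) \<eta> = \<eta>"
proof -
  let ?\<phi> = "lin_frac_map A B C d" and ?\<sigma> = "adjoint_map A B C d"
  have "\<exists>x\<in>cball 0 1. \<forall>y\<in>cball 0 1. norm (?\<phi> y) \<le> norm (?\<phi> x)"
    by (intro continuous_attains_sup continuous_on_norm continuous_on_lin_frac_map L) auto
  then obtain \<zeta> where \<zeta>: "norm \<zeta> \<le> 1" and max: "\<And>y. norm y \<le> 1 \<Longrightarrow> norm (?\<phi> y) \<le> norm (?\<phi> \<zeta>)"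
    by auto
  have "sup_norm_ball ?\<phi> \<le> norm (?\<phi> \<zeta>)"
    unfolding sup_norm_ball_def using max by (intro cSUP_least) auto
  then have n1: "norm (?\<phi> \<zeta>) = 1" using sup lin_frac_self_map_closed[OF L \<zeta>] by simp
  define \<eta> where "\<eta> = ?\<phi> \<zeta>"
  have \<eta>: "norm \<eta> = 1" using n1 by (simp add: \<eta>_def)
  have "hinner (?\<phi> \<zeta>) \<eta> = 1" using \<eta> by (simp add: \<eta>_def hinner_self)
  then have "hinner (A *v \<zeta> + B) \<eta> = hinner \<zeta> C + d"
    using lin_frac_self_mapD(1)[OF L \<zeta>] by (simp add: hinner_lin_frac_map)
  then have e: "cnj (hinner \<eta> (- B) + cnj d) = hinner \<zeta> (conj_transpose A *v \<eta> + - C)"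
    using lin_frac_pairing[of \<zeta> C d A B \<eta>] by simp
  have d: "hinner \<eta> (- B) + cnj d \<noteq> 0"
    using lin_frac_self_mapD(1)[OF adjoint_lin_frac_self_map[OF L]] \<eta> by simp
  have "hinner (?\<sigma> \<eta>) \<zeta> = cnj (hinner \<zeta> (conj_transpose A *v \<eta> + - C)) / (hinner \<eta> (- B) + cnj d)"
    unfolding adjoint_map_def hinner_lin_frac_map cnj_hinner ..
  also have "\<dots> = 1" unfolding e[symmetric] using d by (simp del: complex_cnj_add)
  finally have "?\<sigma> \<eta> = \<zeta>"
    using lin_frac_self_map_closed[OF adjoint_lin_frac_self_map[OF L], of \<eta>] \<eta> \<zeta>
    by (intro hinner_eq_1_unit) (auto simp: adjoint_map_def)
  then show ?thesis using \<eta> by (auto simp: \<eta>_def)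
qed

section \<open>The converse: functions vanishing on the ball\<close>

lemma space_sphere_measure: "space (sphere_measure :: (complex^'n) measure) = sphere 0 1"
  by (simp add: sphere_measure_def space_restrict_space)

lemma space_ball_measure: "space (ball_measure :: (complex^'n) measure) = ball 0 1"
  by (simp add: ball_measure_def space_restrict_space)

lemma hardy_sqnorm_zero:
  fixes f :: "complex^'n \<Rightarrow> complex"
  assumes "\<And>z. norm z < 1 \<Longrightarrow> f z = 0"
  shows "hardy_sqnorm f = 0"
proof -
  have "(\<integral>\<^sup>+\<zeta>. ennreal ((cmod (f (r *\<^sub>R \<zeta>)))\<^sup>2) \<partial>sphere_measure) = (\<integral>\<^sup>+\<zeta>. 0 \<partial>(sphere_measure :: (complex^'n) measure))"
    if "0 < r" "r < 1" for r
    using that assms by (intro nn_integral_cong) (auto simp: space_sphere_measure)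
  then show ?thesis unfolding hardy_sqnorm_def by (simp add: SUP_eq_const)
qed

lemma bergman_sqnorm_zero:
  fixes f :: "complex^'n \<Rightarrow> complex"
  assumes "\<And>z. norm z < 1 \<Longrightarrow> f z = 0"
  shows "bergman_sqnorm s f = 0"
proof -
  have "bergman_sqnorm s f = (\<integral>\<^sup>+z. 0 \<partial>(ball_measure :: (complex^'n) measure))"
    unfolding bergman_sqnorm_def using assms by (intro nn_integral_cong) (auto simp: space_ball_measure)
  then show ?thesis by simp
qed

lemma holomorphic_on_ball_zero:
  fixes f :: "complex^'n \<Rightarrow> complex"
  assumes "\<And>z. norm z < 1 \<Longrightarrow> f z = 0"
  shows "holomorphic_on_ball f"
  unfolding holomorphic_on_ball_def
proof
  fix z :: "complex^'n" assume z: "z \<in> ball 0 1"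
  have "((\<lambda>_. 0) has_derivative (\<lambda>_. 0)) (at z)" by (rule has_derivative_const)
  then have "(f has_derivative (\<lambda>_. 0)) (at z)"
    by (rule has_derivative_transform_within_open[OF _ open_ball z]) (use assms in auto)
  then show "\<exists>L. (f has_derivative L) (at z) \<and> (\<forall>c v. L (c *s v) = c * L v)"
    by (intro exI[of _ "\<lambda>_. 0"]) auto
qed

text \<open>Maps that agree on the ball may differ outside it, so the difference operator need not
  be 0 on total functions. Membership and norm see only the ball, hence the limit 0 works for every
  sequence without thinning it out.\<close>

lemma compact_operator_on_zero:
  fixes H :: "(complex^'n \<Rightarrow> complex) set"
  assumes "\<And>f. (\<And>z. norm z < 1 \<Longrightarrow> f z = 0) \<Longrightarrow> f \<in> H \<and> nrm f = 0"
    and "\<And>f z. norm z < 1 \<Longrightarrow> T f z = 0"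
  shows "compact_operator_on H nrm T"
  unfolding compact_operator_on_def
proof (intro conjI ballI allI impI)
  show "T f \<in> H" for f using assms by blast
  fix F :: "nat \<Rightarrow> complex^'n \<Rightarrow> complex"
  have "nrm (\<lambda>z. T (F k) z - 0) = 0" for k using assms by simp
  then show "\<exists>g\<in>H. \<exists>r :: nat \<Rightarrow> nat. strict_mono r \<and> (\<lambda>k. nrm (\<lambda>z. T (F (r k)) z - g z)) \<longlonglongrightarrow> 0"
    using assms(1)[of "\<lambda>_. 0"]
    by (intro bexI[of _ "\<lambda>_. 0"] exI[of _ "\<lambda>k. k"]) (auto simp: strict_mono_def)
qed

theorem theorem3p2:
  fixes A :: "complex^'n^'n" and B C :: "complex^'n" and d :: complex
    and \<phi> \<sigma> :: "complex^'n \<Rightarrow> complex^'n"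
  assumes "lin_frac_self_map A B C d"
    and "\<phi> = lin_frac_map A B C d"
    and "\<sigma> = adjoint_map A B C d"
    and "sup_norm_ball \<phi> = 1"
  shows "(compact_operator_on hardy_space hardy_norm
            (\<lambda>f z. comp_op (\<phi> \<circ> \<sigma>) f z - comp_op (\<sigma> \<circ> \<phi>) f z)
          \<longleftrightarrow> (\<forall>z\<in>ball 0 1. (\<phi> \<circ> \<sigma>) z = (\<sigma> \<circ> \<phi>) z))
       \<and> (\<forall>s::real. s > -1 \<longrightarrow>
            (compact_operator_on (bergman_space s) (bergman_norm s)
               (\<lambda>f z. comp_op (\<phi> \<circ> \<sigma>) f z - comp_op (\<sigma> \<circ> \<phi>) f z)
             \<longleftrightarrow> (\<forall>z\<in>ball 0 1. (\<phi> \<circ> \<sigma>) z = (\<sigma> \<circ> \<phi>) z)))"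
proof -
  have L: "lin_frac_self_map A B C d" by fact
  have f1: "hermitian_form_map (\<phi> \<circ> \<sigma>) (conj_transpose A) (- C) (- B) (cnj d)"
    and f2: "hermitian_form_map (\<sigma> \<circ> \<phi>) A B C d"
    using comp_adjoint_hermitian_form_map[OF L] adjoint_comp_hermitian_form_map[OF L] assms by auto
  obtain \<eta> where \<eta>: "norm \<eta> = 1" "(\<phi> \<circ> \<sigma>) \<eta> = \<eta>"
    using boundary_fixed_point[OF L] assms by auto
  have only_if: "\<forall>z\<in>ball 0 1. (\<phi> \<circ> \<sigma>) z = (\<sigma> \<circ> \<phi>) z"
    if "kernel_growth_space H nrm \<gamma>"
      "compact_operator_on H nrm (\<lambda>f z. comp_op (\<phi> \<circ> \<sigma>) f z - comp_op (\<sigma> \<circ> \<phi>) f z)" for H nrm \<gamma>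
    using kernel_growth_space.compact_difference_imp_eq[OF that(1) f1 f2 that(2) \<eta>] by simp
  have "if": "compact_operator_on H nrm (\<lambda>f z. comp_op (\<phi> \<circ> \<sigma>) f z - comp_op (\<sigma> \<circ> \<phi>) f z)"
    if "\<forall>z\<in>ball 0 1. (\<phi> \<circ> \<sigma>) z = (\<sigma> \<circ> \<phi>) z"
      and "\<And>f. (\<And>z. norm z < 1 \<Longrightarrow> f z = 0) \<Longrightarrow> f \<in> H \<and> nrm f = 0"
    for H :: "(complex^'n \<Rightarrow> complex) set" and nrm
    using that(1) by (intro compact_operator_on_zero that(2)) (auto simp: comp_op_def)
  have hardy0: "f \<in> hardy_space \<and> hardy_norm f = 0"
    if "\<And>z. norm z < 1 \<Longrightarrow> f z = 0" for f :: "complex^'n \<Rightarrow> complex"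
    using hardy_sqnorm_zero[of f] holomorphic_on_ball_zero[of f] that
    by (simp add: hardy_space_def hardy_norm_def)
  have bergman0: "f \<in> bergman_space s \<and> bergman_norm s f = 0"
    if "\<And>z. norm z < 1 \<Longrightarrow> f z = 0" for f :: "complex^'n \<Rightarrow> complex" and s
    using bergman_sqnorm_zero[of f] holomorphic_on_ball_zero[of f] that
    by (simp add: bergman_space_def bergman_norm_def)
  show ?thesis
  proof (intro conjI allI impI iffI)
    show "\<forall>z\<in>ball 0 1. (\<phi> \<circ> \<sigma>) z = (\<sigma> \<circ> \<phi>) z"
      if "compact_operator_on hardy_space hardy_norm (\<lambda>f z. comp_op (\<phi> \<circ> \<sigma>) f z - comp_op (\<sigma> \<circ> \<phi>) f z)"
      using only_if[OF hardy_kernel_growth_space that] .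
    show "compact_operator_on hardy_space hardy_norm (\<lambda>f z. comp_op (\<phi> \<circ> \<sigma>) f z - comp_op (\<sigma> \<circ> \<phi>) f z)"
      if "\<forall>z\<in>ball 0 1. (\<phi> \<circ> \<sigma>) z = (\<sigma> \<circ> \<phi>) z"
      using "if"[OF that hardy0] .
    fix s :: real assume s: "s > -1"
    show "\<forall>z\<in>ball 0 1. (\<phi> \<circ> \<sigma>) z = (\<sigma> \<circ> \<phi>) z"
      if "compact_operator_on (bergman_space s) (bergman_norm s) (\<lambda>f z. comp_op (\<phi> \<circ> \<sigma>) f z - comp_op (\<sigma> \<circ> \<phi>) f z)"
      using only_if[OF bergman_kernel_growth_space[OF s] that] .
    show "compact_operator_on (bergman_space s) (bergman_norm s) (\<lambda>f z. comp_op (\<phi> \<circ> \<sigma>) f z - comp_op (\<sigma> \<circ> \<phi>) f z)"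
      if "\<forall>z\<in>ball 0 1. (\<phi> \<circ> \<sigma>) z = (\<sigma> \<circ> \<phi>) z"
      using "if"[OF that bergman0] .
  qed
qed

end
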